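(* Let $J \subset \mathbb{R}^2$ be a Jordan curve. If $J$ is smoothly pierceable at some point, then $J$ is a funnel section of a two dimensional ODE.
   Context: For a continuous $f:\mathbb{R}\times\mathbb{R}^m\to\mathbb{R}^m$ with compact support and $(t_0,y_0)\in\mathbb{R}\times\mathbb{R}^m$, $t_1\in\mathbb{R}$, let $K_{t_1}(t_0,y_0,f)\subset\mathbb{R}^m$ be the set of all values $y(t_1)$ where $y:\mathbb{R}\to\mathbb{R}^m$ is a $C^1$ solution of $y'=f(t,y)$ with $y(t_0)=y_0$ (solutions need not be unique). A set $K\subset\mathbb{R}^m$ is a funnel section of an $m$-dimensional ODE if $K=K_{t_1}(t_0,y_0,f)$ for some such $f,t_0,y_0,t_1$. A Jordan curve in $\mathbb{R}^2$ is a homeomorphic image of the circle. An arc pierces $J$ if it meets $J$ at a single point $p$ and passes from one connected component of $\mathbb{R}^2\setminus J$ to the other. $J$ is smoothly pierceable at $p\in J$ if there is a smooth arc (the image of a compact interval under a $C^\infty$ embedding) that pierces $J$ at $p$. *)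

theory Defs
  imports "HOL-Analysis.Analysis"
begin

definition funnel_section_at ::
  "real \<Rightarrow> real \<Rightarrow> real ^ 'm \<Rightarrow> (real \<times> (real ^ 'm) \<Rightarrow> real ^ 'm) \<Rightarrow> (real ^ 'm) set" where
  "funnel_section_at t1 t0 y0 f =
     {y t1 | y. y C1_differentiable_on UNIV \<and>
                (\<forall>t. (y has_vector_derivative f (t, y t)) (at t)) \<and> y t0 = y0}"

definition funnel_section :: "(real ^ 'm) set \<Rightarrow> bool" where
  "funnel_section K \<longleftrightarrow>
     (\<exists>f t0 y0 t1. continuous_on UNIV f \<and> compact (closure {x. f x \<noteq> 0}) \<and>
                   K = funnel_section_at t1 t0 y0 f)"

definition Jordan_curve :: "(real ^ 2) set \<Rightarrow> bool" where
  "Jordan_curve J \<longleftrightarrow> J homeomorphic sphere (0 :: real ^ 2) 1"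

text \<open>
  Derivatives of all orders on the closed interval, one-sided at its two end points;
  \<open>D n\<close> is the \<open>n\<close>-th derivative.
\<close>

definition smooth_on_interval ::
  "real \<Rightarrow> real \<Rightarrow> (real \<Rightarrow> 'a::real_normed_vector) \<Rightarrow> bool" where
  "smooth_on_interval a b g \<longleftrightarrow>
     (\<exists>D :: nat \<Rightarrow> real \<Rightarrow> 'a. D 0 = g \<and>
        (\<forall>n. \<forall>t\<in>{a..b}. (D n has_vector_derivative D (Suc n) t) (at t within {a..b})))"

text \<open>
  An embedding is an injective immersion that is a homeomorphism onto its image.
  The last property is automatic here, as the interval is compact.
\<close>

definition smooth_embedding ::
  "real \<Rightarrow> real \<Rightarrow> (real \<Rightarrow> 'a::real_normed_vector) \<Rightarrow> bool" where
  "smooth_embedding a b g \<longleftrightarrow>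
     a < b \<and> smooth_on_interval a b g \<and> inj_on g {a..b} \<and>
     (\<forall>t\<in>{a..b}. vector_derivative g (at t within {a..b}) \<noteq> 0)"

text \<open>
  Since the arc meets \<open>J\<close> only in \<open>p\<close>, having its end points in different components of the
  complement forces everything before \<open>p\<close> to lie in one of them and everything after \<open>p\<close>
  in the other.
\<close>

definition pierces ::
  "real \<Rightarrow> real \<Rightarrow> (real \<Rightarrow> real ^ 2) \<Rightarrow> (real ^ 2) set \<Rightarrow> real ^ 2 \<Rightarrow> bool" where
  "pierces a b g J p \<longleftrightarrow>
     g ` {a..b} \<inter> J = {p} \<and>
     (\<exists>U\<in>components (- J). \<exists>V\<in>components (- J). U \<noteq> V \<and> g a \<in> U \<and> g b \<in> V)"

definition smoothly_pierceable_at :: "(real ^ 2) set \<Rightarrow> real ^ 2 \<Rightarrow> bool" where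
  "smoothly_pierceable_at J p \<longleftrightarrow> (\<exists>a b g. smooth_embedding a b g \<and> pierces a b g J p)"

end

theory Submission
  imports Defs "HOL-Complex_Analysis.Complex_Analysis"
begin

text \<open>
  A funnel section can be prescribed by moving an arc. Let a straight segment be carried by
  successive isotopies through arcs \<open>a 0\<close>, \<open>a 1\<close>, \<open>a 2\<close> and so on, and let the isotopy from
  \<open>a n\<close> to \<open>a (Suc n)\<close> have speed at most \<open>C / 4 ^ n\<close> when it is run in unit time. Run it in time
  \<open>1 / 2 ^ Suc n\<close> instead: the speeds then still tend to 0, so the velocities of the moving arcs extend to a
  vector field that is continuous up to the final time. Before the final time the field is
  Lipschitz along the arcs, so a solution that starts on the segment is dragged along and ends at
  the limit of its points \<open>a n c\<close>. A single point funnels out to the initial segment, by the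
  nonuniqueness of solutions. Hence the set of all limits is a funnel section
  (\<open>funnel_section_limit_of_moves\<close>). The limit map need not be injective, and this is what allows
  an arc to close up to a curve exactly at the final time.

  It remains to exhaust a Jordan curve \<open>J\<close> by arcs in this way. Let \<open>G\<close> be the inside of \<open>J\<close>, and
  map the unit disc conformally onto \<open>G\<close>. The arcs are the images of circular arcs whose radius
  tends to 1 and whose two ends tend to the point \<open>-1\<close> of the circle. As \<open>J\<close> is locally connected,
  the conformal map oscillates little near each point of the circle
  (\<open>conformal_map_uniformly_close_near_boundary\<close>, in the spirit of Caratheodory). So the points of
  the arcs converge, their limits fill \<open>J\<close>, and the tracks of points between late arcs have small
  diameter.

  Small diameter is not enough, since the speed in the first paragraph bounds the length of a track,
  and this length may be large however small the diameter. The remedy is to compress before moving.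
  Shrink the central part of every cell of a square lattice of mesh \<open>\<delta>\<close> to a tiny square, while the rest of the
  plane is stretched; move the arc; then undo the compression. Compressing and undoing displaces no
  point by more than \<open>2 * \<delta>\<close>, and tracks that stay in the compressed squares become as short as
  desired. Four translates of the lattice suffice to treat every point of the arc
  (\<open>arc_move_in_cores\<close> and \<open>arc_move_small_tracks\<close>). So arcs whose tracks have small diameter can be
  moved into each other at small speed.
\<close>

section \<open>Moving arcs and vector fields that carry them\<close>

text \<open>
  The time interval of the motion is \<open>{0..1}\<close>, and the arc rests before and after it, so that
  motions can be concatenated and still be continuously differentiable in time. The Lipschitz bound compares
  velocities with positions rather than with parameters; it is what makes the velocity field Lipschitz on each arc,
  and it forces distinct points to stay distinct.
\<close>

definition moving_arc ::
  "real \<Rightarrow> real \<Rightarrow> (real \<Rightarrow> real \<Rightarrow> 'a::real_normed_vector) \<Rightarrow> (real \<Rightarrow> real \<Rightarrow> 'a) \<Rightarrow> bool" where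
  "moving_arc M L y v \<longleftrightarrow>
     continuous_on (UNIV \<times> {0..1}) (\<lambda>(t,c). y t c) \<and>
     continuous_on (UNIV \<times> {0..1}) (\<lambda>(t,c). v t c) \<and>
     (\<forall>t. \<forall>c\<in>{0..1}. ((\<lambda>t. y t c) has_vector_derivative v t c) (at t) \<and>
        norm (v t c) \<le> M \<and> (t \<le> 0 \<or> 1 \<le> t \<longrightarrow> v t c = 0)) \<and>
     (\<forall>t. \<forall>c\<in>{0..1}. \<forall>d\<in>{0..1}. norm (v t c - v t d) \<le> L * norm (y t c - y t d))"

definition arc_move ::
  "real \<Rightarrow> (real \<Rightarrow> 'a::real_normed_vector) \<Rightarrow> (real \<Rightarrow> 'a) \<Rightarrow> bool" where
  "arc_move M a b \<longleftrightarrow>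
     (\<exists>L y v. moving_arc M L y v \<and> (\<forall>c\<in>{0..1}. y 0 c = a c \<and> y 1 c = b c))"

lemma moving_arc_rest:
  assumes "moving_arc M L y v" "c \<in> {0..1}"
  shows "t \<le> 0 \<Longrightarrow> y t c = y 0 c" "1 \<le> t \<Longrightarrow> y t c = y 1 c"
proof -
  have d: "((\<lambda>t. y t c) has_vector_derivative v t c) (at t)" and
       z: "t \<le> 0 \<or> 1 \<le> t \<longrightarrow> v t c = 0" for t
    using assms unfolding moving_arc_def by blast+
  have d0: "((\<lambda>t. y t c) has_vector_derivative 0) (at t within S)" if "t \<le> 0 \<or> 1 \<le> t" for t S
    using d[of t] z[of t] that by (metis has_vector_derivative_at_within)
  show "y t c = y 0 c" if "t \<le> 0"
  proof -
    obtain k where "\<And>x. x \<in> {..0} \<Longrightarrow> y x c = k"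
      using has_vector_derivative_zero_constant[of "{..0::real}" "\<lambda>t. y t c"] d0 by auto
    then show ?thesis using that by auto
  qed
  show "y t c = y 1 c" if "1 \<le> t"
  proof -
    obtain k where "\<And>x. x \<in> {1..} \<Longrightarrow> y x c = k"
      using has_vector_derivative_zero_constant[of "{1::real..}" "\<lambda>t. y t c"] d0 by auto
    then show ?thesis using that by auto
  qed
qed

lemma has_vector_derivative_bound:
  fixes y :: "real \<Rightarrow> 'a::real_normed_vector"
  assumes "convex S" "\<And>t. t \<in> S \<Longrightarrow> (y has_vector_derivative v t) (at t within S)"
    and "\<And>t. t \<in> S \<Longrightarrow> norm (v t) \<le> B" "s \<in> S" "t \<in> S"
  shows "norm (y t - y s) \<le> B * \<bar>t - s\<bar>"
proof -
  have "norm (y t - y s) \<le> B * norm (t - s)"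
  proof (rule differentiable_bound[OF assms(1)])
    show "(y has_derivative (\<lambda>h. h *\<^sub>R v x)) (at x within S)" if "x \<in> S" for x
      using assms(2)[OF that] by (simp add: has_vector_derivative_def)
    show "onorm (\<lambda>h::real. h *\<^sub>R v x) \<le> B" if "x \<in> S" for x
      using assms(3)[OF that] by (intro onorm_le) (simp add: mult.commute[of B] mult_left_mono)
  qed (use assms in auto)
  then show ?thesis by simp
qed

lemma moving_arc_displacement:
  assumes "moving_arc M L y v" "c \<in> {0..1}"
  shows "norm (y t c - y 0 c) \<le> M"
proof -
  have d: "((\<lambda>t. y t c) has_vector_derivative v t c) (at t)" and M: "norm (v t c) \<le> M" for t
    using assms unfolding moving_arc_def by blast+
  have M0: "M \<ge> 0" using M[of 0] norm_ge_zero order_trans by blast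
  have *: "norm (y t c - y 0 c) \<le> M" if "t \<in> {0..1}" for t
  proof -
    have "norm (y t c - y 0 c) \<le> M * \<bar>t - 0\<bar>"
      by (rule has_vector_derivative_bound[of "{0..1}" "\<lambda>t. y t c" "\<lambda>t. v t c"])
         (use d M that in \<open>auto intro: has_vector_derivative_at_within\<close>)
    also have "\<dots> \<le> M * 1" using that M0 by (intro mult_left_mono) auto
    finally show ?thesis by simp
  qed
  show ?thesis
    using *[of t] *[of 1] moving_arc_rest[OF assms, of t] M0
    by (cases "t \<le> 0"; cases "1 \<le> t") auto
qed

text \<open>
  Uniform continuity on a compact neighbourhood times \<open>C\<close> makes the functions \<open>\<lambda>p. h p c\<close> equicontinuous
  in \<open>c\<close>.
\<close>

lemma continuous_on_INF_compact:
  fixes h :: "'p::heine_borel \<Rightarrow> 'c::metric_space \<Rightarrow> real"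
  assumes "compact C" "C \<noteq> {}" and cont: "continuous_on (UNIV \<times> C) (\<lambda>(p,c). h p c)"
  shows "continuous_on UNIV (\<lambda>p. INF c\<in>C. h p c)"
    and "\<And>p. bdd_below (h p ` C)"
proof -
  show bdd: "bdd_below (h p ` C)" for p
  proof -
    have "continuous_on C (h p)"
      using continuous_on_compose2[OF cont, of C "Pair p"]
      by (simp add: continuous_on_Pair continuous_on_id' image_subset_iff)
    then show ?thesis
      using assms(1) by (intro bounded_imp_bdd_below compact_imp_bounded compact_continuous_image)
  qed
  have "\<exists>d>0. \<forall>q. dist q p < d \<longrightarrow> dist (INF c\<in>C. h q c) (INF c\<in>C. h p c) < e"
    if "e > 0" for p e
  proof -
    have "uniformly_continuous_on (cball p 1 \<times> C) (\<lambda>(p,c). h p c)"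
      using assms(1)
      by (intro compact_uniformly_continuous continuous_on_subset[OF cont] compact_Times) auto
    then obtain d where d: "d > 0"
      "\<And>x x'. x \<in> cball p 1 \<times> C \<Longrightarrow> x' \<in> cball p 1 \<times> C \<Longrightarrow> dist x' x < d \<Longrightarrow>
         dist ((\<lambda>(p,c). h p c) x') ((\<lambda>(p,c). h p c) x) < e/2"
      using \<open>e > 0\<close> by (metis half_gt_zero uniformly_continuous_on_def)
    have "dist (INF c\<in>C. h q c) (INF c\<in>C. h p c) < e" if q: "dist q p < min d 1" for q
    proof -
      have close: "\<bar>h q c - h p c\<bar> < e/2" if "c \<in> C" for c
        using d(2)[of "(p,c)" "(q,c)"] q that
        by (auto simp: dist_Pair_Pair dist_real_def dist_commute)
      have "(INF c\<in>C. h p c) - e/2 \<le> (INF c\<in>C. h q c)"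
        by (rule cINF_greatest[OF assms(2)])
           (use close cINF_lower[OF bdd[of p]] in \<open>smt (verit)\<close>)
      moreover have "(INF c\<in>C. h q c) - e/2 \<le> (INF c\<in>C. h p c)"
        by (rule cINF_greatest[OF assms(2)])
           (use close cINF_lower[OF bdd[of q]] in \<open>smt (verit)\<close>)
      ultimately show ?thesis using \<open>e > 0\<close> by (auto simp: dist_real_def)
    qed
    then show ?thesis using d(1) by (intro exI[of _ "min d 1"]) auto
  qed
  then show "continuous_on UNIV (\<lambda>p. INF c\<in>C. h p c)"
    unfolding continuous_on_iff by auto
qed

text \<open>
  By the hypothesis \<open>norm (e t)\<^sup>2 * exp (- 2 * K * t)\<close> is nonincreasing, and it vanishes at \<open>a\<close>.
\<close>

lemma gronwall_zero:
  fixes e :: "real \<Rightarrow> 'a::real_inner"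
  assumes d: "\<And>t. t \<in> {a..b} \<Longrightarrow> (e has_vector_derivative e' t) (at t)"
    and K: "\<And>t. t \<in> {a..b} \<Longrightarrow> norm (e' t) \<le> K * norm (e t)"
    and "e a = 0" "t \<in> {a..b}"
  shows "e t = 0"
proof -
  define E where "E = (\<lambda>t. (e t \<bullet> e t) * exp (- 2 * K * t))"
  define E' where "E' = (\<lambda>t. (2 * (e t \<bullet> e' t) - 2 * K * (e t \<bullet> e t)) * exp (- 2 * K * t))"
  have "(E has_real_derivative E' t) (at t)" if "t \<in> {a..b}" for t
    unfolding E_def E'_def
    using d[OF that]
    by (auto intro!: derivative_eq_intros has_vector_derivative_eq_rhs
        simp: has_vector_derivative_def has_field_derivative_def algebra_simps inner_commute fun_eq_iff)
  moreover have "E' t \<le> 0" if "t \<in> {a..b}" for t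
  proof -
    have "e t \<bullet> e' t \<le> norm (e t) * norm (e' t)" by (rule norm_cauchy_schwarz)
    also have "\<dots> \<le> norm (e t) * (K * norm (e t))"
      by (intro mult_left_mono K that) auto
    also have "\<dots> = K * (e t \<bullet> e t)" by (simp add: dot_square_norm power2_eq_square)
    finally show ?thesis unfolding E'_def by (simp add: mult_le_0_iff)
  qed
  ultimately have dec: "\<exists>y. (E has_real_derivative y) (at x) \<and> y \<le> 0" if "a \<le> x" "x \<le> t" for x
    using that \<open>t \<in> {a..b}\<close> by (intro exI[of _ "E' x"]) auto
  have "E t \<le> E a"
    by (rule DERIV_nonpos_imp_nonincreasing[OF _ dec]) (use \<open>t \<in> {a..b}\<close> in simp)
  then have "e t \<bullet> e t \<le> 0" using \<open>e a = 0\<close> by (simp add: E_def mult_le_0_iff)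
  then show ?thesis using inner_ge_zero[of "e t"] by (metis inner_eq_zero_iff order_antisym)
qed

text \<open>
  The velocities are extended from the moving arc to the plane by McShane's formula, one coordinate at a
  time: the infimum over \<open>c\<close> of \<open>v t c \<bullet> b + K * norm (x - y t c)\<close> is continuous because \<open>c\<close> ranges over a
  compact interval. Truncation at the maximal speed at time \<open>t\<close> keeps the field
  bounded and makes it vanish when the arc rests; a cut-off in space makes its support bounded. The last
  property compares the field with the velocity of one point of the arc only, which suffices for
  uniqueness of the solutions that start on the arc.
\<close>

lemma moving_arc_field:
  fixes y v :: "real \<Rightarrow> real \<Rightarrow> 'a::euclidean_space"
  assumes mov: "moving_arc M L y v"
    and N: "\<And>t c. c \<in> {0..1} \<Longrightarrow> norm (y t c) \<le> N"
  obtains g :: "real \<times> 'a \<Rightarrow> 'a" and K where "continuous_on UNIV g"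
    "\<And>t x. norm (g (t,x)) \<le> real DIM('a) * M"
    "\<And>t x. t \<le> 0 \<or> 1 \<le> t \<or> N + 1 \<le> norm x \<Longrightarrow> g (t,x) = 0"
    "\<And>t x c. c \<in> {0..1} \<Longrightarrow> norm (g (t,x) - v t c) \<le> K * norm (x - y t c)"
proof -
  let ?I = "{0..1::real}"
  have cy: "continuous_on (UNIV \<times> ?I) (\<lambda>(t,c). y t c)"
    and cv: "continuous_on (UNIV \<times> ?I) (\<lambda>(t,c). v t c)"
    and vM: "\<And>t c. c \<in> ?I \<Longrightarrow> norm (v t c) \<le> M"
    and v0: "\<And>t c. c \<in> ?I \<Longrightarrow> t \<le> 0 \<or> 1 \<le> t \<Longrightarrow> v t c = 0"
    and vL: "\<And>t c d. c \<in> ?I \<Longrightarrow> d \<in> ?I \<Longrightarrow> norm (v t c - v t d) \<le> L * norm (y t c - y t d)"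
    using mov unfolding moving_arc_def by blast+
  have M0: "M \<ge> 0" using vM[of 0 0] order_trans[OF norm_ge_zero[of "v 0 0"]] by auto
  define K0 where "K0 = \<bar>L\<bar>"
  have vK: "norm (v t c - v t d) \<le> K0 * norm (y t c - y t d)" if "c \<in> ?I" "d \<in> ?I" for t c d
    by (rule order_trans[OF vL[OF that]]) (simp add: K0_def mult_right_mono)
  have K0: "K0 \<ge> 0" by (simp add: K0_def)
  define h where "h = (\<lambda>b (p::real \<times> 'a) c. v (fst p) c \<bullet> b + K0 * norm (snd p - y (fst p) c))"
  define w where "w = (\<lambda>(t::real) c. - norm (v t c))"
  have sub: "continuous_on (UNIV \<times> ?I) (\<lambda>q :: (real \<times> 'a) \<times> real. F (fst (fst q)) (snd q))"
    if "continuous_on (UNIV \<times> ?I) (\<lambda>(t,c). F t c)" for F :: "real \<Rightarrow> real \<Rightarrow> 'a"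
    using continuous_on_compose2[OF that, of "(UNIV :: (real \<times> 'a) set) \<times> ?I" "\<lambda>q. (fst (fst q), snd q)"]
    by (simp add: image_subset_iff mem_Times_iff continuous_on_Pair continuous_on_fst continuous_on_snd continuous_on_id' split_def)
  have ch: "continuous_on (UNIV \<times> ?I) (\<lambda>(p,c). h b p c)" for b
    unfolding h_def split_def by (intro continuous_intros sub[OF cy] sub[OF cv])
  have cw: "continuous_on (UNIV \<times> ?I) (\<lambda>(t,c). w t c)"
    using cv unfolding w_def split_def by (intro continuous_intros)
  define H where "H = (\<lambda>b p. INF c\<in>?I. h b p c)"
  \<comment> \<open>the maximal speed at time \<open>t\<close>\<close>
  define W where "W = (\<lambda>t. - (INF c\<in>?I. w t c))"
  have cH: "continuous_on UNIV (H b)" and bH: "bdd_below (h b p ` ?I)" for b p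
    unfolding H_def using continuous_on_INF_compact[OF _ _ ch] by auto
  have cW: "continuous_on UNIV W" and bW: "bdd_below (w t ` ?I)" for t
    unfolding W_def using continuous_on_INF_compact[OF _ _ cw] by (auto intro: continuous_on_minus)
  have Wge: "norm (v t c) \<le> W t" if "c \<in> ?I" for t c
    using cINF_lower[OF bW that, of t] unfolding W_def w_def by linarith
  have Wle: "W t \<le> M" for t
    unfolding W_def using cINF_greatest[of ?I "-M" "w t"] vM by (fastforce simp: w_def)
  have W0: "W t = 0" if "t \<le> 0 \<or> 1 \<le> t" for t
    unfolding W_def w_def using v0 that by (subst INF_cong[of ?I ?I _ "\<lambda>_. 0"]) auto
  have Wpos: "W t \<ge> 0" for t using Wge[of 0 t] order_trans[OF norm_ge_zero[of "v t 0"]] by auto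
  have Hclose: "\<bar>H b (t,x) - v t c \<bullet> b\<bar> \<le> K0 * norm (x - y t c)" if "c \<in> ?I" "b \<in> Basis" for b t x c
  proof -
    have "H b (t,x) \<le> v t c \<bullet> b + K0 * norm (x - y t c)"
      using cINF_lower[OF bH that(1), of b "(t,x)"] by (simp add: H_def h_def)
    moreover have "v t c \<bullet> b - K0 * norm (x - y t c) \<le> H b (t,x)"
      unfolding H_def
    proof (rule cINF_greatest)
      fix d assume d: "d \<in> ?I"
      have "v t c \<bullet> b - v t d \<bullet> b = (v t c - v t d) \<bullet> b" by (simp add: inner_diff_left)
      also have "\<dots> \<le> norm (v t c - v t d)"
        using Basis_le_norm[OF that(2), of "v t c - v t d"] by linarith
      also have "\<dots> \<le> K0 * norm (y t c - y t d)" using vK that(1) d by blast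
      also have "\<dots> \<le> K0 * (norm (x - y t c) + norm (x - y t d))"
        using K0 norm_triangle_ineq4[of "x - y t d" "x - y t c"]
        by (intro mult_left_mono) (auto simp: algebra_simps)
      finally show "v t c \<bullet> b - K0 * norm (x - y t c) \<le> h b (t, x) d"
        by (simp add: h_def algebra_simps)
    qed auto
    ultimately show ?thesis by linarith
  qed
  define G where "G = (\<lambda>p::real \<times> 'a. \<Sum>b\<in>Basis. max (- W (fst p)) (min (W (fst p)) (H b p)) *\<^sub>R b)"
  define X where "X = (\<lambda>x::'a. max 0 (min 1 (N + 1 - norm x)))"
  define g where "g = (\<lambda>p. X (snd p) *\<^sub>R G p)"
  have cWf: "continuous_on UNIV (\<lambda>p::real \<times> 'a. W (fst p))"
    by (intro continuous_on_compose2[OF cW]) (auto intro: continuous_intros)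
  have GW: "norm (G p) \<le> real DIM('a) * W (fst p)" for p
  proof -
    have "norm (G p) \<le> (\<Sum>b\<in>(Basis::'a set). W (fst p))"
      unfolding G_def using Wpos[of "fst p"] by (intro sum_norm_le) auto
    then show ?thesis by simp
  qed
  have Gclose: "norm (G (t,x) - v t c) \<le> real DIM('a) * K0 * norm (x - y t c)" if c: "c \<in> ?I" for t x c
  proof -
    have "G (t,x) - v t c =
      (\<Sum>b\<in>Basis. (max (- W t) (min (W t) (H b (t,x))) - v t c \<bullet> b) *\<^sub>R b)"
      by (simp add: G_def sum_subtractf scaleR_diff_left euclidean_representation)
    also have "norm \<dots> \<le> (\<Sum>b\<in>(Basis::'a set). K0 * norm (x - y t c))"
    proof (rule sum_norm_le)
      fix b :: 'a assume b: "b \<in> Basis"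
      have "\<bar>v t c \<bullet> b\<bar> \<le> W t" using Basis_le_norm[OF b, of "v t c"] Wge[OF c, of t] by linarith
      then have "\<bar>max (- W t) (min (W t) (H b (t,x))) - v t c \<bullet> b\<bar> \<le> K0 * norm (x - y t c)"
        using Hclose[OF c b, of t x] by linarith
      then show "norm ((max (- W t) (min (W t) (H b (t,x))) - v t c \<bullet> b) *\<^sub>R b) \<le> K0 * norm (x - y t c)"
        using b by simp
    qed
    finally show ?thesis by simp
  qed
  show ?thesis
  proof (rule that[of g "real DIM('a) * K0 + real DIM('a) * M"])
    show "continuous_on UNIV g"
      unfolding g_def G_def X_def by (intro continuous_intros cWf cH)
    show "norm (g (t,x)) \<le> real DIM('a) * M" for t x
    proof -
      have "norm (g (t,x)) \<le> 1 * norm (G (t,x))"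
        unfolding g_def norm_scaleR by (rule mult_right_mono) (simp_all add: X_def)
      also have "\<dots> \<le> real DIM('a) * W t" using GW[of "(t,x)"] by simp
      also have "\<dots> \<le> real DIM('a) * M" by (intro mult_left_mono Wle) auto
      finally show ?thesis .
    qed
    show "g (t,x) = 0" if "t \<le> 0 \<or> 1 \<le> t \<or> N + 1 \<le> norm x" for t x
    proof (cases "N + 1 \<le> norm x")
      case True
      then have "X x = 0" by (simp add: X_def)
      then show ?thesis by (simp add: g_def)
    next
      case False
      then have "W t = 0" using W0 that by blast
      then have "norm (G (t,x)) \<le> 0" using GW[of "(t,x)"] by simp
      then show ?thesis by (simp add: g_def)
    qed
    show "norm (g (t,x) - v t c) \<le> (real DIM('a) * K0 + real DIM('a) * M) * norm (x - y t c)"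
      if c: "c \<in> ?I" for t x c
    proof -
      have "X (y t c) = 1" using N[OF c, of t] by (simp add: X_def)
      then have X: "\<bar>1 - X x\<bar> \<le> norm (x - y t c)"
        using N[OF c, of t] norm_triangle_ineq3[of x "y t c"] unfolding X_def by linarith
      have "g (t,x) - v t c = (G (t,x) - v t c) - (1 - X x) *\<^sub>R G (t,x)"
        by (simp add: g_def scaleR_diff_left)
      also have "norm \<dots> \<le> norm (G (t,x) - v t c) + \<bar>1 - X x\<bar> * norm (G (t,x))"
        by (rule order_trans[OF norm_triangle_ineq4]) simp
      also have "\<dots> \<le> real DIM('a) * K0 * norm (x - y t c) + norm (x - y t c) * (real DIM('a) * M)"
      proof (intro add_mono mult_mono X Gclose c)
        show "norm (G (t,x)) \<le> real DIM('a) * M"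
          by (rule order_trans[OF GW]) (simp add: Wle)
      qed (use M0 K0 in auto)
      also have "\<dots> = (real DIM('a) * K0 + real DIM('a) * M) * norm (x - y t c)"
        by (simp only: distrib_right mult.commute[of "norm (x - y t c)"])
      finally show ?thesis .
    qed
  qed
qed

section \<open>A point that funnels out to a segment\<close>

text \<open>
  A quadratic spline that climbs from 0 to 1 on \<open>{0..1}\<close> with zero slope at both ends. It turns motions
  with arbitrary end velocities into motions that start and end at rest.
\<close>

definition ramp :: "real \<Rightarrow> real" where
  "ramp t = 2 * (max 0 t)\<^sup>2 - 4 * (max 0 (t - 1/2))\<^sup>2 + 2 * (max 0 (t - 1))\<^sup>2"

definition ramp' :: "real \<Rightarrow> real" where
  "ramp' t = 4 * max 0 t - 8 * max 0 (t - 1/2) + 4 * max 0 (t - 1)"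

lemma max_0_square_has_derivative:
  "((\<lambda>t::real. (max 0 t)\<^sup>2) has_real_derivative 2 * max 0 t) (at t)"
proof -
  consider "t < 0" | "t = 0" | "t > 0" by linarith
  then show ?thesis
  proof cases
    case 1
    have "((\<lambda>t::real. 0::real) has_real_derivative 2 * max 0 t) (at t)" using 1 by simp
    then show ?thesis
      by (rule has_field_derivative_transform_within_open[where S = "{..<0}"]) (use 1 in auto)
  next
    case 3
    have "((\<lambda>t::real. t\<^sup>2) has_real_derivative 2 * max 0 t) (at t)"
      using 3 by (auto intro!: derivative_eq_intros)
    then show ?thesis
      by (rule has_field_derivative_transform_within_open[where S = "{0<..}"]) (use 3 in auto)
  next
    case 2
    have "((\<lambda>h::real. (max 0 h)\<^sup>2 / h) \<longlongrightarrow> 0) (at 0)"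
    proof (rule Lim_null_comparison[where g = "\<lambda>h. \<bar>h\<bar>"])
      show "\<forall>\<^sub>F h in at (0::real). norm ((max 0 h)\<^sup>2 / h) \<le> \<bar>h\<bar>"
        by (auto simp: max_def power2_eq_square intro!: always_eventually)
      show "((\<lambda>h::real. \<bar>h\<bar>) \<longlongrightarrow> 0) (at 0)"
        using tendsto_rabs_zero[OF tendsto_ident_at, of UNIV] by simp
    qed
    then show ?thesis using 2 by (simp add: has_field_derivative_iff)
  qed
qed

lemma ramp_has_derivative: "(ramp has_real_derivative ramp' t) (at t)"
proof -
  have s: "((\<lambda>t::real. (max 0 (t - a))\<^sup>2) has_real_derivative 2 * max 0 (t - a)) (at t)" for a
  proof -
    have "((\<lambda>t. t - a) has_real_derivative 1) (at t)" by (auto intro!: derivative_eq_intros)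
    from DERIV_chain2[OF max_0_square_has_derivative this] show ?thesis by simp
  qed
  have "((\<lambda>t. 2 * (max 0 t)\<^sup>2 - 4 * (max 0 (t - 1/2))\<^sup>2 + 2 * (max 0 (t - 1))\<^sup>2)
      has_real_derivative (2 * (2 * max 0 t) - 4 * (2 * max 0 (t - 1/2)) + 2 * (2 * max 0 (t - 1)))) (at t)"
    by (intro DERIV_add DERIV_diff DERIV_cmult s max_0_square_has_derivative)
  then show ?thesis unfolding ramp_def[abs_def] ramp'_def by simp
qed

lemma ramp_simps:
  "t \<le> 0 \<Longrightarrow> ramp t = 0" "1 \<le> t \<Longrightarrow> ramp t = 1"
  "t \<le> 0 \<or> 1 \<le> t \<Longrightarrow> ramp' t = 0"
  by (auto simp: ramp_def ramp'_def max_def power2_eq_square algebra_simps)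

lemma ramp'_bounds: "0 \<le> ramp' t" "ramp' t \<le> 2"
  by (auto simp: ramp'_def max_def)

lemma ramp_mono: "s \<le> t \<Longrightarrow> ramp s \<le> ramp t"
  by (rule DERIV_nonneg_imp_nondecreasing) (use ramp_has_derivative ramp'_bounds in blast)+

lemma ramp_range: "0 \<le> ramp t" "ramp t \<le> 1"
  using ramp_mono[of t "max t 1"] ramp_mono[of "min t 0" t] ramp_simps by auto

lemma ramp_pos: "0 < t \<Longrightarrow> 0 < ramp t"
proof -
  assume "0 < t"
  have "0 < ramp (min t (1/2))" using \<open>0 < t\<close> by (auto simp: ramp_def min_def)
  also have "\<dots> \<le> ramp t" by (rule ramp_mono) auto
  finally show ?thesis .
qed

lemma continuous_ramp' [continuous_intros]: "continuous_on A f \<Longrightarrow> continuous_on A (\<lambda>x. ramp' (f x))"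
  unfolding ramp'_def by (intro continuous_intros)

lemma continuous_ramp [continuous_intros]: "continuous_on A f \<Longrightarrow> continuous_on A (\<lambda>x. ramp (f x))"
  unfolding ramp_def by (intro continuous_intros)

text \<open>
  On the line through \<open>A\<close> in direction \<open>B\<close>, with coordinate \<open>p\<close>, the field is \<open>ramp' t * p / ramp t\<close>, so that
  \<open>p = c * ramp t\<close> is a solution for every \<open>c\<close>. All of these start at \<open>A\<close>. Truncating the
  quotient \<open>p / ramp t\<close> to \<open>{-1..1}\<close> makes the field continuous at \<open>t = 0\<close>, and bounds \<open>\<bar>p\<bar>\<close>
  by \<open>ramp t\<close> along every solution that starts at \<open>A\<close>.
\<close>

lemma segment_field:
  fixes A B :: "'a::euclidean_space"
  assumes "B \<noteq> 0" and N: "norm A + norm B \<le> N"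
  obtains f :: "real \<times> 'a \<Rightarrow> 'a" where "continuous_on UNIV f"
    "\<And>t x. t \<le> 0 \<or> 1 \<le> t \<or> N + 1 \<le> norm x \<Longrightarrow> f (t,x) = 0"
    "\<And>t c. \<bar>c\<bar> \<le> 1 \<Longrightarrow> f (t, A + (ramp t * c) *\<^sub>R B) = (ramp' t * c) *\<^sub>R B"
    "\<And>z. (\<And>t. t \<in> {0..1} \<Longrightarrow> (z has_vector_derivative f (t, z t)) (at t)) \<Longrightarrow> z 0 = A \<Longrightarrow>
       \<exists>c. \<bar>c\<bar> \<le> 1 \<and> z 1 = A + c *\<^sub>R B"
proof -
  define p where "p = (\<lambda>x. ((x - A) \<bullet> B) / (B \<bullet> B))"
  define X where "X = (\<lambda>x::'a. max 0 (min 1 (N + 1 - norm x)))"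
  define k where "k = (\<lambda>q::real \<times> 'a. X (snd q) * (ramp' (fst q) * max (- 1) (min 1 (p (snd q) / ramp (fst q)))))"
  define f where "f = (\<lambda>q. k q *\<^sub>R B)"
  have BB: "B \<bullet> B > 0" using assms(1) by simp
  have X01: "0 \<le> X x" "X x \<le> 1" for x by (auto simp: X_def)
  have kb: "\<bar>k q\<bar> \<le> ramp' (fst q)" for q
  proof -
    have "\<bar>k q\<bar> = X (snd q) * (ramp' (fst q) * \<bar>max (- 1) (min 1 (p (snd q) / ramp (fst q)))\<bar>)"
      using X01[of "snd q"] ramp'_bounds[of "fst q"] by (simp add: k_def abs_mult)
    also have "\<dots> \<le> 1 * (ramp' (fst q) * 1)"
      using X01[of "snd q"] ramp'_bounds[of "fst q"] by (intro mult_mono) auto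
    finally show ?thesis by simp
  qed
  have cp: "continuous_on S (\<lambda>q. p (snd q))" for S :: "(real \<times> 'a) set"
    unfolding p_def using BB by (intro continuous_intros) auto
  have "isCont k q" for q
  proof -
    consider "fst q < 0" | "fst q = 0" | "fst q > 0" by linarith
    then show ?thesis
    proof cases
      case 1
      have "\<forall>\<^sub>F r in nhds q. k r = 0"
      proof (rule eventually_nhds_in_open[THEN eventually_mono])
        show "open ({..<0::real} \<times> (UNIV::'a set))" by (intro open_Times) auto
        show "q \<in> {..<0::real} \<times> UNIV" using 1 by (cases q) auto
        show "k r = 0" if "r \<in> {..<0::real} \<times> (UNIV::'a set)" for r
          using that ramp_simps(3)[of "fst r"] by (cases r) (auto simp: k_def)
      qed
      then show ?thesis using isCont_cong[of k "\<lambda>_. 0" q] by auto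
    next
      case 2
      have "(k \<longlongrightarrow> 0) (at q)"
      proof (rule Lim_null_comparison[where g = "\<lambda>q. ramp' (fst q)"])
        show "\<forall>\<^sub>F r in at q. norm (k r) \<le> ramp' (fst r)" using kb by (auto intro!: always_eventually)
        have "isCont (\<lambda>q::real \<times> 'a. ramp' (fst q)) q"
          by (intro continuous_on_interior[where S = UNIV] continuous_intros) auto
        then show "((\<lambda>q. ramp' (fst q)) \<longlongrightarrow> 0) (at q)"
          using 2 ramp_simps(3)[of 0] by (simp add: isCont_def)
      qed
      moreover have "k q = 0" using 2 ramp_simps(3)[of 0] by (simp add: k_def)
      ultimately show ?thesis by (simp add: isCont_def)
    next
      case 3
      have ne: "\<forall>r\<in>{0<..} \<times> (UNIV::'a set). ramp (fst r) \<noteq> 0"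
        using ramp_pos by (metis less_irrefl greaterThan_iff mem_Times_iff)
      have "continuous_on ({0<..} \<times> UNIV) k"
        unfolding k_def X_def
        by (intro continuous_intros cp ne)
      moreover have "q \<in> {0<..} \<times> UNIV" using 3 by (cases q) auto
      moreover have "open ({0<..} \<times> (UNIV::'a set) :: (real \<times> 'a) set)" by (intro open_Times) auto
      ultimately show ?thesis using continuous_on_eq_continuous_at by blast
    qed
  qed
  then have ck: "continuous_on UNIV k" by (simp add: continuous_on_eq_continuous_at)
  show ?thesis
  proof (rule that[of f])
    show "continuous_on UNIV f" unfolding f_def by (intro continuous_intros ck)
    show "f (t,x) = 0" if "t \<le> 0 \<or> 1 \<le> t \<or> N + 1 \<le> norm x" for t x
      using that ramp_simps(3)[of t] by (auto simp: f_def k_def X_def)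
    show "f (t, A + (ramp t * c) *\<^sub>R B) = (ramp' t * c) *\<^sub>R B" if "\<bar>c\<bar> \<le> 1" for t c
    proof (cases "t \<le> 0")
      case True then show ?thesis using ramp_simps(3)[of t] by (auto simp: f_def k_def)
    next
      case False
      have "\<bar>ramp t * c\<bar> \<le> 1 * 1" unfolding abs_mult using that ramp_range[of t] by (intro mult_mono) auto
      then have "norm ((ramp t * c) *\<^sub>R B) \<le> 1 * norm B" unfolding norm_scaleR by (intro mult_right_mono) auto
      then have "norm (A + (ramp t * c) *\<^sub>R B) \<le> N" using N norm_triangle_ineq[of A "(ramp t * c) *\<^sub>R B"] by linarith
      then have "X (A + (ramp t * c) *\<^sub>R B) = 1" by (simp add: X_def)
      moreover have "p (A + (ramp t * c) *\<^sub>R B) / ramp t = c"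
        using BB ramp_pos[of t] False by (simp add: p_def)
      moreover have "max (- 1) (min 1 c) = c" using that by linarith
      ultimately show ?thesis by (simp add: f_def k_def)
    qed
    fix z :: "real \<Rightarrow> 'a"
    assume z: "\<And>t. t \<in> {0..1} \<Longrightarrow> (z has_vector_derivative f (t, z t)) (at t)" and z0: "z 0 = A"
    have zd: "(z has_vector_derivative (k (t, z t) *\<^sub>R B)) (at t)" if "t \<in> {0..1}" for t
      using z[OF that] by (simp add: f_def)
    have pd: "((\<lambda>t. p (z t)) has_real_derivative k (t, z t)) (at t)" if "t \<in> {0..1}" for t
    proof -
      have "bounded_linear (\<lambda>w. (w \<bullet> B) / (B \<bullet> B))"
        by (intro bounded_linear_compose[OF bounded_linear_divide] bounded_linear_inner_left)
      then have "((\<lambda>t. (z t \<bullet> B) / (B \<bullet> B)) has_vector_derivative ((k (t, z t) *\<^sub>R B) \<bullet> B) / (B \<bullet> B)) (at t)"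
        by (rule bounded_linear.has_vector_derivative) (rule zd[OF that])
      then have "((\<lambda>t. (z t \<bullet> B) / (B \<bullet> B)) has_real_derivative k (t, z t)) (at t)"
        using BB by (simp add: has_real_derivative_iff_has_vector_derivative)
      then have "((\<lambda>t. (z t \<bullet> B) / (B \<bullet> B) - (A \<bullet> B) / (B \<bullet> B)) has_real_derivative k (t, z t) - 0) (at t)"
        by (intro DERIV_diff DERIV_const)
      then show ?thesis by (simp add: p_def inner_diff_left diff_divide_distrib)
    qed
    have "((\<lambda>t. z t - (A + p (z t) *\<^sub>R B)) has_vector_derivative 0) (at t within {0..1})" if "t \<in> {0..1}" for t
    proof -
      have "((\<lambda>t. z t - (A + p (z t) *\<^sub>R B)) has_vector_derivative (k (t, z t) *\<^sub>R B) - (0 + k (t, z t) *\<^sub>R B)) (at t)"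
        using zd[OF that] pd[OF that] by (auto intro!: derivative_eq_intros)
      then show ?thesis by (simp add: has_vector_derivative_at_within)
    qed
    then obtain w where "\<And>t. t \<in> {0..1} \<Longrightarrow> z t - (A + p (z t) *\<^sub>R B) = w"
      using has_vector_derivative_zero_constant[of "{0..1::real}" "\<lambda>t. z t - (A + p (z t) *\<^sub>R B)"] by auto
    from this[of 0] this[of 1] have z1: "z 1 = A + p (z 1) *\<^sub>R B" using z0 by (simp add: p_def)
    have "p (z 1) - ramp 1 \<le> p (z 0) - ramp 0"
    proof (rule DERIV_nonpos_imp_nonincreasing, simp)
      fix t :: real assume "0 \<le> t" "t \<le> 1"
      then have "((\<lambda>t. p (z t) - ramp t) has_real_derivative k (t, z t) - ramp' t) (at t)"
        by (intro DERIV_diff pd ramp_has_derivative) auto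
      then show "\<exists>y. ((\<lambda>t. p (z t) - ramp t) has_real_derivative y) (at t) \<and> y \<le> 0"
        using kb[of "(t, z t)"] by (intro exI[of _ "k (t, z t) - ramp' t"]) auto
    qed
    moreover have "p (z 0) + ramp 0 \<le> p (z 1) + ramp 1"
    proof (rule DERIV_nonneg_imp_nondecreasing, simp)
      fix t :: real assume "0 \<le> t" "t \<le> 1"
      then have "((\<lambda>t. p (z t) + ramp t) has_real_derivative k (t, z t) + ramp' t) (at t)"
        by (intro DERIV_add pd ramp_has_derivative) auto
      then show "\<exists>y. ((\<lambda>t. p (z t) + ramp t) has_real_derivative y) (at t) \<and> y \<ge> 0"
        using kb[of "(t, z t)"] by (intro exI[of _ "k (t, z t) + ramp' t"]) auto
    qed
    ultimately have "\<bar>p (z 1)\<bar> \<le> 1" using z0 ramp_simps(1)[of 0] ramp_simps(2)[of 1] by (simp add: p_def)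
    then show "\<exists>c. \<bar>c\<bar> \<le> 1 \<and> z 1 = A + c *\<^sub>R B" using z1 by blast
  qed
qed

section \<open>Limits of moving arcs are funnel sections\<close>

lemma has_vector_derivative_suminf:
  fixes w :: "nat \<Rightarrow> real \<Rightarrow> 'a::banach"
  assumes d: "\<And>n t. (w n has_vector_derivative d n t) (at t)"
    and M: "\<And>n t. norm (d n t) \<le> M n" "summable M"
    and s: "\<And>t. summable (\<lambda>n. w n t)"
  shows "((\<lambda>t. \<Sum>n. w n t) has_vector_derivative (\<Sum>n. d n t)) (at t)"
proof -
  have u: "uniform_limit UNIV (\<lambda>n t. \<Sum>i<n. d i t) (\<lambda>t. \<Sum>i. d i t) sequentially"
    by (rule Weierstrass_m_test) (use M in auto)
  have "\<exists>g. \<forall>x\<in>UNIV. (\<lambda>n. w n x) sums g x \<and>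
      (g has_derivative (\<lambda>h. h *\<^sub>R (\<Sum>n. d n x))) (at x within UNIV)"
  proof (rule has_derivative_series[where f' = "\<lambda>n x h. h *\<^sub>R d n x"])
    show "(w n has_derivative (\<lambda>h. h *\<^sub>R d n x)) (at x within UNIV)" for n x
      using d[of n x] by (simp add: has_vector_derivative_def)
    show "(\<lambda>n. w n 0) sums (\<Sum>n. w n 0)" using s by (rule summable_sums)
    fix e :: real assume "e > 0"
    have "\<forall>\<^sub>F n in sequentially. \<forall>x\<in>UNIV. dist (\<Sum>i<n. d i x) (\<Sum>i. d i x) < e"
      using u \<open>e > 0\<close> by (simp add: uniform_limit_iff)
    then show "\<forall>\<^sub>F n in sequentially. \<forall>x\<in>UNIV. \<forall>h.
        norm ((\<Sum>i<n. h *\<^sub>R d i x) - h *\<^sub>R (\<Sum>n. d n x)) \<le> e * norm h"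
    proof (rule eventually_mono, intro ballI allI)
      fix n x h
      assume "\<forall>x\<in>UNIV. dist (\<Sum>i<n. d i x) (\<Sum>i. d i x) < e"
      then have "norm ((\<Sum>i<n. d i x) - (\<Sum>i. d i x)) \<le> e" by (simp add: dist_norm less_imp_le)
      then have "\<bar>h\<bar> * norm ((\<Sum>i<n. d i x) - (\<Sum>i. d i x)) \<le> \<bar>h\<bar> * e" by (intro mult_left_mono) auto
      then show "norm ((\<Sum>i<n. h *\<^sub>R d i x) - h *\<^sub>R (\<Sum>n. d n x)) \<le> e * norm h"
        by (simp add: scaleR_sum_right[symmetric] scaleR_diff_right[symmetric] mult.commute)
    qed
  qed auto
  then obtain g where g: "\<And>x. (\<lambda>n. w n x) sums g x"
    "\<And>x. (g has_derivative (\<lambda>h. h *\<^sub>R (\<Sum>n. d n x))) (at x)" by auto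
  have "g = (\<lambda>t. \<Sum>n. w n t)" using g(1) by (auto simp: sums_iff)
  then show ?thesis using g(2) by (simp add: has_vector_derivative_def)
qed

text \<open>
  Stage \<open>n\<close> occupies the time interval from \<open>2 - 1 / 2 ^ n\<close> to \<open>2 - 1 / 2 ^ Suc n\<close>, which \<open>stage n\<close> maps
  affinely onto \<open>{0..1}\<close>. The stages fill \<open>{1..<2}\<close>.
\<close>

definition stage :: "nat \<Rightarrow> real \<Rightarrow> real" where
  "stage n t = 2 - 2 ^ Suc n * (2 - t)"

lemma stage_order:
  assumes "m < n"
  shows "0 \<le> stage n t \<Longrightarrow> 1 \<le> stage m t" "stage m t \<le> 1 \<Longrightarrow> stage n t \<le> 0"
proof -
  have p: "(2::real) ^ Suc n = 2 ^ Suc m * 2 ^ (n - m)"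
    using assms by (simp flip: power_add)
  have "(2::real) ^ 1 \<le> 2 ^ (n - m)" using assms by (intro power_increasing) auto
  then have k: "(2::real) \<le> 2 ^ (n - m)" by simp
  show "1 \<le> stage m t" if "0 \<le> stage n t"
  proof (rule ccontr)
    assume "\<not> 1 \<le> stage m t"
    then have *: "1 < 2 ^ Suc m * (2 - t)" by (simp add: stage_def)
    have "2 ^ Suc n * (2 - t) = 2 ^ (n - m) * (2 ^ Suc m * (2 - t))" by (simp only: p mult_ac)
    moreover have "\<dots> > 2 * 1" using * k by (intro mult_le_less_imp_less) auto
    ultimately show False using that unfolding stage_def by linarith
  qed
  show "stage n t \<le> 0" if "stage m t \<le> 1"
  proof -
    have *: "1 \<le> 2 ^ Suc m * (2 - t)" using that by (simp add: stage_def)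
    have "2 ^ Suc n * (2 - t) = 2 ^ (n - m) * (2 ^ Suc m * (2 - t))" by (simp only: p mult_ac)
    moreover have "\<dots> \<ge> 2 * 1" using * k by (intro mult_mono) auto
    ultimately show ?thesis unfolding stage_def by linarith
  qed
qed

lemma stage_outside:
  "t \<le> 1 \<Longrightarrow> stage n t \<le> 0" "2 \<le> t \<Longrightarrow> 1 \<le> stage n t"
proof -
  have "2 ^ Suc n * (2 - t) \<ge> 2 * 1" if "t \<le> 1"
    using that by (intro mult_mono) auto
  then show "t \<le> 1 \<Longrightarrow> stage n t \<le> 0" by (simp add: stage_def)
  have "2 ^ Suc n * (2 - t) \<le> 0" if "2 \<le> t" using that by (intro mult_nonneg_nonpos) auto
  then show "2 \<le> t \<Longrightarrow> 1 \<le> stage n t" unfolding stage_def by linarith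
qed

lemma stage_has_derivative: "(stage n has_real_derivative 2 ^ Suc n) (at t)"
  unfolding stage_def[abs_def] by (auto intro!: derivative_eq_intros)

text \<open>
  On \<open>{0..1}\<close> the point \<open>A\<close> funnels out to the segment, and on stage \<open>n\<close> the field of the \<open>n\<close>-th
  motion acts, sped up by the factor \<open>2 ^ Suc n\<close>. Both the field and its solutions are written as sums over all
  stages, of which at most one term is active at any time. As \<open>2 ^ Suc n * (C / 4 ^ n)\<close> is
  summable, the Weierstrass M-test gives continuity of the field and differentiability of
  the solutions at all times, including the joints between stages and the final time.
\<close>

theorem funnel_section_limit_of_moves:
  fixes a :: "nat \<Rightarrow> real \<Rightarrow> real ^ 'm"
  assumes B: "B \<noteq> 0"
    and a0: "\<And>c. c \<in> {0..1} \<Longrightarrow> a 0 c = A + (2 * c - 1) *\<^sub>R B"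
    and moves: "\<And>n. arc_move (C / 4 ^ n) (a n) (a (Suc n))"
    and lim: "\<And>c. c \<in> {0..1} \<Longrightarrow> (\<lambda>n. a n c) \<longlonglongrightarrow> b c"
  shows "funnel_section (b ` {0..1})"
proof -
  let ?I = "{0..1::real}"
  have "\<forall>n. \<exists>L y v. moving_arc (C / 4 ^ n) L y v \<and> (\<forall>c\<in>?I. y 0 c = a n c \<and> y 1 c = a (Suc n) c)"
    using moves unfolding arc_move_def by blast
  then obtain L y v where mov: "\<And>n. moving_arc (C / 4 ^ n) (L n) (y n) (v n)"
    and y0: "\<And>n c. c \<in> ?I \<Longrightarrow> y n 0 c = a n c" and y1: "\<And>n c. c \<in> ?I \<Longrightarrow> y n 1 c = a (Suc n) c"
    by metis
  have disp: "norm (y n t c - a n c) \<le> C / 4 ^ n" if "c \<in> ?I" for n t c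
    using moving_arc_displacement[OF mov that, of n t] y0[OF that] by simp
  have yd: "((\<lambda>t. y n t c) has_vector_derivative v n t c) (at t)"
    and vM: "norm (v n t c) \<le> C / 4 ^ n" and v0: "t \<le> 0 \<or> 1 \<le> t \<Longrightarrow> v n t c = 0" if "c \<in> ?I" for n t c
    using mov[of n] that unfolding moving_arc_def by blast+
  have C0: "C \<ge> 0" using order_trans[OF norm_ge_zero disp[of 0 0 0]] by simp
  define R where "R = norm A + norm B"
  have an: "norm (a n c) \<le> R + 4/3 * C * (1 - 1 / 4 ^ n)" if c: "c \<in> ?I" for n c
  proof (induction n)
    case 0
    have "norm ((2 * c - 1) *\<^sub>R B) \<le> 1 * norm B" unfolding norm_scaleR using c by (intro mult_right_mono) auto
    then show ?case using a0[OF c] norm_triangle_ineq[of A "(2 * c - 1) *\<^sub>R B"] by (simp add: R_def)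
  next
    case (Suc n)
    have "norm (a (Suc n) c) \<le> norm (a n c) + C / 4 ^ n"
      using disp[OF c, of n 1] y1[OF c, of n] norm_triangle_sub[of "a (Suc n) c" "a n c"] by simp
    moreover have "4/3 * C * (1 - 1 / 4 ^ Suc n) = 4/3 * C * (1 - 1 / 4 ^ n) + C / 4 ^ n"
      by (simp add: field_simps)
    ultimately show ?case using Suc by linarith
  qed
  define N where "N = R + 3 * C"
  have pow1: "C / 4 ^ n \<le> C" for n using C0 by (simp add: divide_le_eq mult_le_cancel_left1)
  have an': "norm (a n c) \<le> R + 4/3 * C" if "c \<in> ?I" for n c
  proof -
    have "4/3 * C * (1 - 1 / 4 ^ n) \<le> 4/3 * C * 1" using C0 by (intro mult_left_mono) auto
    then show ?thesis using an[OF that, of n] by linarith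
  qed
  have yN: "norm (y n t c) \<le> N" if "c \<in> ?I" for n t c
    using an'[OF that, of n] disp[OF that, of n t] pow1[of n] C0
      norm_triangle_sub[of "y n t c" "a n c"] unfolding N_def by linarith
  have "\<forall>n. \<exists>g K. continuous_on UNIV g \<and>
    (\<forall>t x. norm (g (t,x)) \<le> real DIM(real ^ 'm) * (C / 4 ^ n)) \<and>
    (\<forall>t x. t \<le> 0 \<or> 1 \<le> t \<or> N + 1 \<le> norm x \<longrightarrow> g (t,x) = 0) \<and>
    (\<forall>t x. \<forall>c\<in>?I. norm (g (t,x) - v n t c) \<le> K * norm (x - y n t c))"
  proof
    fix n
    obtain g K where "continuous_on UNIV g" "\<And>t x. norm (g (t,x)) \<le> real DIM(real ^ 'm) * (C / 4 ^ n)"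
      "\<And>t x. t \<le> 0 \<or> 1 \<le> t \<or> N + 1 \<le> norm x \<Longrightarrow> g (t,x) = 0"
      "\<And>t x c. c \<in> ?I \<Longrightarrow> norm (g (t,x) - v n t c) \<le> K * norm (x - y n t c)"
      using moving_arc_field[OF mov yN, of n] by blast
    then show "\<exists>g K. continuous_on UNIV g \<and>
      (\<forall>t x. norm (g (t,x)) \<le> real DIM(real ^ 'm) * (C / 4 ^ n)) \<and>
      (\<forall>t x. t \<le> 0 \<or> 1 \<le> t \<or> N + 1 \<le> norm x \<longrightarrow> g (t,x) = 0) \<and>
      (\<forall>t x. \<forall>c\<in>?I. norm (g (t,x) - v n t c) \<le> K * norm (x - y n t c))"
      by blast
  qed
  then obtain g K where cg: "\<And>n. continuous_on UNIV (g n)"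
    and gM: "\<And>n t x. norm (g n (t,x)) \<le> real DIM(real ^ 'm) * (C / 4 ^ n)"
    and g0: "\<And>n t x. t \<le> 0 \<or> 1 \<le> t \<or> N + 1 \<le> norm x \<Longrightarrow> g n (t,x) = 0"
    and gK: "\<And>n t x c. c \<in> ?I \<Longrightarrow> norm (g n (t,x) - v n t c) \<le> K n * norm (x - y n t c)"
    by metis
  have gv: "g n (t, y n t c) = v n t c" if "c \<in> ?I" for n t c
    using gK[OF that, of n t "y n t c"] by simp
  have AB: "norm A + norm B \<le> N" using C0 by (simp add: N_def R_def)
  obtain f0 where cf0: "continuous_on UNIV f0"
    and f00: "\<And>t x. t \<le> 0 \<or> 1 \<le> t \<or> N + 1 \<le> norm x \<Longrightarrow> f0 (t,x) = 0"
    and f0y: "\<And>t c. \<bar>c\<bar> \<le> 1 \<Longrightarrow> f0 (t, A + (ramp t * c) *\<^sub>R B) = (ramp' t * c) *\<^sub>R B"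
    and f0z: "\<And>z. (\<And>t. t \<in> {0..1} \<Longrightarrow> (z has_vector_derivative f0 (t, z t)) (at t)) \<Longrightarrow> z 0 = A \<Longrightarrow>
       \<exists>c. \<bar>c\<bar> \<le> 1 \<and> z 1 = A + c *\<^sub>R B"
    by (rule segment_field[OF B AB]) blast
  define F where "F = (\<lambda>n p. 2 ^ Suc n *\<^sub>R g n (stage n (fst p), snd p))"
  define f where "f = (\<lambda>p. f0 p + (\<Sum>n. F n p))"
  define Q where "Q = (\<lambda>n. 2 * real DIM(real ^ 'm) * C * (1/2) ^ n)"
  have pw: "2 ^ Suc n * (D * (C / 4 ^ n)) = 2 * D * C * (1/2) ^ n" for n :: nat and D :: real
  proof -
    have "(4::real) ^ n = 2 ^ n * 2 ^ n" by (simp flip: power_mult_distrib)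
    then show ?thesis by (simp add: field_simps)
  qed
  have FQ: "norm (F n p) \<le> Q n" for n p
  proof -
    have "norm (F n p) \<le> 2 ^ Suc n * (real DIM(real ^ 'm) * (C / 4 ^ n))"
      unfolding F_def norm_scaleR using gM by (intro mult_mono) auto
    then show ?thesis unfolding pw Q_def .
  qed
  have sQ: "summable Q" unfolding Q_def by (intro summable_mult summable_geometric) auto
  have cF: "continuous_on UNIV (F n)" for n
  proof -
    have "continuous_on UNIV (\<lambda>p::real \<times> (real ^ 'm). (stage n (fst p), snd p))"
      unfolding stage_def by (intro continuous_intros)
    then show ?thesis unfolding F_def
      by (intro continuous_on_scaleR continuous_on_const continuous_on_compose2[OF cg]) auto
  qed
  have cf: "continuous_on UNIV f"
    unfolding f_def
  proof (intro continuous_on_add cf0)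
    show "continuous_on UNIV (\<lambda>p. \<Sum>n. F n p)"
    proof (rule uniform_limit_theorem)
      show "uniform_limit UNIV (\<lambda>n p. \<Sum>i<n. F i p) (\<lambda>p. \<Sum>n. F n p) sequentially"
        by (rule Weierstrass_m_test) (use FQ sQ in auto)
      show "\<forall>\<^sub>F n in sequentially. continuous_on UNIV (\<lambda>p. \<Sum>i<n. F i p)"
        by (intro always_eventually allI continuous_on_sum cF)
    qed simp
  qed
  have F0: "F n (t,x) = 0" if "stage n t \<le> 0 \<or> 1 \<le> stage n t \<or> N + 1 \<le> norm x" for n t x
    using g0[OF that] by (simp add: F_def)
  have f_out: "f (t,x) = 0" if "t \<le> 0 \<or> 2 \<le> t \<or> N + 1 \<le> norm x" for t x
  proof -
    have "F n (t,x) = 0" for n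
      using that stage_outside[of t n] by (intro F0) auto
    then show ?thesis using f00[of t x] that by (auto simp: f_def)
  qed
  have f_first: "f (t,x) = f0 (t,x)" if "t \<le> 1" for t x
  proof -
    have "F n (t,x) = 0" for n
      using that stage_outside[of t n] by (intro F0) auto
    then show ?thesis by (simp add: f_def)
  qed
  have f_stage: "f (t,x) = F n (t,x)" if "0 \<le> stage n t" "stage n t \<le> 1" for n t x
  proof -
    have "F m (t,x) = 0" if "m \<noteq> n" for m
      using \<open>0 \<le> stage n t\<close> \<open>stage n t \<le> 1\<close> that stage_order[of m n t] stage_order[of n m t]
      by (intro F0) (metis linorder_neqE_nat)
    then have "(\<Sum>m. F m (t,x)) = (\<Sum>m\<in>{n}. F m (t,x))" by (intro suminf_finite) auto
    moreover have "f0 (t,x) = 0"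
    proof (cases "t \<le> 1")
      case True
      have "t = 1"
      proof -
        have "2 * (2 - t) \<le> 2 ^ Suc n * (2 - t)" using True by (intro mult_right_mono) auto
        then show ?thesis using True that(1) by (simp add: stage_def)
      qed
      then show ?thesis using f00 by simp
    qed (use f00 in auto)
    ultimately show ?thesis by (simp add: f_def)
  qed
  have supp: "compact (closure {p. f p \<noteq> 0})"
  proof -
    have sub: "{p. f p \<noteq> 0} \<subseteq> {0..2} \<times> cball 0 (N + 1)"
    proof
      fix p assume "p \<in> {p. f p \<noteq> 0}"
      then have "\<not> (fst p \<le> 0 \<or> 2 \<le> fst p \<or> N + 1 \<le> norm (snd p))"
        using f_out[of "fst p" "snd p"] by (metis mem_Collect_eq prod.collapse)
      then show "p \<in> {0..2} \<times> cball 0 (N + 1)" by (cases p) simp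
    qed
    have "bounded {p. f p \<noteq> 0}"
      by (rule bounded_subset[OF _ sub]) (intro bounded_Times, auto)
    then show ?thesis by (simp add: compact_closure)
  qed
  \<comment> \<open>Uniqueness on each stage gives one inclusion, explicit solutions give the other.\<close>
  have "funnel_section_at 2 0 A f = b ` ?I"
  proof (intro equalityI subsetI)
    fix p assume "p \<in> funnel_section_at 2 0 A f"
    then obtain z where p: "p = z 2" and zd: "\<And>t. (z has_vector_derivative f (t, z t)) (at t)" and "z 0 = A"
      unfolding funnel_section_at_def by blast
    have "\<exists>c. \<bar>c\<bar> \<le> 1 \<and> z 1 = A + c *\<^sub>R B"
      using zd f_first \<open>z 0 = A\<close> by (intro f0z) (metis atLeastAtMost_iff)+
    then obtain c' where c': "\<bar>c'\<bar> \<le> 1" "z 1 = A + c' *\<^sub>R B" by blast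
    define c where "c = (c' + 1) / 2"
    have c: "c \<in> ?I" using c'(1) by (auto simp: c_def abs_le_iff)
    have "2 * c - 1 = c'" by (simp add: c_def field_simps)
    then have z1: "z 1 = a 0 c" using c'(2) a0[OF c] by simp
    define T where "T = (\<lambda>n. 2 - (1/2::real) ^ n)"
    have zT: "z (T n) = a n c" for n
    proof (induction n)
      case 0 then show ?case using z1 by (simp add: T_def)
    next
      case (Suc n)
      define \<tau> where "\<tau> = (\<lambda>s. T n + s * (1/2) ^ Suc n)"
      have st: "stage n (\<tau> s) = s" for s
        by (simp add: stage_def \<tau>_def T_def field_simps)
      have e1: "((\<lambda>s. z (\<tau> s) - y n s c) has_vector_derivative
          ((1/2) ^ Suc n *\<^sub>R f (\<tau> s, z (\<tau> s)) - v n s c)) (at s)" for s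
      proof -
        have "(\<tau> has_vector_derivative (1/2) ^ Suc n) (at s)"
          unfolding \<tau>_def by (auto intro!: derivative_eq_intros)
        from vector_diff_chain_at[OF this zd]
        show ?thesis using yd[OF c] by (auto intro!: has_vector_derivative_diff simp: o_def)
      qed
      have e2: "norm ((1/2) ^ Suc n *\<^sub>R f (\<tau> s, z (\<tau> s)) - v n s c)
           \<le> K n * norm (z (\<tau> s) - y n s c)" if "s \<in> {0..1}" for s
      proof -
        have "(1/2) ^ Suc n *\<^sub>R f (\<tau> s, z (\<tau> s)) = (1/2) ^ Suc n *\<^sub>R F n (\<tau> s, z (\<tau> s))"
          using f_stage[of n "\<tau> s"] st that by simp
        also have "\<dots> = g n (s, z (\<tau> s))"
          by (simp add: F_def st power_one_over)
        finally show ?thesis using gK[OF c] by simp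
      qed
      have e3: "z (\<tau> 0) - y n 0 c = 0" using Suc y0[OF c] by (simp add: \<tau>_def)
      have "z (\<tau> 1) - y n 1 c = 0"
        by (rule gronwall_zero[of 0 1 "\<lambda>s. z (\<tau> s) - y n s c", OF e1 e2 e3]) auto
      then show ?case using y1[OF c] by (simp add: \<tau>_def T_def)
    qed
    have "T \<longlonglongrightarrow> 2 - 0" unfolding T_def by (intro tendsto_intros LIMSEQ_power_zero) auto
    moreover have "isCont z 2" using zd has_vector_derivative_continuous by blast
    ultimately have "(\<lambda>n. z (T n)) \<longlonglongrightarrow> z 2" by (intro isCont_tendsto_compose[of 2 z]) auto
    then have "z 2 = b c" using lim[OF c] zT LIMSEQ_unique by simp
    then show "p \<in> b ` ?I" using p c by blast
  next
    fix p assume "p \<in> b ` ?I"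
    then obtain c where c: "c \<in> ?I" and p: "p = b c" by blast
    define w where "w = (\<lambda>n t. y n (stage n t) c - a n c)"
    define d where "d = (\<lambda>n t. 2 ^ Suc n *\<^sub>R v n (stage n t) c)"
    define z where "z = (\<lambda>t. (A + (ramp t * (2 * c - 1)) *\<^sub>R B) + (\<Sum>n. w n t))"
    have w_hi: "w n t = a (Suc n) c - a n c" if "1 \<le> stage n t" for n t
      using moving_arc_rest(2)[OF mov c that] y1[OF c] by (simp add: w_def)
    have w_lo: "w n t = 0" if "stage n t \<le> 0" for n t
      using moving_arc_rest(1)[OF mov c that] y0[OF c] by (simp add: w_def)
    have sw: "summable (\<lambda>n. w n t)" for t
    proof (rule summable_comparison_test)
      show "\<exists>N. \<forall>n\<ge>N. norm (w n t) \<le> C * (1/4) ^ n"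
        using disp[OF c] by (auto simp: w_def power_one_over field_simps)
      show "summable (\<lambda>n. C * (1/4::real) ^ n)" by (intro summable_mult summable_geometric) auto
    qed
    have wd: "(w n has_vector_derivative d n t) (at t)" for n t
    proof -
      have "(stage n has_vector_derivative 2 ^ Suc n) (at t)"
        using stage_has_derivative has_real_derivative_iff_has_vector_derivative by blast
      from vector_diff_chain_at[OF this yd[OF c, of n]]
      show ?thesis unfolding w_def d_def by (auto simp: o_def intro!: derivative_eq_intros)
    qed
    have dM: "norm (d n t) \<le> 2 * 1 * C * (1/2) ^ n" for n t
    proof -
      have "norm (d n t) \<le> 2 ^ Suc n * (1 * (C / 4 ^ n))"
        unfolding d_def norm_scaleR using vM[OF c] by (intro mult_mono) auto
      then show ?thesis unfolding pw .
    qed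
    have "((\<lambda>t. \<Sum>n. w n t) has_vector_derivative (\<Sum>n. d n t)) (at t)" for t
      by (rule has_vector_derivative_suminf[OF wd dM _ sw]) (intro summable_mult summable_geometric, auto)
    then have zd0: "(z has_vector_derivative ((ramp' t * (2 * c - 1)) *\<^sub>R B + (\<Sum>n. d n t))) (at t)" for t
      unfolding z_def
      by (auto intro!: derivative_eq_intros ramp_has_derivative)
    have z_first: "z t = A + (ramp t * (2 * c - 1)) *\<^sub>R B" if "t \<le> 1" for t
      using w_lo[OF stage_outside(1)[OF that]] by (simp add: z_def)
    have z_stage: "z t = y n (stage n t) c" if st: "0 \<le> stage n t" "stage n t \<le> 1" for n t
    proof -
      have t1: "1 \<le> t"
      proof (rule ccontr)
        assume "\<not> 1 \<le> t"
        then have "2 ^ Suc n * (2 - t) > 2 * 1" by (intro mult_le_less_imp_less) auto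
        then show False using st by (simp add: stage_def)
      qed
      have "w m t = 0" if "m \<notin> {..<Suc n}" for m
        using stage_order(2)[of n m t] st that by (intro w_lo) auto
      then have "(\<Sum>m. w m t) = (\<Sum>m<Suc n. w m t)" by (intro suminf_finite) auto
      also have "\<dots> = (\<Sum>m<n. a (Suc m) c - a m c) + (y n (stage n t) c - a n c)"
        using w_hi[OF stage_order(1)[OF _ st(1)]] by (simp add: w_def)
      also have "\<dots> = y n (stage n t) c - a 0 c" using sum_lessThan_telescope[of "\<lambda>m. a m c" n] by simp
      finally show ?thesis using ramp_simps(2)[OF t1] a0[OF c] by (simp add: z_def)
    qed
    have zd: "(z has_vector_derivative f (t, z t)) (at t)" for t
    proof -
      have "f0 (t, z t) = (ramp' t * (2 * c - 1)) *\<^sub>R B"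
      proof (cases "t \<le> 1")
        case True
        then show ?thesis using z_first f0y[of "2 * c - 1" t] c by auto
      next
        case False
        then show ?thesis using f00[of t] ramp_simps(3)[of t] by simp
      qed
      moreover have "F n (t, z t) = d n t" for n
      proof (cases "stage n t \<le> 0 \<or> 1 \<le> stage n t")
        case True
        then show ?thesis using F0[of n t] v0[OF c True] by (auto simp: d_def)
      next
        case False
        then show ?thesis using z_stage[of n t] gv[OF c] by (simp add: F_def d_def)
      qed
      ultimately show ?thesis using zd0[of t] by (simp add: f_def)
    qed
    have cz: "continuous_on UNIV z"
      using zd has_vector_derivative_continuous continuous_at_imp_continuous_on by blast
    have "z C1_differentiable_on UNIV"
      unfolding C1_differentiable_on_def
    proof (intro exI[of _ "\<lambda>t. f (t, z t)"] conjI ballI zd)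
      show "continuous_on UNIV (\<lambda>t. f (t, z t))"
        by (intro continuous_on_compose2[OF cf] continuous_on_Pair continuous_on_id cz) auto
    qed
    moreover have "z 0 = A" using z_first[of 0] ramp_simps(1)[of 0] by simp
    moreover have "z 2 = b c"
    proof -
      have "(\<lambda>n. w n 2) = (\<lambda>n. a (Suc n) c - a n c)" using w_hi stage_outside(2)[of 2] by auto
      moreover have "(\<lambda>n. a (Suc n) c - a n c) sums (b c - a 0 c)" by (rule telescope_sums[OF lim[OF c]])
      ultimately have "(\<Sum>n. w n 2) = b c - a 0 c" by (simp add: sums_iff)
      then show ?thesis using ramp_simps(2)[of 2] a0[OF c] by (simp add: z_def)
    qed
    ultimately show "p \<in> funnel_section_at 2 0 A f"
      unfolding funnel_section_at_def mem_Collect_eq using zd p by (intro exI[of _ z]) simp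
  qed
  then show ?thesis unfolding funnel_section_def using cf supp by blast
qed

section \<open>Composing moves of arcs\<close>

lemma arc_move_mono:
  assumes "arc_move M a b" "M \<le> M'" shows "arc_move M' a b"
proof -
  have "moving_arc M' L y v" if "moving_arc M L y v" for L y and v :: "real \<Rightarrow> real \<Rightarrow> 'a"
    unfolding moving_arc_def
  proof (intro conjI allI ballI)
    fix t c :: real assume "c \<in> {0..1}"
    then have "norm (v t c) \<le> M" using that unfolding moving_arc_def by blast
    then show "norm (v t c) \<le> M'" using assms(2) by linarith
  qed (use that[unfolded moving_arc_def] in \<open>blast+\<close>)
  then show ?thesis using assms(1) unfolding arc_move_def by blast
qed

lemma continuous_on_time_change:
  assumes "continuous_on (UNIV \<times> {0..1}) (\<lambda>(t,c). F t c)" "continuous_on UNIV \<phi>"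
  shows "continuous_on (UNIV \<times> {0..1::real}) (\<lambda>(t::real,c). F (\<phi> t :: real) c)"
proof -
  have "continuous_on (UNIV \<times> {0..1}) (\<lambda>p::real \<times> real. (\<phi> (fst p), snd p))"
    by (intro continuous_on_Pair continuous_on_compose2[OF assms(2)] continuous_on_fst continuous_on_snd
        continuous_on_id) auto
  from continuous_on_compose2[OF assms(1) this] show ?thesis by (simp add: split_def image_subset_iff)
qed

lemma arc_move_reverse:
  assumes "arc_move M a b" shows "arc_move M b a"
proof -
  obtain L y v where m: "moving_arc M L y v" and ab: "\<And>c. c \<in> {0..1} \<Longrightarrow> y 0 c = a c \<and> y 1 c = b c"
    using assms unfolding arc_move_def by blast
  have 1: "((\<lambda>t. y (1 - t) c) has_vector_derivative - v (1 - t) c) (at t)" if "c \<in> {0..1}" for c t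
  proof -
    have "((\<lambda>t::real. 1 - t) has_vector_derivative - 1) (at t)" by (auto intro!: derivative_eq_intros)
    moreover have "((\<lambda>t. y t c) has_vector_derivative v (1 - t) c) (at (1 - t))"
      using m that unfolding moving_arc_def by blast
    ultimately show ?thesis using vector_diff_chain_at[of "\<lambda>t. 1 - t" "-1" t "\<lambda>t. y t c"] by (simp add: o_def)
  qed
  have "moving_arc M L (\<lambda>t. y (1 - t)) (\<lambda>t c. - v (1 - t) c)"
    unfolding moving_arc_def
  proof (intro conjI allI ballI impI)
    show "continuous_on (UNIV \<times> {0..1}) (\<lambda>(t,c). y (1 - t) c)"
      by (rule continuous_on_time_change) (use m in \<open>auto simp: moving_arc_def intro!: continuous_intros\<close>)
    have "continuous_on (UNIV \<times> {0..1}) (\<lambda>(t,c). v (1 - t) c)"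
      by (rule continuous_on_time_change) (use m in \<open>auto simp: moving_arc_def intro!: continuous_intros\<close>)
    then show "continuous_on (UNIV \<times> {0..1}) (\<lambda>(t,c). - v (1 - t) c)"
      using continuous_on_minus by (fastforce simp: split_def)
    fix t c d :: real assume c: "c \<in> {0..1}"
    show "norm (- v (1 - t) c) \<le> M" using m c unfolding moving_arc_def by simp
    show "- v (1 - t) c = 0" if "t \<le> 0 \<or> 1 \<le> t" using m c that unfolding moving_arc_def by auto
    assume d: "d \<in> {0..1}"
    have "norm (v (1 - t) c - v (1 - t) d) \<le> L * norm (y (1 - t) c - y (1 - t) d)"
      using m c d unfolding moving_arc_def by blast
    then show "norm (- v (1 - t) c - - v (1 - t) d) \<le> L * norm (y (1 - t) c - y (1 - t) d)"
      by (simp add: norm_minus_commute)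
  qed (rule 1)
  then show ?thesis unfolding arc_move_def using ab by (intro exI[of _ L] exI[of _ "\<lambda>t. y (1 - t)"] exI) auto
qed

text \<open>
  Each motion is run at double speed. The arc rests outside the time interval of the motion, so the
  concatenation is the sum of both motions minus the common arc \<open>b\<close>; no case distinction is
  needed for its derivative.
\<close>

lemma arc_move_trans:
  assumes "arc_move M a b" "arc_move M b c"
  shows "arc_move (2 * M) a c"
proof -
  obtain L y v where m: "moving_arc M L y v" and y: "\<And>c. c \<in> {0..1} \<Longrightarrow> y 0 c = a c" "\<And>c. c \<in> {0..1} \<Longrightarrow> y 1 c = b c"
    using assms(1) unfolding arc_move_def by blast
  obtain L' y' v' where m': "moving_arc M L' y' v'" and y': "\<And>d. d \<in> {0..1} \<Longrightarrow> y' 0 d = b d" "\<And>d. d \<in> {0..1} \<Longrightarrow> y' 1 d = c d"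
    using assms(2) unfolding arc_move_def by blast
  define w where "w = (\<lambda>t d. y (2 * t) d + y' (2 * t - 1) d - b d)"
  define u where "u = (\<lambda>t d. 2 *\<^sub>R v (2 * t) d + 2 *\<^sub>R v' (2 * t - 1) d)"
  note M = m[unfolded moving_arc_def] and M' = m'[unfolded moving_arc_def]
  have lo: "w t d = y (2 * t) d" "u t d = 2 *\<^sub>R v (2 * t) d" if "t \<le> 1/2" "d \<in> {0..1}" for t d
    using moving_arc_rest(1)[OF m' that(2), of "2 * t - 1"] y'(1)[OF that(2)] M' that by (auto simp: w_def u_def)
  have hi: "w t d = y' (2 * t - 1) d" "u t d = 2 *\<^sub>R v' (2 * t - 1) d" if "\<not> t \<le> 1/2" "d \<in> {0..1}" for t d
    using moving_arc_rest(2)[OF m that(2), of "2 * t"] y(2)[OF that(2)] M that by (auto simp: w_def u_def)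
  have cb: "continuous_on {0..1} b"
  proof -
    have "continuous_on {0..1} (\<lambda>d. case (1::real, d) of (t,c) \<Rightarrow> y t c)"
      by (rule continuous_on_compose2[of "UNIV \<times> {0..1}" _ _ "Pair 1"])
         (use M in \<open>auto intro!: continuous_intros\<close>)
    then show ?thesis by (rule continuous_on_eq) (use y(2) in auto)
  qed
  have c2: "continuous_on UNIV (\<lambda>t::real. 2 * t)" "continuous_on UNIV (\<lambda>t::real. 2 * t - 1)"
    by (intro continuous_intros)+
  have cc: "continuous_on (UNIV \<times> {0..1}) (\<lambda>p. y (2 * fst p) (snd p))"
     "continuous_on (UNIV \<times> {0..1}) (\<lambda>p. y' (2 * fst p - 1) (snd p))"
     "continuous_on (UNIV \<times> {0..1}) (\<lambda>p. v (2 * fst p) (snd p))"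
     "continuous_on (UNIV \<times> {0..1}) (\<lambda>p. v' (2 * fst p - 1) (snd p))"
    using continuous_on_time_change[OF M[THEN conjunct1] c2(1)]
      continuous_on_time_change[OF M'[THEN conjunct1] c2(2)]
      continuous_on_time_change[OF M[THEN conjunct2, THEN conjunct1] c2(1)]
      continuous_on_time_change[OF M'[THEN conjunct2, THEN conjunct1] c2(2)]
    by (simp_all add: split_def)
  have "moving_arc (2 * M) (2 * \<bar>L\<bar> + 2 * \<bar>L'\<bar>) w u"
    unfolding moving_arc_def
  proof (intro conjI allI ballI impI)
    show "continuous_on (UNIV \<times> {0..1}) (\<lambda>(t,c). w t c)"
      unfolding w_def split_def
      by (intro continuous_on_diff continuous_on_add cc continuous_on_compose2[OF cb] continuous_on_snd continuous_on_id) auto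
    show "continuous_on (UNIV \<times> {0..1}) (\<lambda>(t,c). u t c)"
      unfolding u_def split_def
      by (intro continuous_on_add continuous_on_scaleR continuous_on_const cc)
    fix t d e :: real assume d: "d \<in> {0..1}"
    have 1: "((\<lambda>t. y (2 * t) d) has_vector_derivative 2 *\<^sub>R v (2 * t) d) (at t)"
    proof -
      have "((\<lambda>t::real. 2 * t) has_vector_derivative 2) (at t)" by (auto intro!: derivative_eq_intros)
      moreover have "((\<lambda>t. y t d) has_vector_derivative v (2 * t) d) (at (2 * t))" using M d by blast
      ultimately show ?thesis using vector_diff_chain_at[of "\<lambda>t. 2 * t" 2 t "\<lambda>t. y t d"] by (simp add: o_def)
    qed
    have 2: "((\<lambda>t. y' (2 * t - 1) d) has_vector_derivative 2 *\<^sub>R v' (2 * t - 1) d) (at t)"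
    proof -
      have "((\<lambda>t::real. 2 * t - 1) has_vector_derivative 2) (at t)" by (auto intro!: derivative_eq_intros)
      moreover have "((\<lambda>t. y' t d) has_vector_derivative v' (2 * t - 1) d) (at (2 * t - 1))" using M' d by blast
      ultimately show ?thesis using vector_diff_chain_at[of "\<lambda>t. 2 * t - 1" 2 t "\<lambda>t. y' t d"] by (simp add: o_def)
    qed
    show "((\<lambda>t. w t d) has_vector_derivative u t d) (at t)"
      unfolding w_def u_def using has_vector_derivative_diff[OF has_vector_derivative_add[OF 1 2] has_vector_derivative_const, of "b d"] by simp
    have vM: "norm (v s d) \<le> M" "norm (v' s d) \<le> M" for s using M M' d by blast+
    show "norm (u t d) \<le> 2 * M"
      using lo[OF _ d, of t] hi[OF _ d, of t] vM by (cases "t \<le> 1/2") auto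
    show "u t d = 0" if "t \<le> 0 \<or> 1 \<le> t"
    proof -
      have "v (2 * t) d = 0" "v' (2 * t - 1) d = 0" using M M' d that by auto
      then show ?thesis by (simp add: u_def)
    qed
    assume e: "e \<in> {0..1}"
    show "norm (u t d - u t e) \<le> (2 * \<bar>L\<bar> + 2 * \<bar>L'\<bar>) * norm (w t d - w t e)"
    proof (cases "t \<le> 1/2")
      case True
      have "norm (v (2 * t) d - v (2 * t) e) \<le> L * norm (w t d - w t e)"
        using M d e lo(1)[OF True] by simp
      also have "\<dots> \<le> (\<bar>L\<bar> + \<bar>L'\<bar>) * norm (w t d - w t e)" by (intro mult_right_mono) auto
      finally have "norm (v (2 * t) d - v (2 * t) e) \<le> (\<bar>L\<bar> + \<bar>L'\<bar>) * norm (w t d - w t e)" .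
      moreover have "u t d - u t e = 2 *\<^sub>R (v (2 * t) d - v (2 * t) e)"
        using lo(2)[OF True d] lo(2)[OF True e] by (simp add: scaleR_diff_right)
      then have "norm (u t d - u t e) = 2 * norm (v (2 * t) d - v (2 * t) e)" by simp
      ultimately show ?thesis by (simp add: distrib_right)
    next
      case False
      have "norm (v' (2 * t - 1) d - v' (2 * t - 1) e) \<le> L' * norm (w t d - w t e)"
        using M' d e hi(1)[OF False] by simp
      also have "\<dots> \<le> (\<bar>L\<bar> + \<bar>L'\<bar>) * norm (w t d - w t e)" by (intro mult_right_mono) auto
      finally have "norm (v' (2 * t - 1) d - v' (2 * t - 1) e) \<le> (\<bar>L\<bar> + \<bar>L'\<bar>) * norm (w t d - w t e)" .
      moreover have "u t d - u t e = 2 *\<^sub>R (v' (2 * t - 1) d - v' (2 * t - 1) e)"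
        using hi(2)[OF False d] hi(2)[OF False e] by (simp add: scaleR_diff_right)
      then have "norm (u t d - u t e) = 2 * norm (v' (2 * t - 1) d - v' (2 * t - 1) e)" by simp
      ultimately show ?thesis by (simp add: distrib_right)
    qed
  qed
  moreover have "w 0 d = a d \<and> w 1 d = c d" if "d \<in> {0..1}" for d
    using lo(1)[of 0, OF _ that] hi(1)[of 1, OF _ that] y(1) y'(2) that by simp
  ultimately show ?thesis unfolding arc_move_def by blast
qed

text \<open>
  Reparametrising the time of an isotopy by \<open>ramp\<close> makes it start and end at rest; the factor 2 is
  the maximal slope of \<open>ramp\<close>.
\<close>

lemma arc_move_isotopy:
  fixes Z V :: "real \<Rightarrow> real \<Rightarrow> 'a::real_normed_vector"
  assumes d: "\<And>s c. s \<in> {0..1} \<Longrightarrow> c \<in> {0..1} \<Longrightarrow> ((\<lambda>s. Z s c) has_vector_derivative V s c) (at s)"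
    and cZ: "continuous_on ({0..1} \<times> {0..1}) (\<lambda>(s,c). Z s c)"
    and cV: "continuous_on ({0..1} \<times> {0..1}) (\<lambda>(s,c). V s c)"
    and B: "\<And>s c. s \<in> {0..1} \<Longrightarrow> c \<in> {0..1} \<Longrightarrow> norm (V s c) \<le> B"
    and L: "\<And>s c d. s \<in> {0..1} \<Longrightarrow> c \<in> {0..1} \<Longrightarrow> d \<in> {0..1} \<Longrightarrow>
        norm (V s c - V s d) \<le> L * norm (Z s c - Z s d)"
  shows "arc_move (2 * B) (Z 0) (Z 1)"
proof -
  define y where "y = (\<lambda>t c. Z (ramp t) c)"
  define v where "v = (\<lambda>t c. ramp' t *\<^sub>R V (ramp t) c)"
  have r: "ramp t \<in> {0..1}" for t using ramp_range by simp
  have cr: "continuous_on (UNIV \<times> {0..1}) (\<lambda>p::real \<times> real. (ramp (fst p), snd p))"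
    by (intro continuous_on_Pair continuous_ramp continuous_on_fst continuous_on_snd continuous_on_id)
  have img: "(\<lambda>p::real \<times> real. (ramp (fst p), snd p)) ` (UNIV \<times> {0..1}) \<subseteq> {0..1} \<times> {0..1}"
    using r by auto
  have "moving_arc (2 * B) (2 * L) y v"
    unfolding moving_arc_def
  proof (intro conjI allI ballI impI)
    show "continuous_on (UNIV \<times> {0..1}) (\<lambda>(t,c). y t c)"
      using continuous_on_compose2[OF cZ cr img] by (simp add: y_def split_def)
    have "continuous_on (UNIV \<times> {0..1}) (\<lambda>p. V (ramp (fst p)) (snd p))"
      using continuous_on_compose2[OF cV cr img] by (simp add: split_def)
    then show "continuous_on (UNIV \<times> {0..1}) (\<lambda>(t,c). v t c)"
      unfolding v_def split_def
      by (intro continuous_on_scaleR continuous_ramp' continuous_on_fst continuous_on_id)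
    fix t c e :: real assume c: "c \<in> {0..1}"
    show "((\<lambda>t. y t c) has_vector_derivative v t c) (at t)"
      using vector_diff_chain_at[of ramp "ramp' t" t "\<lambda>s. Z s c", OF _ d[OF r c]] ramp_has_derivative[of t]
      by (simp add: y_def v_def o_def has_real_derivative_iff_has_vector_derivative)
    have "ramp' t * norm (V (ramp t) c) \<le> 2 * B"
      by (intro mult_mono ramp'_bounds B r c) auto
    then show "norm (v t c) \<le> 2 * B" using ramp'_bounds(1)[of t] by (simp add: v_def)
    show "v t c = 0" if "t \<le> 0 \<or> 1 \<le> t" using ramp_simps(3)[OF that] by (simp add: v_def)
    assume e: "e \<in> {0..1}"
    have "ramp' t * norm (V (ramp t) c - V (ramp t) e) \<le> 2 * (L * norm (Z (ramp t) c - Z (ramp t) e))"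
      by (intro mult_mono ramp'_bounds L r c e) auto
    then show "norm (v t c - v t e) \<le> 2 * L * norm (y t c - y t e)"
      using ramp'_bounds(1)[of t] by (simp add: v_def y_def scaleR_diff_right[symmetric])
  qed
  moreover have "y 0 c = Z 0 c \<and> y 1 c = Z 1 c" for c
    using ramp_simps(1)[of 0] ramp_simps(2)[of 1] by (simp add: y_def)
  ultimately show ?thesis unfolding arc_move_def by blast
qed

lemma arc_move_linear:
  fixes a b :: "real \<Rightarrow> 'a::real_normed_vector"
  assumes "continuous_on {0..1} a" "continuous_on {0..1} b"
    and B: "\<And>c. c \<in> {0..1} \<Longrightarrow> norm (b c - a c) \<le> B"
    and L: "\<And>s c d. s \<in> {0..1} \<Longrightarrow> c \<in> {0..1} \<Longrightarrow> d \<in> {0..1} \<Longrightarrow>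
        norm ((b c - a c) - (b d - a d)) \<le> L * norm ((a c + s *\<^sub>R (b c - a c)) - (a d + s *\<^sub>R (b d - a d)))"
  shows "arc_move (2 * B) a b"
proof -
  have ca: "continuous_on ({0..1} \<times> {0..1}) (\<lambda>p::real \<times> real. a (snd p))"
    and cb: "continuous_on ({0..1} \<times> {0..1}) (\<lambda>p::real \<times> real. b (snd p))"
    using assms(1,2) by (auto intro!: continuous_on_compose2[of "{0..1}" _ _ snd] continuous_intros)
  have "arc_move (2 * B) (\<lambda>c. a c + 0 *\<^sub>R (b c - a c)) (\<lambda>c. a c + 1 *\<^sub>R (b c - a c))"
  proof (rule arc_move_isotopy[where Z = "\<lambda>s c. a c + s *\<^sub>R (b c - a c)" and V = "\<lambda>s c. b c - a c" and L = L])
    show "((\<lambda>s. a c + s *\<^sub>R (b c - a c)) has_vector_derivative b c - a c) (at s)" for s c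
      by (auto intro!: derivative_eq_intros)
    show "continuous_on ({0..1} \<times> {0..1}) (\<lambda>(s,c). a c + s *\<^sub>R (b c - a c))"
      unfolding split_def by (intro continuous_intros ca cb)
    show "continuous_on ({0..1} \<times> {0..1}) (\<lambda>(s::real,c). b c - a c)"
      unfolding split_def by (intro continuous_intros ca cb)
  qed (use B L in auto)
  then show ?thesis by simp
qed

section \<open>Compressing the cells of a lattice\<close>

text \<open>
  A continuous substitute for rounding to the nearest integer: it is constant on the open
  intervals of radius 1/3 about the integers and climbs with slope 3 in the gaps.
\<close>

definition staircase :: "real \<Rightarrow> real" where
  "staircase x = of_int \<lfloor>x\<rfloor> + max 0 (min 1 (3 * frac x - 1))"

lemma staircase_increment:
  assumes "x \<le> y"
  shows "0 \<le> staircase y - staircase x" "staircase y - staircase x \<le> 3 * (y - x)"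
proof -
  define p where "p = max 0 (min 1 (3 * frac x - 1))"
  define q where "q = max 0 (min 1 (3 * frac y - 1))"
  have p: "0 \<le> p" "p \<le> 1" "1 - p \<le> 3 * (1 - (x - of_int \<lfloor>x\<rfloor>))"
    using frac_lt_1[of x] by (auto simp: p_def frac_def)
  have q: "0 \<le> q" "q \<le> 1" "q \<le> 3 * (y - of_int \<lfloor>y\<rfloor>)"
    using frac_ge_0[of y] by (auto simp: q_def frac_def)
  have xy: "x = of_int \<lfloor>x\<rfloor> + frac x" "y = of_int \<lfloor>y\<rfloor> + frac y" by (simp_all add: frac_def)
  have s: "staircase x = of_int \<lfloor>x\<rfloor> + p" "staircase y = of_int \<lfloor>y\<rfloor> + q"
    by (simp_all add: staircase_def p_def q_def)
  have "0 \<le> staircase y - staircase x \<and> staircase y - staircase x \<le> 3 * (y - x)"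
  proof (cases "\<lfloor>x\<rfloor> = \<lfloor>y\<rfloor>")
    case True
    then have "frac x \<le> frac y" "y - x = frac y - frac x" using assms xy by linarith+
    moreover have "p \<le> q" "q - p \<le> 3 * (frac y - frac x)"
      using \<open>frac x \<le> frac y\<close> unfolding p_def q_def by (auto simp: max_def min_def)
    ultimately show ?thesis using s True by simp
  next
    case False
    then have "\<lfloor>x\<rfloor> + 1 \<le> \<lfloor>y\<rfloor>" using floor_mono[OF assms] by linarith
    then have "of_int \<lfloor>x\<rfloor> + 1 \<le> (of_int \<lfloor>y\<rfloor> :: real)" by linarith
    moreover have "0 \<le> n + q - (m + p) \<and> n + q - (m + p) \<le> 3 * (y - x)"
      if "m + 1 \<le> n" "1 - p \<le> 3 * (1 - (x - m))" "q \<le> 3 * (y - n)" for m n :: real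
      using that p(1,2) q(1,2) by simp
    ultimately show ?thesis using p q s by simp
  qed
  then show "0 \<le> staircase y - staircase x" "staircase y - staircase x \<le> 3 * (y - x)" by auto
qed

lemma staircase_near: "\<bar>staircase x - x\<bar> \<le> 1"
  using frac_lt_1[of x] frac_ge_0[of x] unfolding staircase_def frac_def by linarith

lemma staircase_flat:
  assumes "\<bar>x - of_int k\<bar> < 1/3" shows "staircase x = of_int k"
proof (cases "of_int k \<le> x")
  case True
  then have f: "\<lfloor>x\<rfloor> = k" using assms by linarith
  then have "frac x < 1/3" using assms True by (simp add: frac_def)
  then show ?thesis using f by (simp add: staircase_def)
next
  case False
  then have f: "\<lfloor>x\<rfloor> = k - 1" using assms by linarith
  then have "frac x > 2/3" using assms False by (simp add: frac_def)
  then show ?thesis using f by (simp add: staircase_def)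
qed

text \<open>
  A homeomorphism of the line that compresses the intervals of radius \<open>\<delta> / 3\<close> about the points
  \<open>\<delta> * (k + \<sigma>)\<close>, called cores below, by the factor \<open>\<eta>\<close>. Mixing in a small multiple of the
  identity makes the staircase bi-Lipschitz.
\<close>

definition squeeze :: "real \<Rightarrow> real \<Rightarrow> real \<Rightarrow> real \<Rightarrow> real" where
  "squeeze \<eta> \<delta> \<sigma> s = \<eta> * s + (1 - \<eta>) * (\<delta> * (staircase (s / \<delta> - \<sigma>) + \<sigma>))"

lemma squeeze_increment:
  assumes "0 < \<delta>" "0 < \<eta>" "\<eta> \<le> 1" "x \<le> y"
  shows "\<eta> * (y - x) \<le> squeeze \<eta> \<delta> \<sigma> y - squeeze \<eta> \<delta> \<sigma> x"
    and "squeeze \<eta> \<delta> \<sigma> y - squeeze \<eta> \<delta> \<sigma> x \<le> 3 * (y - x)"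
proof -
  define D where "D = staircase (y / \<delta> - \<sigma>) - staircase (x / \<delta> - \<sigma>)"
  have "x / \<delta> - \<sigma> \<le> y / \<delta> - \<sigma>" using assms by (simp add: divide_right_mono)
  from staircase_increment[OF this] have D: "0 \<le> D" "D \<le> 3 * (y / \<delta> - x / \<delta>)" by (simp_all add: D_def)
  have "\<delta> * D \<le> \<delta> * (3 * (y / \<delta> - x / \<delta>))" using assms D by (intro mult_left_mono) auto
  also have "\<dots> = 3 * (y - x)" using assms by (simp add: field_simps)
  finally have D3: "\<delta> * D \<le> 3 * (y - x)" .
  have eq: "squeeze \<eta> \<delta> \<sigma> y - squeeze \<eta> \<delta> \<sigma> x = \<eta> * (y - x) + (1 - \<eta>) * (\<delta> * D)"
    by (simp add: squeeze_def D_def algebra_simps)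
  show "\<eta> * (y - x) \<le> squeeze \<eta> \<delta> \<sigma> y - squeeze \<eta> \<delta> \<sigma> x"
    unfolding eq using assms D by simp
  have "\<eta> * (y - x) \<le> \<eta> * (3 * (y - x))" using assms by (intro mult_left_mono) auto
  moreover have "(1 - \<eta>) * (\<delta> * D) \<le> (1 - \<eta>) * (3 * (y - x))" using assms D3 by (intro mult_left_mono) auto
  ultimately show "squeeze \<eta> \<delta> \<sigma> y - squeeze \<eta> \<delta> \<sigma> x \<le> 3 * (y - x)"
    unfolding eq by (simp add: algebra_simps)
qed

lemma squeeze_near:
  assumes "0 < \<delta>" "0 < \<eta>" "\<eta> \<le> 1" shows "\<bar>squeeze \<eta> \<delta> \<sigma> s - s\<bar> \<le> \<delta>"
proof -
  have "squeeze \<eta> \<delta> \<sigma> s - s = (1 - \<eta>) * (\<delta> * (staircase (s / \<delta> - \<sigma>) - (s / \<delta> - \<sigma>)))"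
    using assms by (simp add: squeeze_def field_simps)
  also have "\<bar>\<dots>\<bar> = (1 - \<eta>) * (\<delta> * \<bar>staircase (s / \<delta> - \<sigma>) - (s / \<delta> - \<sigma>)\<bar>)"
    using assms by (simp add: abs_mult)
  also have "\<dots> \<le> 1 * (\<delta> * 1)"
    using assms staircase_near[of "s / \<delta> - \<sigma>"] by (intro mult_mono) auto
  finally show ?thesis by simp
qed

lemma squeeze_core:
  assumes "0 < \<delta>" "\<bar>s - \<delta> * (of_int k + \<sigma>)\<bar> < \<delta> / 3"
  shows "squeeze \<eta> \<delta> \<sigma> s = \<eta> * s + (1 - \<eta>) * (\<delta> * (of_int k + \<sigma>))"
proof -
  have "s / \<delta> - \<sigma> - of_int k = (s - \<delta> * (of_int k + \<sigma>)) / \<delta>"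
    using assms(1) by (simp add: diff_divide_distrib)
  then have "\<bar>s / \<delta> - \<sigma> - of_int k\<bar> = \<bar>s - \<delta> * (of_int k + \<sigma>)\<bar> / \<delta>"
    using assms(1) by (simp add: abs_divide)
  also have "\<dots> < (\<delta> / 3) / \<delta>" using assms by (intro divide_strict_right_mono) auto
  also have "\<dots> = 1/3" using assms by simp
  finally show ?thesis using staircase_flat by (simp add: squeeze_def)
qed

definition squeeze_plane :: "real \<Rightarrow> real \<Rightarrow> real \<Rightarrow> real \<Rightarrow> complex \<Rightarrow> complex" where
  "squeeze_plane \<eta> \<delta> \<sigma> \<tau> z = Complex (squeeze \<eta> \<delta> \<sigma> (Re z)) (squeeze \<eta> \<delta> \<tau> (Im z))"

lemma cmod_le_componentwise:
  assumes "\<bar>Re z\<bar> \<le> k * \<bar>Re w\<bar>" "\<bar>Im z\<bar> \<le> k * \<bar>Im w\<bar>" "0 \<le> k"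
  shows "cmod z \<le> k * cmod w"
proof -
  have "(cmod z)\<^sup>2 = \<bar>Re z\<bar>\<^sup>2 + \<bar>Im z\<bar>\<^sup>2" by (simp add: cmod_power2)
  also have "\<dots> \<le> (k * \<bar>Re w\<bar>)\<^sup>2 + (k * \<bar>Im w\<bar>)\<^sup>2" using assms by (intro add_mono power_mono) auto
  also have "\<dots> = (k * cmod w)\<^sup>2" by (simp add: power_mult_distrib cmod_power2 distrib_left)
  finally show ?thesis by (rule power2_le_imp_le) (use assms(3) in simp)
qed

text \<open>
  The estimates are inherited from the two coordinates. The last one says that the straight-line
  homotopy from the identity to the compression runs through uniformly injective maps; this holds because
  a convex combination of increasing functions is increasing.
\<close>

lemma squeeze_plane_bounds:
  fixes \<sigma> \<tau> :: real
  assumes "0 < \<delta>" "0 < \<eta>" "\<eta> \<le> 1"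
  defines "G \<equiv> squeeze_plane \<eta> \<delta> \<sigma> \<tau>"
  shows "cmod (G z - z) \<le> 2 * \<delta>"
    and "cmod (G z - G w) \<le> 3 * cmod (z - w)"
    and "cmod ((G z - z) - (G w - w)) \<le> 3 * cmod (z - w)"
    and "s \<in> {0..1} \<Longrightarrow> \<eta> * cmod (z - w) \<le> cmod ((z + s *\<^sub>R (G z - z)) - (w + s *\<^sub>R (G w - w)))"
proof -
  have "cmod (G z - z) \<le> \<bar>Re (G z - z)\<bar> + \<bar>Im (G z - z)\<bar>" by (rule cmod_le)
  then show "cmod (G z - z) \<le> 2 * \<delta>"
    using squeeze_near[OF assms(1-3), of \<sigma> "Re z"] squeeze_near[OF assms(1-3), of \<tau> "Im z"]
    by (simp add: G_def squeeze_plane_def)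
  have inc: "\<bar>squeeze \<eta> \<delta> \<sigma> x - squeeze \<eta> \<delta> \<sigma> y\<bar> \<le> 3 * \<bar>x - y\<bar>"
    "\<bar>(squeeze \<eta> \<delta> \<sigma> x - x) - (squeeze \<eta> \<delta> \<sigma> y - y)\<bar> \<le> 3 * \<bar>x - y\<bar>" for \<sigma> x y
  proof -
    have *: "\<bar>squeeze \<eta> \<delta> \<sigma> x - squeeze \<eta> \<delta> \<sigma> y\<bar> \<le> 3 * \<bar>x - y\<bar> \<and>
       \<bar>(squeeze \<eta> \<delta> \<sigma> x - x) - (squeeze \<eta> \<delta> \<sigma> y - y)\<bar> \<le> 3 * \<bar>x - y\<bar>" if "x \<le> y" for x y
    proof -
      have "0 \<le> \<eta> * (y - x)" using assms that by simp
      then have "0 \<le> squeeze \<eta> \<delta> \<sigma> y - squeeze \<eta> \<delta> \<sigma> x"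
        using squeeze_increment(1)[OF assms(1-3) that, of \<sigma>] by linarith
      then show ?thesis using squeeze_increment(2)[OF assms(1-3) that, of \<sigma>] that
        by (simp add: abs_le_iff)
    qed
    have "\<bar>squeeze \<eta> \<delta> \<sigma> x - squeeze \<eta> \<delta> \<sigma> y\<bar> \<le> 3 * \<bar>x - y\<bar> \<and>
       \<bar>(squeeze \<eta> \<delta> \<sigma> x - x) - (squeeze \<eta> \<delta> \<sigma> y - y)\<bar> \<le> 3 * \<bar>x - y\<bar>"
      using *[of x y] *[of y x] by (cases "x \<le> y") (simp_all add: abs_minus_commute)
    then show "\<bar>squeeze \<eta> \<delta> \<sigma> x - squeeze \<eta> \<delta> \<sigma> y\<bar> \<le> 3 * \<bar>x - y\<bar>"
      "\<bar>(squeeze \<eta> \<delta> \<sigma> x - x) - (squeeze \<eta> \<delta> \<sigma> y - y)\<bar> \<le> 3 * \<bar>x - y\<bar>"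
      by blast+
  qed
  show "cmod (G z - G w) \<le> 3 * cmod (z - w)"
    by (rule cmod_le_componentwise) (use inc in \<open>simp_all add: G_def squeeze_plane_def\<close>)
  show "cmod ((G z - z) - (G w - w)) \<le> 3 * cmod (z - w)"
    by (rule cmod_le_componentwise) (use inc in \<open>simp_all add: G_def squeeze_plane_def\<close>)
  assume s: "s \<in> {0..1}"
  have low: "\<bar>x - y\<bar> \<le> (1 / \<eta>) * \<bar>(x + s * (squeeze \<eta> \<delta> \<sigma> x - x)) - (y + s * (squeeze \<eta> \<delta> \<sigma> y - y))\<bar>" for \<sigma> x y
  proof -
    have *: "\<eta> * (y - x) \<le> (y + s * (squeeze \<eta> \<delta> \<sigma> y - y)) - (x + s * (squeeze \<eta> \<delta> \<sigma> x - x))" if "x \<le> y" for x y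
    proof -
      have "(1 - s) * (\<eta> * (y - x)) \<le> (1 - s) * (1 * (y - x))"
        using s assms that by (intro mult_left_mono mult_right_mono) auto
      moreover have "s * (\<eta> * (y - x)) \<le> s * (squeeze \<eta> \<delta> \<sigma> y - squeeze \<eta> \<delta> \<sigma> x)"
        using s squeeze_increment[OF assms(1-3) that, of \<sigma>] by (intro mult_left_mono) auto
      ultimately show ?thesis by (simp add: algebra_simps)
    qed
    have "\<eta> * \<bar>x - y\<bar> \<le> \<bar>(x + s * (squeeze \<eta> \<delta> \<sigma> x - x)) - (y + s * (squeeze \<eta> \<delta> \<sigma> y - y))\<bar>"
    proof (cases "x \<le> y")
      case True then show ?thesis using *[of x y] by (simp add: abs_if)
    next
      case False then show ?thesis using *[of y x] by (simp add: abs_if)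
    qed
    then show ?thesis using assms(2) by (simp add: pos_le_divide_eq mult.commute)
  qed
  have "cmod (z - w) \<le> (1 / \<eta>) * cmod ((z + s *\<^sub>R (G z - z)) - (w + s *\<^sub>R (G w - w)))"
    by (rule cmod_le_componentwise)
       (use low[of "Re z" "Re w" \<sigma>] low[of "Im z" "Im w" \<tau>] assms(2) in \<open>simp_all add: G_def squeeze_plane_def\<close>)
  then show "\<eta> * cmod (z - w) \<le> cmod ((z + s *\<^sub>R (G z - z)) - (w + s *\<^sub>R (G w - w)))"
    using assms(2) by (simp add: pos_le_divide_eq mult.commute)
qed

lemma arc_move_squeeze:
  assumes "0 < \<delta>" "0 < \<eta>" "\<eta> \<le> 1" and a: "continuous_on {0..1} a"
  shows "arc_move (4 * \<delta>) a (\<lambda>c. squeeze_plane \<eta> \<delta> \<sigma> \<tau> (a c))"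
proof -
  let ?G = "squeeze_plane \<eta> \<delta> \<sigma> \<tau>"
  note G = squeeze_plane_bounds[OF assms(1-3), where \<sigma> = \<sigma> and \<tau> = \<tau>]
  have cG: "continuous_on UNIV ?G"
    by (rule lipschitz_on_continuous_on[of 3]) (auto intro!: lipschitz_onI G(2) simp: dist_norm)
  have "arc_move (2 * (2 * \<delta>)) a (\<lambda>c. ?G (a c))"
  proof (rule arc_move_linear[where L = "3 / \<eta>"])
    show "continuous_on {0..1} (\<lambda>c. ?G (a c))" by (intro continuous_on_compose2[OF cG a]) auto
    fix s c d :: real assume "s \<in> {0..1}"
    have "cmod ((?G (a c) - a c) - (?G (a d) - a d)) \<le> 3 * cmod (a c - a d)" by (rule G(3))
    also have "\<dots> = 3 / \<eta> * (\<eta> * cmod (a c - a d))" using assms by simp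
    also have "\<dots> \<le> 3 / \<eta> * cmod ((a c + s *\<^sub>R (?G (a c) - a c)) - (a d + s *\<^sub>R (?G (a d) - a d)))"
      by (rule mult_left_mono[OF G(4)[OF \<open>s \<in> {0..1}\<close>]]) (use assms in simp)
    finally show "cmod ((?G (a c) - a c) - (?G (a d) - a d)) \<le>
       3 / \<eta> * cmod ((a c + s *\<^sub>R (?G (a c) - a c)) - (a d + s *\<^sub>R (?G (a d) - a d)))" .
  qed (use a G(1) in auto)
  then show ?thesis by simp
qed

text \<open>
  The bound does not depend on the speed \<open>B\<close> of the isotopy. The arc is first
  compressed at cost of order \<open>\<delta>\<close>. On the cores the compression is a similarity with ratio
  \<open>\<eta>\<close>, and only points in the cores move, so the compressed isotopy has speed at most
  \<open>\<eta> * B\<close>; here \<open>\<eta>\<close> is chosen so small that this is at most \<open>\<delta>\<close>. Finally the compression is undone.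
\<close>

lemma arc_move_in_cores:
  fixes Z V :: "real \<Rightarrow> real \<Rightarrow> complex"
  assumes "0 < \<delta>"
    and d: "\<And>s c. s \<in> {0..1} \<Longrightarrow> c \<in> {0..1} \<Longrightarrow> ((\<lambda>s. Z s c) has_vector_derivative V s c) (at s)"
    and cZ: "continuous_on ({0..1} \<times> {0..1}) (\<lambda>(s,c). Z s c)"
    and cV: "continuous_on ({0..1} \<times> {0..1}) (\<lambda>(s,c). V s c)"
    and B: "\<And>s c. s \<in> {0..1} \<Longrightarrow> c \<in> {0..1} \<Longrightarrow> cmod (V s c) \<le> B"
    and L: "\<And>s c d. s \<in> {0..1} \<Longrightarrow> c \<in> {0..1} \<Longrightarrow> d \<in> {0..1} \<Longrightarrow>
        cmod (V s c - V s d) \<le> L * cmod (Z s c - Z s d)"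
    and core: "\<And>c. c \<in> {0..1} \<Longrightarrow> (\<forall>s. Z s c = Z 0 c) \<or>
        (\<exists>k l. \<forall>s\<in>{0..1}. \<bar>Re (Z s c) - \<delta> * (of_int k + \<sigma>)\<bar> < \<delta> / 3 \<and>
                          \<bar>Im (Z s c) - \<delta> * (of_int l + \<tau>)\<bar> < \<delta> / 3)"
  shows "arc_move (16 * \<delta>) (Z 0) (Z 1)"
proof -
  have B0: "B \<ge> 0" using order_trans[OF norm_ge_zero B[of 0 0]] by simp
  define \<eta> where "\<eta> = min 1 (\<delta> / (B + 1))"
  have \<eta>: "0 < \<eta>" "\<eta> \<le> 1" using \<open>0 < \<delta>\<close> B0 by (auto simp: \<eta>_def)
  have "\<eta> * B \<le> \<delta> / (B + 1) * (B + 1)" using B0 \<open>0 < \<delta>\<close> by (intro mult_mono) (auto simp: \<eta>_def)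
  then have \<eta>B: "\<eta> * B \<le> \<delta>" using B0 by simp
  let ?G = "squeeze_plane \<eta> \<delta> \<sigma> \<tau>"
  note G = squeeze_plane_bounds[OF \<open>0 < \<delta>\<close> \<eta>, where \<sigma> = \<sigma> and \<tau> = \<tau>]
  have cG: "continuous_on UNIV ?G"
    by (rule lipschitz_on_continuous_on[of 3]) (auto intro!: lipschitz_onI G(2) simp: dist_norm)
  have Gd: "((\<lambda>s. ?G (Z s c)) has_vector_derivative \<eta> *\<^sub>R V s c) (at s)" if s: "s \<in> {0..1}" and c: "c \<in> {0..1}" for s c
    using core[OF c]
  proof
    assume const: "\<forall>s. Z s c = Z 0 c"
    then have "(\<lambda>s. Z s c) = (\<lambda>s. Z 0 c)" by auto
    then have "((\<lambda>s. Z s c) has_vector_derivative 0) (at s)" by simp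
    then have "V s c = 0" using vector_derivative_unique_at d[OF s c] by blast
    moreover have "(\<lambda>s. ?G (Z s c)) = (\<lambda>s. ?G (Z 0 c))"
      by (rule ext, rule arg_cong[where f = ?G], rule const[rule_format])
    ultimately show ?thesis by simp
  next
    assume "\<exists>k l. \<forall>s\<in>{0..1}. \<bar>Re (Z s c) - \<delta> * (of_int k + \<sigma>)\<bar> < \<delta> / 3 \<and>
                          \<bar>Im (Z s c) - \<delta> * (of_int l + \<tau>)\<bar> < \<delta> / 3"
    then obtain k l where kl: "\<bar>Re (Z s c) - \<delta> * (of_int k + \<sigma>)\<bar> < \<delta> / 3"
        "\<bar>Im (Z s c) - \<delta> * (of_int l + \<tau>)\<bar> < \<delta> / 3" using s by blast
    define U where "U = {z. \<bar>Re z - \<delta> * (of_int k + \<sigma>)\<bar> < \<delta> / 3 \<and> \<bar>Im z - \<delta> * (of_int l + \<tau>)\<bar> < \<delta> / 3}"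
    define q where "q = Complex ((1 - \<eta>) * (\<delta> * (of_int k + \<sigma>))) ((1 - \<eta>) * (\<delta> * (of_int l + \<tau>)))"
    have "open U" unfolding U_def
      by (intro open_Collect_conj open_Collect_less continuous_intros)
    have GU: "?G z = \<eta> *\<^sub>R z + q" if "z \<in> U" for z
      using that squeeze_core[OF \<open>0 < \<delta>\<close>] by (simp add: U_def q_def squeeze_plane_def complex_eq_iff)
    have "isCont (\<lambda>s. Z s c) s" using d[OF s c] has_vector_derivative_continuous by blast
    then have "\<forall>\<^sub>F r in at s. Z r c \<in> U"
      unfolding isCont_def using \<open>open U\<close> kl topological_tendstoD[of _ "Z s c" "at s" U]
      by (simp add: U_def)
    then have ev: "\<forall>\<^sub>F r in at s. \<eta> *\<^sub>R Z r c + q = ?G (Z r c)" by (rule eventually_mono) (use GU in simp)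
    have at: "\<eta> *\<^sub>R Z s c + q = ?G (Z s c)" using GU kl by (simp add: U_def)
    have "((\<lambda>s. \<eta> *\<^sub>R Z s c + q) has_vector_derivative \<eta> *\<^sub>R V s c) (at s)"
      using d[OF s c] by (auto intro!: derivative_eq_intros)
    then show ?thesis
      unfolding has_vector_derivative_def
      by (rule has_derivative_transform_eventually[OF _ ev at]) simp
  qed
  have "arc_move (2 * (\<eta> * B)) (\<lambda>c. ?G (Z 0 c)) (\<lambda>c. ?G (Z 1 c))"
  proof (rule arc_move_isotopy[where Z = "\<lambda>s c. ?G (Z s c)", OF Gd])
    show "continuous_on ({0..1} \<times> {0..1}) (\<lambda>(s,c). ?G (Z s c))"
      using continuous_on_compose2[OF cG cZ] by (simp add: split_def)
    show "continuous_on ({0..1} \<times> {0..1}) (\<lambda>(s,c). \<eta> *\<^sub>R V s c)"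
      using continuous_on_scaleR[OF continuous_on_const cV] by (simp add: split_def)
    fix s c e :: real assume s: "s \<in> {0..1}" and c: "c \<in> {0..1}"
    show "cmod (\<eta> *\<^sub>R V s c) \<le> \<eta> * B" using B[OF s c] \<eta> by simp
    assume e: "e \<in> {0..1}"
    have "cmod (\<eta> *\<^sub>R V s c - \<eta> *\<^sub>R V s e) = \<eta> * cmod (V s c - V s e)"
      using \<eta> by (simp add: scaleR_diff_right[symmetric])
    also have "\<dots> \<le> \<eta> * (\<bar>L\<bar> * cmod (Z s c - Z s e))"
      using \<eta> by (intro mult_left_mono order_trans[OF L[OF s c e]] mult_right_mono) auto
    also have "\<dots> = \<bar>L\<bar> * (\<eta> * cmod (Z s c - Z s e))" by simp
    also have "\<dots> \<le> \<bar>L\<bar> * cmod (?G (Z s c) - ?G (Z s e))"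
      using G(4)[where s = 1 and z = "Z s c" and w = "Z s e"] by (intro mult_left_mono) auto
    finally show "cmod (\<eta> *\<^sub>R V s c - \<eta> *\<^sub>R V s e) \<le> \<bar>L\<bar> * cmod (?G (Z s c) - ?G (Z s e))" .
  qed
  then have 2: "arc_move (4 * \<delta>) (\<lambda>c. ?G (Z 0 c)) (\<lambda>c. ?G (Z 1 c))"
    by (rule arc_move_mono) (use \<eta>B \<open>0 < \<delta>\<close> in linarith)
  have cs: "continuous_on {0..1} (Z s)" if "s \<in> {0..1}" for s
    using continuous_on_compose2[OF cZ, of "{0..1}" "Pair s"] that
    by (simp add: continuous_on_Pair continuous_on_id' image_subset_iff)
  have 1: "arc_move (4 * \<delta>) (Z s) (\<lambda>c. ?G (Z s c))" if "s \<in> {0..1}" for s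
    by (rule arc_move_squeeze[OF \<open>0 < \<delta>\<close> \<eta> cs[OF that]])
  have "arc_move (2 * (4 * \<delta>)) (\<lambda>c. ?G (Z 0 c)) (Z 1)"
    by (rule arc_move_trans[OF 2 arc_move_reverse[OF 1]]) simp
  moreover have "arc_move (2 * (4 * \<delta>)) (Z 0) (\<lambda>c. ?G (Z 0 c))"
    by (rule arc_move_mono[OF 1]) (use \<open>0 < \<delta>\<close> in auto)
  ultimately have "arc_move (2 * (2 * (4 * \<delta>))) (Z 0) (Z 1)" by (rule arc_move_trans[rotated])
  then show ?thesis by simp
qed

section \<open>Short images of vertical lines\<close>

text \<open>
  Compare areas.
\<close>

lemma sum_squares_disjoint_balls:
  fixes p :: "'i \<Rightarrow> complex"
  assumes "finite I" and r: "\<And>i. i \<in> I \<Longrightarrow> 0 \<le> r i"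
    and disj: "disjoint_family_on (\<lambda>i. ball (p i) (r i)) I"
    and sub: "\<And>i. i \<in> I \<Longrightarrow> ball (p i) (r i) \<subseteq> ball 0 M" and "0 \<le> M"
  shows "(\<Sum>i\<in>I. (r i)\<^sup>2) \<le> M\<^sup>2"
proof -
  define K where "K = unit_ball_vol (real DIM(complex))"
  have K: "K > 0" by (simp add: K_def)
  have vol: "measure lborel (ball c s) = K * s\<^sup>2" if "0 \<le> s" for c :: complex and s
    using content_ball[OF that, of c] by (simp add: K_def)
  have "(\<Sum>i\<in>I. K * (r i)\<^sup>2) = (\<Sum>i\<in>I. measure lborel (ball (p i) (r i)))"
    by (intro sum.cong refl) (simp add: vol r)
  also have "\<dots> = measure lborel (\<Union>i\<in>I. ball (p i) (r i))"
    by (rule measure_finite_Union[symmetric, OF \<open>finite I\<close> _ disj])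
       (auto simp: emeasure_ball r)
  also have "\<dots> \<le> measure lborel (ball (0::complex) M)"
    by (rule measure_mono_fmeasurable)
       (use sub \<open>finite I\<close> \<open>0 \<le> M\<close> in \<open>auto simp: fmeasurable_def emeasure_ball\<close>)
  also have "\<dots> = K * M\<^sup>2" by (rule vol[OF \<open>0 \<le> M\<close>])
  finally show ?thesis using K by (simp add: sum_distrib_left[symmetric])
qed

text \<open>
  A discrete form of the length-area method. Cut a rectangle of width \<open>N\<close> into squares of side \<open>h\<close>, so
  small that the derivative is nearly constant on each square. The image of the square
  with centre \<open>w\<close> contains a disc of radius \<open>h * cmod (deriv F w) / 4\<close>. These discs are disjoint in \<open>ball 0 M\<close>, which
  bounds the sum of \<open>(h * cmod (deriv F w))\<^sup>2\<close> over all squares by a constant times \<open>M\<^sup>2\<close>. By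
  Cauchy-Schwarz one of the \<open>N / h\<close> columns has an image of length at most a constant times \<open>M / sqrt N\<close>. The term
  \<open>e\<close> pays for the points that are not on the grid.
\<close>

lemma short_vertical_image_approx:
  fixes F :: "complex \<Rightarrow> complex"
  assumes hol: "F holomorphic_on {z. 0 < Im z \<and> Im z < pi}" and inj: "inj_on F {z. 0 < Im z \<and> Im z < pi}"
    and img: "F ` {z. 0 < Im z \<and> Im z < pi} \<subseteq> ball 0 M" and "0 < N" "0 < e" "e < 1"
  obtains u where "u0 \<le> u" "u \<le> u0 + N"
    "\<And>v v'. v \<in> {e..pi - e} \<Longrightarrow> v' \<in> {e..pi - e} \<Longrightarrow>
        cmod (F (Complex u v) - F (Complex u v')) \<le> 10 * M / sqrt N + e"
proof -
  define S where "S = {z. 0 < Im z \<and> Im z < pi}"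
  define R where "R = cbox (Complex (u0 - 1) (e/2)) (Complex (u0 + N + 1) (pi - e/2))"
  have "open S" unfolding S_def by (intro open_Collect_conj open_Collect_less continuous_intros)
  have pi3: "pi > 3" using pi_gt3 .
  have RS: "R \<subseteq> S" using \<open>0 < e\<close> by (auto simp: R_def S_def in_cbox_complex_iff)
  have holS: "F holomorphic_on S" and injS: "inj_on F S" and imgS: "F ` S \<subseteq> ball 0 M"
    using hol inj img by (simp_all add: S_def)
  have cD: "continuous_on R (deriv F)"
    using holomorphic_on_imp_continuous_on[OF holomorphic_deriv[OF holS \<open>open S\<close>]] RS continuous_on_subset by blast
  have "compact R" "convex R" by (simp_all add: R_def)
  have nz: "deriv F z \<noteq> 0" if "z \<in> R" for z
    using holomorphic_injective_imp_regular[OF holS \<open>open S\<close> injS] RS that by blast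
  have "Complex u0 1 \<in> R" using \<open>0 < N\<close> \<open>e < 1\<close> pi3 by (auto simp: R_def in_cbox_complex_iff)
  then have "R \<noteq> {}" and "F (Complex u0 1) \<in> ball 0 M" using imgS RS by blast+
  then have M0: "0 \<le> M" using order_trans[OF norm_ge_zero less_imp_le] by auto
  have cn: "continuous_on R (\<lambda>z. cmod (deriv F z))" by (intro continuous_intros cD)
  obtain z0 where z0: "z0 \<in> R" "\<And>z. z \<in> R \<Longrightarrow> cmod (deriv F z0) \<le> cmod (deriv F z)"
    using continuous_attains_inf[OF \<open>compact R\<close> \<open>R \<noteq> {}\<close> cn] by blast
  obtain z1 where z1: "z1 \<in> R" "\<And>z. z \<in> R \<Longrightarrow> cmod (deriv F z) \<le> cmod (deriv F z1)"
    using continuous_attains_sup[OF \<open>compact R\<close> \<open>R \<noteq> {}\<close> cn] by blast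
  define m where "m = cmod (deriv F z0)"
  define P where "P = cmod (deriv F z1)"
  have m: "m > 0" using nz z0 by (simp add: m_def)
  have mP: "m \<le> P" using z0 z1 by (simp add: m_def P_def)
  have "uniformly_continuous_on R (deriv F)" by (rule compact_uniformly_continuous[OF cD \<open>compact R\<close>])
  then obtain d0 where d0: "d0 > 0"
    "\<And>z w. z \<in> R \<Longrightarrow> w \<in> R \<Longrightarrow> dist z w < d0 \<Longrightarrow> dist (deriv F z) (deriv F w) < m / 4"
    using m unfolding uniformly_continuous_on_def by (metis divide_pos_pos zero_less_numeral)
  define b where "b = min (min (d0/2) (e/2)) (e / (4 * P))"
  have P: "P > 0" using m mP by simp
  have b: "b > 0" using d0 \<open>0 < e\<close> P by (simp add: b_def)
  obtain n :: nat where n: "n > 0" "N / b < n"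
    by (metis reals_Archimedean2 gr0I of_nat_0 divide_pos_pos b \<open>0 < N\<close> order_less_asym)
  define h where "h = N / n"
  have h: "h > 0" using n \<open>0 < N\<close> by (simp add: h_def)
  have "h < b" using n b by (simp add: h_def field_simps)
  then have hd: "h < d0 / 2" "h < e / 2" and hP: "P * h \<le> e / 4"
    using P by (auto simp: b_def field_simps)
  define q where "q = nat \<lfloor>(pi - 2 * e) / h\<rfloor> + 1"
  define w where "w = (\<lambda>j k::nat. Complex (u0 + real j * h) (e + real k * h))"
  have kb: "e + real k * h \<le> pi - e" if "k < q" for k
  proof -
    have "0 \<le> (pi - 2 * e) / h" using \<open>e < 1\<close> pi3 h by simp
    then have "real (nat \<lfloor>(pi - 2 * e) / h\<rfloor>) \<le> (pi - 2 * e) / h" by simp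
    moreover have "real k \<le> real (nat \<lfloor>(pi - 2 * e) / h\<rfloor>)" using that by (simp add: q_def)
    ultimately have "real k \<le> (pi - 2 * e) / h" by linarith
    then show ?thesis using h by (simp add: field_simps)
  qed
  have jb: "real j * h \<le> N" if "j \<le> n" for j
  proof -
    have "real j * h \<le> real n * h" using that h by (intro mult_right_mono) auto
    then show ?thesis using n by (simp add: h_def)
  qed
  have qh: "real q * h \<le> pi"
  proof -
    have "real (q - 1) * h \<le> pi - 2 * e" using kb[of "q - 1"] by (simp add: q_def)
    then show ?thesis using hd \<open>0 < e\<close> by (simp add: q_def algebra_simps)
  qed
  have ballR: "cball (w j k) h \<subseteq> R" if "j \<le> n" "k < q" for j k
  proof
    fix z assume "z \<in> cball (w j k) h"
    then have "cmod (z - w j k) \<le> h" by (simp add: dist_norm norm_minus_commute)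
    then have "\<bar>Re z - (u0 + real j * h)\<bar> \<le> h" "\<bar>Im z - (e + real k * h)\<bar> \<le> h"
      using abs_Re_le_cmod[of "z - w j k"] abs_Im_le_cmod[of "z - w j k"] by (auto simp: w_def)
    moreover have "0 \<le> real j * h" "0 \<le> real k * h" using h by auto
    ultimately have "u0 - 1 \<le> Re z" "Re z \<le> u0 + N + 1" "e/2 \<le> Im z" "Im z \<le> pi - e/2"
      using jb[OF that(1)] kb[OF that(2)] hd \<open>e < 1\<close> unfolding abs_le_iff by linarith+
    then show "z \<in> R" by (simp add: R_def in_cbox_complex_iff)
  qed
  have dF: "(F has_field_derivative deriv F z) (at z within T)" if "z \<in> R" for z T
    using holomorphic_derivI[OF holS \<open>open S\<close>] that RS by blast
  have lin: "cmod (F z - F (w j k) - deriv F (w j k) * (z - w j k)) \<le> m / 4 * cmod (z - w j k)"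
    if "j \<le> n" "k < q" "z \<in> cball (w j k) h" for j k z
  proof -
    let ?c = "w j k"
    have "cmod ((F z - deriv F ?c * z) - (F ?c - deriv F ?c * ?c)) \<le> m / 4 * cmod (z - ?c)"
    proof (rule field_differentiable_bound[where f' = "\<lambda>z. deriv F z - deriv F ?c" and S = "cball ?c h"])
      fix x assume x: "x \<in> cball ?c h"
      then have "x \<in> R" "?c \<in> R" using ballR[OF that(1,2)] h by auto
      then show "((\<lambda>z. F z - deriv F ?c * z) has_field_derivative deriv F x - deriv F ?c) (at x within cball ?c h)"
        by (auto intro!: derivative_eq_intros dF)
      have "dist x ?c < d0" using x hd h by (simp add: dist_commute)
      then show "cmod (deriv F x - deriv F ?c) \<le> m / 4"
        using d0(2)[OF \<open>x \<in> R\<close> \<open>?c \<in> R\<close>] by (simp add: dist_norm)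
    qed (use that h in auto)
    then show ?thesis by (simp add: algebra_simps)
  qed
  have cR: "w j k \<in> R" if "j \<le> n" "k < q" for j k using ballR[OF that] h by auto
  define a where "a = (\<lambda>j k. cmod (deriv F (w j k)))"
  have am: "m \<le> a j k" if "j \<le> n" "k < q" for j k using z0(2)[OF cR[OF that]] by (simp add: m_def a_def)
  have bigball: "ball (F (w j k)) (h * a j k / 4) \<subseteq> F ` ball (w j k) (h/2)" if jk: "j \<le> n" "k < q" for j k
  proof (rule ball_subset_open_map_image)
    have cb: "ball (w j k) (h/2) \<subseteq> S" using ballR[OF jk] RS h by (force simp: subset_iff)
    have "closure (ball (w j k) (h/2)) \<subseteq> S" using ballR[OF jk] RS h by (force simp: subset_iff closure_ball)
    then show "continuous_on (closure (ball (w j k) (h/2))) F"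
      using holomorphic_on_imp_continuous_on[OF holS] continuous_on_subset by blast
    show "open (F ` interior (ball (w j k) (h/2)))"
      using open_mapping_thm3[OF holomorphic_on_subset[OF holS cb]] inj_on_subset[OF injS cb] by simp
    fix z assume "z \<in> frontier (ball (w j k) (h/2))"
    then have z: "cmod (z - w j k) = h/2" using h by (simp add: frontier_ball dist_norm norm_minus_commute)
    then have "z \<in> cball (w j k) h" using h by (simp add: dist_norm norm_minus_commute)
    from lin[OF jk this]
    have "cmod (deriv F (w j k) * (z - w j k)) - cmod (F z - F (w j k)) \<le> m / 4 * cmod (z - w j k)"
      using norm_triangle_ineq2[of "deriv F (w j k) * (z - w j k)" "F z - F (w j k)"]
      by (simp add: norm_minus_commute)
    then have "a j k * (h/2) - m/4 * (h/2) \<le> cmod (F z - F (w j k))"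
      unfolding norm_mult z a_def by linarith
    moreover have "m/4 * (h/2) \<le> a j k / 4 * (h/2)" using am[OF jk] h by (intro mult_right_mono) auto
    moreover have "0 \<le> a j k * h" using h by (simp add: a_def)
    ultimately show "h * a j k / 4 \<le> cmod (F z - F (w j k))" by (simp add: field_simps)
  next
    show "0 < h * a j k / 4" using h am[OF jk] m by (intro divide_pos_pos mult_pos_pos) linarith+
  qed (use h in auto)
  let ?I = "{..<n} \<times> {..<q}"
  have "(\<Sum>i\<in>?I. (case i of (j,k) \<Rightarrow> h * a j k / 4)\<^sup>2) \<le> M\<^sup>2"
  proof (rule sum_squares_disjoint_balls[where p = "\<lambda>(j,k). F (w j k)"])
    show "0 \<le> (case i of (j,k) \<Rightarrow> h * a j k / 4)" for i using h by (auto simp: a_def split: prod.split)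
    show "ball (case i of (j,k) \<Rightarrow> F (w j k)) (case i of (j,k) \<Rightarrow> h * a j k / 4) \<subseteq> ball 0 M" if iI: "i \<in> ?I" for i
    proof -
      obtain j k where i: "i = (j,k)" "j < n" "k < q" using iI by auto
      have "F ` ball (w j k) (h/2) \<subseteq> F ` S" using ballR[of j k] RS i h by (intro image_mono) (force simp: subset_iff)
      then show ?thesis using bigball[of j k] i imgS by force
    qed
    show "0 \<le> M" by (rule M0)
    show "disjoint_family_on (\<lambda>i. ball (case i of (j,k) \<Rightarrow> F (w j k)) (case i of (j,k) \<Rightarrow> h * a j k / 4)) ?I"
      unfolding disjoint_family_on_def
    proof (intro ballI impI)
      fix i i' assume "i \<in> ?I" "i' \<in> ?I" "i \<noteq> i'"
      then obtain j k j' k' where i: "i = (j,k)" "j < n" "k < q" and i': "i' = (j',k')" "j' < n" "k' < q"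
        and ne: "j \<noteq> j' \<or> k \<noteq> k'" by auto
      have "ball (w j k) (h/2) \<inter> ball (w j' k') (h/2) = {}"
      proof (rule ccontr)
        assume "\<not> ?thesis"
        then obtain z where "dist (w j k) z < h/2" "dist (w j' k') z < h/2" by auto
        then have "dist (w j k) (w j' k') < h" using dist_triangle_half_l by blast
        then have "\<bar>Re (w j k - w j' k')\<bar> < h" "\<bar>Im (w j k - w j' k')\<bar> < h"
          using abs_Re_le_cmod[of "w j k - w j' k'"] abs_Im_le_cmod[of "w j k - w j' k'"] by (auto simp: dist_norm)
        then have "\<bar>real j - real j'\<bar> * h < 1 * h" "\<bar>real k - real k'\<bar> * h < 1 * h"
          using h by (simp_all add: w_def left_diff_distrib[symmetric] abs_mult)
        then have "\<bar>real j - real j'\<bar> < 1" "\<bar>real k - real k'\<bar> < 1" using h by (simp_all only: mult_less_cancel_right_pos)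
        then show False using ne by linarith
      qed
      moreover have "ball (w j k) (h/2) \<subseteq> S" "ball (w j' k') (h/2) \<subseteq> S"
        using ballR[of j k] ballR[of j' k'] i i' RS h by (force simp: subset_iff)+
      ultimately have "F ` ball (w j k) (h/2) \<inter> F ` ball (w j' k') (h/2) = {}"
        using inj_on_image_Int[OF injS] by (metis image_empty)
      then show "ball (case i of (j,k) \<Rightarrow> F (w j k)) (case i of (j,k) \<Rightarrow> h * a j k / 4) \<inter>
         ball (case i' of (j,k) \<Rightarrow> F (w j k)) (case i' of (j,k) \<Rightarrow> h * a j k / 4) = {}"
        using bigball[of j k] bigball[of j' k'] i i' by fastforce
    qed
  qed auto
  then have "(\<Sum>j<n. \<Sum>k<q. (h * a j k / 4)\<^sup>2) \<le> M\<^sup>2"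
    by (simp add: sum.cartesian_product split_def)
  then have area: "(\<Sum>j<n. \<Sum>k<q. (h * a j k)\<^sup>2) \<le> 16 * M\<^sup>2"
    by (simp add: power_divide sum_divide_distrib[symmetric])
  define D where "D = (\<lambda>j. \<Sum>k<q. h * a j k)"
  have D2: "(D j)\<^sup>2 \<le> real q * (\<Sum>k<q. (h * a j k)\<^sup>2)" for j
    using Cauchy_Schwarz_ineq_sum[of "\<lambda>_. 1" "\<lambda>k. h * a j k" "{..<q}"] by (simp add: D_def)
  have "\<exists>j<n. (D j)\<^sup>2 \<le> 16 * pi * M\<^sup>2 / N"
  proof (rule ccontr)
    assume "\<not> ?thesis"
    then have *: "\<And>j. j < n \<Longrightarrow> 16 * pi * M\<^sup>2 / N < (D j)\<^sup>2" by force
    have "real n * (16 * pi * M\<^sup>2 / N) = (\<Sum>j<n. 16 * pi * M\<^sup>2 / N)" by simp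
    also have "\<dots> < (\<Sum>j<n. (D j)\<^sup>2)" using n * by (intro sum_strict_mono) auto
    also have "\<dots> \<le> (\<Sum>j<n. real q * (\<Sum>k<q. (h * a j k)\<^sup>2))" by (intro sum_mono D2)
    also have "\<dots> \<le> real q * (16 * M\<^sup>2)"
      using area by (simp add: sum_distrib_left[symmetric] mult_left_mono)
    finally have "real n * (16 * pi * M\<^sup>2 / N) * h < real q * (16 * M\<^sup>2) * h" using h by (intro mult_strict_right_mono)
    moreover have "real n * (16 * pi * M\<^sup>2 / N) * h = pi * (16 * M\<^sup>2)" using n \<open>0 < N\<close> by (simp add: h_def)
    moreover have "real q * (16 * M\<^sup>2) * h \<le> pi * (16 * M\<^sup>2)"
      using mult_right_mono[OF qh, of "16 * M\<^sup>2"] by (simp add: mult_ac)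
    ultimately show False by linarith
  qed
  then obtain j where j: "j < n" "(D j)\<^sup>2 \<le> 16 * pi * M\<^sup>2 / N" by blast
  have "(D j)\<^sup>2 \<le> 16 * 4 * M\<^sup>2 / N"
    using j(2) pi_less_4 \<open>0 < N\<close> by (elim order_trans) (intro divide_right_mono mult_right_mono, auto)
  also have "\<dots> = (8 * M / sqrt N)\<^sup>2" using \<open>0 < N\<close> by (simp add: power_divide power_mult_distrib)
  finally have D8: "D j \<le> 8 * M / sqrt N"
    by (rule power2_le_imp_le) (use M0 \<open>0 < N\<close> in \<open>simp add: divide_nonneg_nonneg\<close>)
  have vertical: "cmod (F (Complex (u0 + real j * h) v) - F (w j k)) \<le> 5/4 * (h * a j k)"
    if "k < q" "e + real k * h \<le> v" "v \<le> e + real (Suc k) * h" for k v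
  proof -
    let ?z = "Complex (u0 + real j * h) v"
    have nz: "cmod (?z - w j k) = v - (e + real k * h)"
      using that by (simp add: w_def complex_diff complex_norm)
    then have z: "cmod (?z - w j k) \<le> h" using that by (simp add: algebra_simps)
    then have "?z \<in> cball (w j k) h" by (simp add: dist_norm norm_minus_commute)
    from lin[OF _ that(1) this] j
    have "cmod (F ?z - F (w j k)) \<le> cmod (deriv F (w j k) * (?z - w j k)) + m/4 * cmod (?z - w j k)"
      using norm_triangle_sub[of "F ?z - F (w j k)" "deriv F (w j k) * (?z - w j k)"] by simp
    also have "\<dots> \<le> a j k * h + a j k / 4 * h"
      unfolding norm_mult a_def[symmetric] using z am[of j k] j that m h
      by (intro add_mono mult_mono) (auto simp: a_def)
    finally show ?thesis by (simp add: algebra_simps)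
  qed
  have tele: "cmod (F (w j k') - F (w j k)) \<le> (\<Sum>i=k..<k'. 5/4 * (h * a j i))" if "k \<le> k'" "k' < q" for k k'
    using that
  proof (induction k' rule: dec_induct)
    case (step i)
    have "cmod (F (w j (Suc i)) - F (w j i)) \<le> 5/4 * (h * a j i)"
      using vertical[of i "e + real (Suc i) * h"] step.prems h
      by (simp add: w_def algebra_simps)
    then show ?case using step norm_triangle_sub[of "F (w j (Suc i)) - F (w j k)" "F (w j i) - F (w j k)"] by simp
  qed simp
  have tele': "cmod (F (w j k') - F (w j k)) \<le> 5/4 * D j" if "k < q" "k' < q" for k k'
  proof -
    have "(\<Sum>i=k..<k'. 5/4 * (h * a j i)) \<le> (\<Sum>i<q. 5/4 * (h * a j i))" if "k' < q" for k k'
      using that h by (intro sum_mono2) (auto simp: a_def)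
    then have DD: "(\<Sum>i=k..<k'. 5/4 * (h * a j i)) \<le> 5/4 * D j" if "k' < q" for k k'
      using that by (simp add: D_def sum_distrib_left)
    show ?thesis
    proof (cases "k \<le> k'")
      case True
      show ?thesis by (rule order_trans[OF tele[OF True that(2)] DD[OF that(2)]])
    next
      case False
      then have "cmod (F (w j k) - F (w j k')) \<le> 5/4 * D j"
        by (intro order_trans[OF tele[OF _ that(1)] DD[OF that(1)]]) simp
      then show ?thesis by (simp add: norm_minus_commute)
    qed
  qed
  have near: "\<exists>k<q. cmod (F (Complex (u0 + real j * h) v) - F (w j k)) \<le> e/2" if v: "v \<in> {e..pi - e}" for v
  proof -
    define k where "k = nat \<lfloor>(v - e) / h\<rfloor>"
    have nn: "0 \<le> (v - e) / h" using v h by simp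
    have k1: "real k \<le> (v - e) / h" and k2: "(v - e) / h \<le> real (Suc k)" using nn unfolding k_def by linarith+
    have "(v - e) / h \<le> (pi - 2 * e) / h" using v h by (intro divide_right_mono) auto
    then have "\<lfloor>(v - e) / h\<rfloor> \<le> \<lfloor>(pi - 2 * e) / h\<rfloor>" by (rule floor_mono)
    then have kq: "k < q" unfolding k_def q_def by linarith
    have "e + real k * h \<le> v" using k1 h by (simp add: field_simps)
    moreover have "v \<le> e + real (Suc k) * h" using k2 h by (simp add: field_simps)
    ultimately have "cmod (F (Complex (u0 + real j * h) v) - F (w j k)) \<le> 5/4 * (h * a j k)" by (rule vertical[OF kq])
    also have "h * a j k \<le> P * h"
      using z1(2)[OF cR[of j k]] j kq h by (simp add: P_def a_def mult.commute)
    finally show ?thesis using kq hP \<open>0 < e\<close> by (intro exI[of _ k]) auto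
  qed
  show ?thesis
  proof (rule that[of "u0 + real j * h"])
    show "u0 \<le> u0 + real j * h" "u0 + real j * h \<le> u0 + N" using h jb[of j] j by auto
    fix v v' assume v: "v \<in> {e..pi - e}" "v' \<in> {e..pi - e}"
    let ?A = "F (Complex (u0 + real j * h) v)" and ?B = "F (Complex (u0 + real j * h) v')"
    obtain k where k: "k < q" "cmod (?A - F (w j k)) \<le> e/2" using near[OF v(1)] by blast
    obtain k' where k': "k' < q" "cmod (?B - F (w j k')) \<le> e/2" using near[OF v(2)] by blast
    have "?A - ?B = (?A - F (w j k)) + (F (w j k) - F (w j k')) - (?B - F (w j k'))" by simp
    also have "cmod \<dots> \<le> cmod (?A - F (w j k)) + cmod (F (w j k) - F (w j k')) + cmod (?B - F (w j k'))"
      by (rule order_trans[OF norm_triangle_ineq4 add_right_mono[OF norm_triangle_ineq]])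
    finally show "cmod (?A - ?B) \<le> 10 * M / sqrt N + e"
      using k k' tele'[OF k'(1) k(1)] D8 by simp
  qed
qed

text \<open>
  The compact interval of abscissas contains a limit of those belonging to \<open>e = 1 / (n + 2)\<close>; continuity
  gives the estimate along the whole open line.
\<close>

lemma short_vertical_image:
  fixes F :: "complex \<Rightarrow> complex"
  assumes hol: "F holomorphic_on {z. 0 < Im z \<and> Im z < pi}" and inj: "inj_on F {z. 0 < Im z \<and> Im z < pi}"
    and img: "F ` {z. 0 < Im z \<and> Im z < pi} \<subseteq> ball 0 M" and "0 < N"
  obtains u where "u0 \<le> u" "u \<le> u0 + N"
    "\<And>v v'. 0 < v \<Longrightarrow> v < pi \<Longrightarrow> 0 < v' \<Longrightarrow> v' < pi \<Longrightarrow>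
        cmod (F (Complex u v) - F (Complex u v')) \<le> 10 * M / sqrt N"
proof -
  define e where "e = (\<lambda>n::nat. 1 / (real n + 2))"
  have "\<exists>u. u0 \<le> u \<and> u \<le> u0 + N \<and> (\<forall>v\<in>{e n..pi - e n}. \<forall>v'\<in>{e n..pi - e n}.
        cmod (F (Complex u v) - F (Complex u v')) \<le> 10 * M / sqrt N + e n)" for n
  proof -
    have e1: "0 < e n" "e n < 1" by (simp_all add: e_def)
    obtain u where "u0 \<le> u" "u \<le> u0 + N" "\<And>v v'. v \<in> {e n..pi - e n} \<Longrightarrow> v' \<in> {e n..pi - e n} \<Longrightarrow>
        cmod (F (Complex u v) - F (Complex u v')) \<le> 10 * M / sqrt N + e n"
      by (rule short_vertical_image_approx[OF hol inj img \<open>0 < N\<close> e1]) blast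
    then show ?thesis by blast
  qed
  then obtain U where U: "\<And>n. u0 \<le> U n \<and> U n \<le> u0 + N"
    "\<And>n v v'. v \<in> {e n..pi - e n} \<Longrightarrow> v' \<in> {e n..pi - e n} \<Longrightarrow>
        cmod (F (Complex (U n) v) - F (Complex (U n) v')) \<le> 10 * M / sqrt N + e n"
    by metis
  have "compact {u0..u0 + N}" by simp
  moreover have "\<forall>n. U n \<in> {u0..u0 + N}" using U(1) by auto
  ultimately obtain u r where u: "u \<in> {u0..u0 + N}" and r: "strict_mono r" and lim: "(U \<circ> r) \<longlonglongrightarrow> u"
    unfolding compact_def by metis
  have e0: "e \<longlonglongrightarrow> 0" unfolding e_def
    by (rule real_tendsto_divide_at_top[OF tendsto_const])
       (intro filterlim_tendsto_add_at_top[OF tendsto_const, of _ _ 2, simplified add.commute] filterlim_real_sequentially)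
  have er: "(\<lambda>n. e (r n)) \<longlonglongrightarrow> 0" using LIMSEQ_subseq_LIMSEQ[OF e0 r] by (simp add: o_def)
  have "open {z. 0 < Im z \<and> Im z < pi}" by (intro open_Collect_conj open_Collect_less continuous_intros)
  then have cont: "isCont F z" if "0 < Im z" "Im z < pi" for z
    using holomorphic_on_imp_continuous_on[OF hol] that by (simp add: continuous_on_eq_continuous_at)
  show ?thesis
  proof (rule that[of u])
    show "u0 \<le> u" "u \<le> u0 + N" using u by auto
    fix v v' assume v: "0 < v" "v < pi" "0 < v'" "v' < pi"
    have lF: "(\<lambda>n. F (Complex (U (r n)) v)) \<longlonglongrightarrow> F (Complex u v)" if "0 < v" "v < pi" for v
    proof (rule isCont_tendsto_compose[OF cont])
      show "(\<lambda>n. Complex (U (r n)) v) \<longlonglongrightarrow> Complex u v"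
        using lim by (intro tendsto_Complex tendsto_const) (simp add: o_def)
    qed (use that in auto)
    define m where "m = min (min v v') (min (pi - v) (pi - v'))"
    have "m > 0" using v by (simp add: m_def)
    then have "\<forall>\<^sub>F n in sequentially. e (r n) < m" using er by (simp add: order_tendstoD)
    then have ev: "\<forall>\<^sub>F n in sequentially. cmod (F (Complex (U (r n)) v) - F (Complex (U (r n)) v'))
        \<le> 10 * M / sqrt N + e (r n)"
      by (rule eventually_mono) (intro U(2), auto simp: m_def)
    have "cmod (F (Complex u v) - F (Complex u v')) \<le> 10 * M / sqrt N + 0"
    proof (rule tendsto_le[OF _ _ _ ev])
      show "(\<lambda>n. 10 * M / sqrt N + e (r n)) \<longlonglongrightarrow> 10 * M / sqrt N + 0" by (intro tendsto_intros er)
      show "(\<lambda>n. cmod (F (Complex (U (r n)) v) - F (Complex (U (r n)) v'))) \<longlonglongrightarrow>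
          cmod (F (Complex u v) - F (Complex u v'))"
        using v by (intro tendsto_intros lF)
    qed simp
    then show "cmod (F (Complex u v) - F (Complex u v')) \<le> 10 * M / sqrt N" by simp
  qed
qed

section \<open>Boundary behaviour of conformal maps\<close>

text \<open>
  Cover \<open>J\<close> by relatively open sets that lie in small connected sets, and take a Lebesgue number of
  the cover. Taking closures makes the connected sets closed.
\<close>

lemma small_subsets_in_small_continua:
  fixes J :: "'a::heine_borel set"
  assumes "compact J" "locally connected J" "0 < \<epsilon>"
  obtains \<delta> where "0 < \<delta>"
    "\<And>X. X \<subseteq> J \<Longrightarrow> diameter X < \<delta> \<Longrightarrow>
       \<exists>T. closed T \<and> connected T \<and> X \<subseteq> T \<and> T \<subseteq> J \<and> (\<forall>a\<in>T. T \<subseteq> cball a \<epsilon>)"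
proof -
  have lc: "\<exists>u v. openin (top_of_set J) u \<and> connected v \<and> x \<in> u \<and> u \<subseteq> v \<and> v \<subseteq> J \<inter> ball x (\<epsilon>/2)"
    if "x \<in> J" for x
    using assms(2,3) that unfolding locally_def
    by (meson IntI centre_in_ball half_gt_zero open_ball openin_open_Int)
  have "\<exists>O' v. open O' \<and> connected v \<and> x \<in> O' \<and> J \<inter> O' \<subseteq> v \<and> v \<subseteq> J \<inter> ball x (\<epsilon>/2)"
    if x: "x \<in> J" for x
  proof -
    obtain u v where uv: "openin (top_of_set J) u" "connected v" "x \<in> u" "u \<subseteq> v" "v \<subseteq> J \<inter> ball x (\<epsilon>/2)"
      using lc[OF x] by blast
    then obtain O' where "open O'" "u = J \<inter> O'" unfolding openin_open by blast
    then show ?thesis using uv by (intro exI[of _ O'] exI[of _ v]) simp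
  qed
  then obtain O' V where OV: "\<And>x. x \<in> J \<Longrightarrow> open (O' x) \<and> connected (V x) \<and> x \<in> O' x \<and> J \<inter> O' x \<subseteq> V x \<and> V x \<subseteq> J \<inter> ball x (\<epsilon>/2)"
    by metis
  show ?thesis
  proof (cases "J = {}")
    case True
    show ?thesis by (rule that[of 1]) (use True in \<open>auto intro!: exI[of _ "{}"]\<close>)
  next
    case False
    obtain \<delta> where \<delta>: "0 < \<delta>" "\<And>T. T \<subseteq> J \<Longrightarrow> diameter T < \<delta> \<Longrightarrow> \<exists>B\<in>O' ` J. T \<subseteq> B"
    proof (rule Lebesgue_number_lemma[OF \<open>compact J\<close>, of "O' ` J"])
      show "J \<subseteq> \<Union>(O' ` J)" using OV by blast
      show "\<And>B. B \<in> O' ` J \<Longrightarrow> open B" using OV by blast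
    qed (use False in auto)
    show ?thesis
    proof (rule that[OF \<delta>(1)])
      fix X assume X: "X \<subseteq> J" "diameter X < \<delta>"
      then obtain x where x: "x \<in> J" "X \<subseteq> O' x" using \<delta>(2) by blast
      have sub: "closure (V x) \<subseteq> cball x (\<epsilon>/2)"
        using OV[OF x(1)] by (intro closure_minimal) (auto simp: less_imp_le subset_iff)
      have "closure (V x) \<subseteq> J"
        using OV[OF x(1)] compact_imp_closed[OF \<open>compact J\<close>] by (intro closure_minimal) auto
      moreover have "closure (V x) \<subseteq> cball a \<epsilon>" if "a \<in> closure (V x)" for a
      proof
        fix b assume "b \<in> closure (V x)"
        then have "dist x b \<le> \<epsilon>/2" "dist x a \<le> \<epsilon>/2" using sub that by auto
        then show "b \<in> cball a \<epsilon>" using dist_triangle2[of a b x] by (simp add: dist_commute)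
      qed
      moreover have "X \<subseteq> closure (V x)" using X x OV[OF x(1)] closure_subset[of "V x"] by blast
      ultimately show "\<exists>T. closed T \<and> connected T \<and> X \<subseteq> T \<and> T \<subseteq> J \<and> (\<forall>a\<in>T. T \<subseteq> cball a \<epsilon>)"
        using OV[OF x(1)] by (intro exI[of _ "closure (V x)"]) (auto intro: connected_imp_connected_closure)
    qed
  qed
qed

text \<open>
  The conformal map from the upper half plane onto the unit disc that sends 0 to 1; it turns the
  half circles about 0 into the circular arcs that cut off small neighbourhoods of 1.
\<close>

definition cayley :: "complex \<Rightarrow> complex" where
  "cayley z = (\<i> - z) / (\<i> + z)"

definition inv_cayley :: "complex \<Rightarrow> complex" where
  "inv_cayley m = \<i> * (1 - m) / (1 + m)"

lemma inv_cayley_cayley: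
  assumes "0 \<le> Im z" shows "inv_cayley (cayley z) = z"
proof -
  have ne: "\<i> + z \<noteq> 0" using assms by (auto simp: complex_eq_iff)
  have "1 - cayley z = 2 * z / (\<i> + z)" "1 + cayley z = 2 * \<i> / (\<i> + z)"
    using ne by (simp_all add: cayley_def field_simps)
  then show ?thesis using ne by (simp add: inv_cayley_def)
qed

lemma cayley_inv_cayley:
  assumes "m \<noteq> - 1" shows "cayley (inv_cayley m) = m"
proof -
  have ne: "1 + m \<noteq> 0" using assms by (metis add.commute add_eq_0_iff)
  have "\<i> - inv_cayley m = 2 * \<i> * m / (1 + m)" "\<i> + inv_cayley m = 2 * \<i> / (1 + m)"
    using ne by (simp_all add: inv_cayley_def field_simps)
  then show ?thesis using ne by (simp add: cayley_def)
qed

lemma norm_cayley: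
  "0 < Im z \<Longrightarrow> cmod (cayley z) < 1" "Im z = 0 \<Longrightarrow> cmod (cayley z) = 1"
proof -
  have 1: "(cmod (\<i> - z))\<^sup>2 = (Re z)\<^sup>2 + (1 - Im z)\<^sup>2" "(cmod (\<i> + z))\<^sup>2 = (Re z)\<^sup>2 + (1 + Im z)\<^sup>2"
    by (simp_all add: cmod_power2)
  show "cmod (cayley z) < 1" if "0 < Im z"
  proof -
    have "(cmod (\<i> - z))\<^sup>2 < (cmod (\<i> + z))\<^sup>2" unfolding 1 using that by (simp add: power2_eq_square algebra_simps)
    then have "cmod (\<i> - z) < cmod (\<i> + z)" by (rule power2_less_imp_less) simp
    then show ?thesis by (simp add: cayley_def norm_divide divide_less_eq)
  qed
  show "cmod (cayley z) = 1" if "Im z = 0"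
  proof -
    have "(cmod (\<i> - z))\<^sup>2 = (cmod (\<i> + z))\<^sup>2" unfolding 1 using that by simp
    then have "cmod (\<i> - z) = cmod (\<i> + z)" by simp
    moreover have "\<i> + z \<noteq> 0" using that by (auto simp: complex_eq_iff)
    ultimately show ?thesis by (simp add: cayley_def norm_divide)
  qed
qed

lemma Im_inv_cayley:
  assumes "cmod m < 1" shows "0 < Im (inv_cayley m)"
proof -
  have ne: "1 + m \<noteq> 0" using assms by (metis add_eq_0_iff norm_minus_cancel norm_one order_less_irrefl)
  have "inv_cayley m = \<i> * ((1 - m) * cnj (1 + m)) / of_real ((cmod (1 + m))\<^sup>2)"
  proof -
    have "cnj (1 + m) \<noteq> 0" using ne by (metis complex_cnj_zero_iff)
    then have "\<i> * (1 - m) / (1 + m) = \<i> * (1 - m) * cnj (1 + m) / ((1 + m) * cnj (1 + m))"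
      by (rule nonzero_mult_divide_mult_cancel_right[symmetric])
    then show ?thesis
      unfolding inv_cayley_def complex_norm_square mult.assoc[of \<i>] .
  qed
  then have "Im (inv_cayley m) = Re ((1 - m) * cnj (1 + m)) / (cmod (1 + m))\<^sup>2" by simp
  moreover have "Re ((1 - m) * cnj (1 + m)) = 1 - (cmod m)\<^sup>2"
    unfolding cmod_power2 by (simp add: power2_eq_square algebra_simps)
  moreover have "0 < 1 - (cmod m)\<^sup>2" using assms by (simp add: abs_square_less_1)
  ultimately show ?thesis using ne by simp
qed

lemma continuous_on_inv_cayley: "continuous_on (ball 0 1) inv_cayley"
proof -
  have "1 + m \<noteq> 0" if "cmod m < 1" for m :: complex
    using that by (metis add_eq_0_iff norm_minus_cancel norm_one order_less_irrefl)
  then show ?thesis unfolding inv_cayley_def by (intro continuous_intros) auto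
qed

text \<open>
  Fix a boundary point \<open>\<zeta>\<close> of the disc. In logarithmic coordinates the crosscuts around
  \<open>\<zeta>\<close> are vertical lines, so \<open>short_vertical_image\<close> gives a crosscut whose image \<open>\<gamma>\<close> is small, at
  a distance from \<open>\<zeta>\<close> that is bounded below independently of \<open>\<zeta>\<close>. The closure of \<open>\<gamma>\<close>
  meets the frontier \<open>J\<close> of \<open>G\<close> in a small set, which lies in a small continuum \<open>T\<close> inside \<open>J\<close>.
  Suppose that some \<open>z\<close> cut off by the crosscut has an image far from \<open>\<gamma>\<close>. The points \<open>\<phi> z\<close> and \<open>\<phi> 0\<close> are
  not separated by \<open>J\<close>, since both are in \<open>G\<close>, and not by the union of \<open>T\<close> and the closure of \<open>\<gamma>\<close>,
  since this lies in a small disc away from both. These two sets meet in the connected set \<open>T\<close>, so by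
  Janiszewski's theorem their union does not separate the points either. Pulled back to the disc,
  this contradicts that the crosscut separates \<open>z\<close> from 0. So everything that is cut off has its image near
  \<open>\<gamma>\<close>.
\<close>

theorem conformal_map_uniformly_close_near_boundary:
  fixes \<phi> \<psi> :: "complex \<Rightarrow> complex"
  assumes "open G" "bounded G" and lc: "locally connected (frontier G)"
    and hol: "\<phi> holomorphic_on ball 0 1"
    and \<phi>: "\<And>z. z \<in> ball 0 1 \<Longrightarrow> \<phi> z \<in> G \<and> \<psi> (\<phi> z) = z"
    and c\<psi>: "continuous_on G \<psi>"
    and \<psi>: "\<And>w. w \<in> G \<Longrightarrow> \<psi> w \<in> ball 0 1 \<and> \<phi> (\<psi> w) = w"
    and "0 < \<epsilon>"
  obtains d where "0 < d"
    "\<And>\<zeta> z z'. cmod \<zeta> = 1 \<Longrightarrow> z \<in> ball 0 1 \<inter> ball \<zeta> d \<Longrightarrow> z' \<in> ball 0 1 \<inter> ball \<zeta> d \<Longrightarrow>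
       cmod (\<phi> z - \<phi> z') \<le> \<epsilon>"
proof -
  define J where "J = frontier G"
  define S where "S = {z. 0 < Im z \<and> Im z < pi}"
  have cJ: "compact J" unfolding J_def by (rule compact_frontier_bounded[OF \<open>bounded G\<close>])
  have GJ: "G \<inter> J = {}" unfolding J_def using frontier_disjoint_eq[of G] \<open>open G\<close> by (simp add: Int_commute)
  have \<phi>G: "\<phi> ` ball 0 1 = G"
  proof
    show "\<phi> ` ball 0 1 \<subseteq> G" using \<phi> by blast
    show "G \<subseteq> \<phi> ` ball 0 1" using \<psi> by (metis image_eqI subsetI)
  qed
  have "connected G"
    using connected_continuous_image[OF holomorphic_on_imp_continuous_on[OF hol]] \<phi>G by auto
  have w0: "\<phi> 0 \<in> G" using \<phi>[of 0] by simp
  obtain d0 where d0: "0 < d0" "ball (\<phi> 0) d0 \<subseteq> G" using \<open>open G\<close> w0 by (meson openE)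
  obtain M where M: "G \<subseteq> ball 0 M" using \<open>bounded G\<close> bounded_subset_ballD by blast
  have "0 < M" using M w0 by (metis mem_ball_0 norm_ge_zero order_le_less_trans subsetD)
  define \<epsilon>' where "\<epsilon>' = min (\<epsilon>/2) (d0/2)"
  have \<epsilon>': "0 < \<epsilon>'" "\<epsilon>' \<le> \<epsilon>/2" "\<epsilon>' < d0" using \<open>0 < \<epsilon>\<close> d0 by (auto simp: \<epsilon>'_def)
  obtain \<delta> where \<delta>: "0 < \<delta>" "\<And>X. X \<subseteq> J \<Longrightarrow> diameter X < \<delta> \<Longrightarrow>
       \<exists>T. closed T \<and> connected T \<and> X \<subseteq> T \<and> T \<subseteq> J \<and> (\<forall>a\<in>T. T \<subseteq> cball a \<epsilon>')"
    using small_subsets_in_small_continua[OF cJ _ \<epsilon>'(1)] lc unfolding J_def by metis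
  define \<delta>' where "\<delta>' = min (\<delta>/2) \<epsilon>'"
  have \<delta>': "0 < \<delta>'" "\<delta>' < \<delta>" "\<delta>' \<le> \<epsilon>'" using \<delta>(1) \<epsilon>' by (auto simp: \<delta>'_def)
  \<comment> \<open>chosen so that \<open>10 * M / sqrt N\<close>, the bound of \<open>short_vertical_image\<close>, equals \<open>\<delta>'\<close>\<close>
  define N where "N = (10 * M / \<delta>')\<^sup>2"
  have "0 < N" using \<open>0 < M\<close> \<delta>' by (simp add: N_def)
  have MN: "10 * M / sqrt N = \<delta>'" using \<open>0 < M\<close> \<delta>' by (simp add: N_def)
  define d where "d = exp (- N - 1)"
  have "0 < d" "d < 1" using \<open>0 < N\<close> by (auto simp: d_def)
  have inj\<phi>: "inj_on \<phi> (ball 0 1)" using \<phi> by (metis inj_on_inverseI)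
  have near: "\<exists>a. \<forall>z\<in>ball 0 1 \<inter> ball \<zeta> d. cmod (\<phi> z - a) \<le> \<epsilon>'" if \<zeta>: "cmod \<zeta> = 1" for \<zeta>
  proof -
    have \<zeta>0: "\<zeta> \<noteq> 0" using \<zeta> by auto
    define E where "E = (\<lambda>w. \<zeta> * cayley (exp w))"
    define F where "F = (\<lambda>w. \<phi> (E w))"
    have ImE: "0 < Im (exp w)" if "w \<in> S" for w
      using that sin_gt_zero[of "Im w"] by (auto simp: S_def Im_exp)
    have E1: "E w \<in> ball 0 1" if "w \<in> S" for w
      using norm_cayley(1)[OF ImE[OF that]] \<zeta> by (simp add: E_def norm_mult)
    have inv: "Ln (inv_cayley (E w / \<zeta>)) = w" if "w \<in> S" for w
    proof -
      have "inv_cayley (E w / \<zeta>) = exp w"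
        using inv_cayley_cayley[of "exp w"] ImE[OF that] \<zeta>0 by (simp add: E_def)
      then show ?thesis using that by (simp add: S_def)
    qed
    have "inj_on E S" by (rule inj_on_inverseI[where g = "\<lambda>x. Ln (inv_cayley (x / \<zeta>))"]) (rule inv)
    moreover have "E holomorphic_on S"
    proof -
      have "\<i> + exp w \<noteq> 0" if "w \<in> S" for w using ImE[OF that] by (auto simp: complex_eq_iff)
      then show ?thesis unfolding E_def cayley_def by (intro holomorphic_intros) auto
    qed
    moreover have ES: "E ` S \<subseteq> ball 0 1" using E1 by blast
    ultimately have holF: "F holomorphic_on S" and injF: "inj_on F S"
      using holomorphic_on_compose_gen[OF _ hol ES] comp_inj_on[OF _ inj_on_subset[OF inj\<phi> ES]]
      by (auto simp: F_def o_def)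
    have FS: "F ` S \<subseteq> G" using E1 \<phi> by (auto simp: F_def)
    then have FM: "F ` S \<subseteq> ball 0 M" using M by blast
    obtain u where u: "- N - 1 \<le> u" "u \<le> - N - 1 + N"
      and small: "\<And>v v'. 0 < v \<Longrightarrow> v < pi \<Longrightarrow> 0 < v' \<Longrightarrow> v' < pi \<Longrightarrow>
        cmod (F (Complex u v) - F (Complex u v')) \<le> \<delta>'"
      using short_vertical_image[OF holF[unfolded S_def] injF[unfolded S_def] FM[unfolded S_def] \<open>0 < N\<close>,
          of "- N - 1", unfolded MN] by blast
    define \<gamma> where "\<gamma> = (\<lambda>v. F (Complex u v)) ` {0<..<pi}"
    have \<gamma>G: "\<gamma> \<subseteq> G" using FS by (auto simp: \<gamma>_def S_def)
    have clos: "dist a b \<le> \<delta>'" if "a \<in> closure \<gamma>" "b \<in> closure \<gamma>" for a b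
    proof -
      have "\<gamma> \<subseteq> cball b \<delta>'" if "b \<in> \<gamma>" for b
        using that small by (auto simp: \<gamma>_def dist_norm)
      then have 1: "closure \<gamma> \<subseteq> cball b \<delta>'" if "b \<in> \<gamma>" for b
        using that by (intro closure_minimal) auto
      then have "\<gamma> \<subseteq> cball a \<delta>'" using \<open>a \<in> closure \<gamma>\<close> by (auto simp: dist_commute subset_iff)
      then have "closure \<gamma> \<subseteq> cball a \<delta>'" by (intro closure_minimal) auto
      then show ?thesis using \<open>b \<in> closure \<gamma>\<close> by auto
    qed
    have cG: "closure G = G \<union> J" unfolding J_def using closure_Un_frontier[of G] by simp
    have cl\<gamma>: "compact (closure \<gamma>)"
      using bounded_subset[OF \<open>bounded G\<close> \<gamma>G] by (simp add: compact_closure)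
    \<comment> \<open>The crosscut runs into the boundary, so its preimage in the disc is not relatively compact.\<close>
    have "closure \<gamma> \<inter> J \<noteq> {}"
    proof
      assume "closure \<gamma> \<inter> J = {}"
      then have sub: "closure \<gamma> \<subseteq> G" using closure_mono[OF \<gamma>G] cG by blast
      then have "compact (\<psi> ` closure \<gamma>)"
        using cl\<gamma> continuous_on_subset[OF c\<psi>] by (intro compact_continuous_image) auto
      then have cl: "closed (\<psi> ` closure \<gamma>)" by (rule compact_imp_closed)
      define v where "v = (\<lambda>n::nat. 1 / (real n + 1))"
      have v: "0 < v n" "v n < pi" for n
      proof -
        have "v n \<le> 1" by (simp add: v_def)
        then show "v n < pi" using pi_gt3 by linarith
      qed (simp add: v_def)
      have "\<psi> (F (Complex u (v n))) = E (Complex u (v n))" for n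
        unfolding F_def using \<phi>[OF E1, of "Complex u (v n)"] v[of n] by (simp add: S_def)
      moreover have "F (Complex u (v n)) \<in> \<gamma>" for n using v[of n] by (auto simp: \<gamma>_def)
      ultimately have mem: "\<forall>n. E (Complex u (v n)) \<in> \<psi> ` closure \<gamma>"
        using closure_subset[of \<gamma>] by (metis image_eqI subsetD)
      have "v \<longlonglongrightarrow> 0" unfolding v_def using LIMSEQ_inverse_real_of_nat by (simp add: inverse_eq_divide add.commute)
      then have "(\<lambda>n. Complex u (v n)) \<longlonglongrightarrow> Complex u 0" by (intro tendsto_Complex tendsto_const)
      moreover have "isCont E (Complex u 0)"
      proof -
        have "\<i> + exp (Complex u 0) \<noteq> 0" by (auto simp: complex_eq_iff Im_exp)
        then show ?thesis unfolding E_def cayley_def by (intro continuous_intros) auto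
      qed
      ultimately have "(\<lambda>n. E (Complex u (v n))) \<longlonglongrightarrow> E (Complex u 0)"
        using isCont_tendsto_compose by blast
      from closed_sequentially[OF cl _ this] have "E (Complex u 0) \<in> \<psi> ` closure \<gamma>"
        using mem by simp
      then have "cmod (E (Complex u 0)) < 1" using sub \<psi> by auto
      moreover have "cmod (E (Complex u 0)) = 1" using norm_cayley(2)[of "exp (Complex u 0)"] \<zeta>
        by (simp add: E_def norm_mult Im_exp)
      ultimately show False by simp
    qed
    then obtain a where a: "a \<in> closure \<gamma>" "a \<in> J" by blast
    define X where "X = closure \<gamma> \<inter> J"
    have "X \<noteq> {}" using a by (auto simp: X_def)
    have "diameter X \<le> \<delta>'" unfolding diameter_def using \<open>X \<noteq> {}\<close> clos by (auto simp: X_def intro!: cSUP_least)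
    then have "diameter X < \<delta>" using \<delta>' by linarith
    then obtain T where T: "closed T" "connected T" "X \<subseteq> T" "T \<subseteq> J" "\<And>a. a \<in> T \<Longrightarrow> T \<subseteq> cball a \<epsilon>'"
      using \<delta>(2)[of X] by (auto simp: X_def)
    have aT: "T \<subseteq> cball a \<epsilon>'" using T a by (auto simp: X_def)
    have \<gamma>a: "closure \<gamma> \<subseteq> cball a \<epsilon>'" using clos[OF a(1)] \<delta>' by (force simp: subset_iff)
    define B where "B = closure \<gamma> \<union> T"
    have BaB: "B \<subseteq> cball a \<epsilon>'" using aT \<gamma>a by (simp add: B_def)
    have "compact T" using compact_Int_closed[OF cJ T(1)] T(4) by (simp add: Int_absorb1)
    then have "compact B" unfolding B_def using cl\<gamma> by (rule compact_Un[rotated])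
    have "B \<inter> J = T" using T by (auto simp: B_def X_def)
    have far0: "\<phi> 0 \<notin> cball a \<epsilon>'"
    proof
      assume "\<phi> 0 \<in> cball a \<epsilon>'"
      then have "a \<in> ball (\<phi> 0) d0" using \<epsilon>' by (simp add: dist_commute)
      then show False using d0 a GJ by blast
    qed
    have "cmod (\<phi> z - a) \<le> \<epsilon>'" if z: "z \<in> ball 0 1" "z \<in> ball \<zeta> d" for z
    proof (rule ccontr)
      assume "\<not> ?thesis"
      then have far: "\<phi> z \<notin> cball a \<epsilon>'" by (simp add: dist_norm norm_minus_commute)
      have zG: "\<phi> z \<in> G" using \<phi> z by blast
      have "connected (- cball a \<epsilon>')" by (intro connected_complement_bounded_convex) auto
      then have 1: "connected_component (- B) (\<phi> z) (\<phi> 0)"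
        using far far0 BaB unfolding connected_component_def by (intro exI[of _ "- cball a \<epsilon>'"]) auto
      have 2: "connected_component (- J) (\<phi> z) (\<phi> 0)"
        using \<open>connected G\<close> GJ zG w0 unfolding connected_component_def by (intro exI[of _ G]) auto
      have "connected_component (- (B \<union> J)) (\<phi> z) (\<phi> 0)"
        by (rule Janiszewski[OF \<open>compact B\<close> compact_imp_closed[OF cJ] _ 1 2]) (simp add: \<open>B \<inter> J = T\<close> T)
      then obtain C where C: "connected C" "C \<subseteq> - (B \<union> J)" "\<phi> z \<in> C" "\<phi> 0 \<in> C"
        unfolding connected_component_def by blast
      have CG: "C \<subseteq> G"
        using connected_Int_frontier[OF C(1), of G] C zG unfolding J_def by blast
      \<comment> \<open>The crosscut is a level set of \<open>k\<close>, and \<open>z\<close> and 0 lie on different sides of it.\<close>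
      define k where "k = (\<lambda>m. cmod (inv_cayley (m / \<zeta>)))"
      have ck: "continuous_on (ball 0 1) k"
        unfolding k_def using \<zeta> \<zeta>0
        by (intro continuous_on_norm continuous_on_compose2[OF continuous_on_inv_cayley] continuous_intros)
           (auto simp: norm_divide)
      have "continuous_on C (\<lambda>x. k (\<psi> x))"
        using CG \<psi> by (intro continuous_on_compose2[OF ck] continuous_on_subset[OF c\<psi>]) auto
      then have "connected ((\<lambda>x. k (\<psi> x)) ` C)" using C(1) by (rule connected_continuous_image)
      moreover have "k 0 = 1" by (simp add: k_def inv_cayley_def norm_mult)
      moreover have "k z < exp u"
      proof -
        have "cmod (1 - z / \<zeta>) < d"
        proof -
          have "cmod (1 - z / \<zeta>) = cmod ((\<zeta> - z) / \<zeta>)" using \<zeta>0 by (simp add: diff_divide_distrib)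
          also have "\<dots> < d" using z \<zeta> by (simp add: norm_divide dist_norm)
          finally show ?thesis .
        qed
        have z1: "cmod (1 + z / \<zeta>) \<ge> 1"
          using norm_triangle_ineq2[of 2 "1 - z / \<zeta>"] \<open>cmod (1 - z / \<zeta>) < d\<close> \<open>d < 1\<close> by (simp add: algebra_simps)
        have "k z = cmod (1 - z / \<zeta>) / cmod (1 + z / \<zeta>)"
          by (simp add: k_def inv_cayley_def norm_mult norm_divide)
        also have "\<dots> \<le> cmod (1 - z / \<zeta>) / 1" using z1 by (intro divide_left_mono) auto
        also have "\<dots> < d" using \<open>cmod (1 - z / \<zeta>) < d\<close> by simp
        also have "d \<le> exp u" using u by (simp add: d_def)
        finally show ?thesis .
      qed
      moreover have "exp u < 1" using u by simp
      moreover have "k z \<in> (\<lambda>x. k (\<psi> x)) ` C" "k 0 \<in> (\<lambda>x. k (\<psi> x)) ` C"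
        using C \<phi>[of z] \<phi>[of 0] z by (metis image_eqI, metis image_eqI centre_in_ball zero_less_one)
      ultimately have "exp u \<in> (\<lambda>x. k (\<psi> x)) ` C"
        using connectedD_interval[of "(\<lambda>x. k (\<psi> x)) ` C" "k z" "k 0" "exp u"] by simp
      then obtain x where x: "x \<in> C" "k (\<psi> x) = exp u" by auto
      define m where "m = \<psi> x / \<zeta>"
      have xG: "x \<in> G" using x CG by blast
      have m1: "cmod m < 1" using \<psi>[OF xG] \<zeta> by (simp add: m_def norm_divide)
      have Im: "0 < Im (inv_cayley m)" by (rule Im_inv_cayley[OF m1])
      then have nz: "inv_cayley m \<noteq> 0" by auto
      define v where "v = Im (Ln (inv_cayley m))"
      have v: "0 < v" "v < pi" using Im_Ln_pos_lt_imp[OF Im] by (auto simp: v_def)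
      have "Ln (inv_cayley m) = Complex u v"
        using x(2) nz by (simp add: complex_eq_iff v_def k_def m_def)
      then have "exp (Complex u v) = inv_cayley m" using nz by (metis exp_Ln)
      moreover have "m \<noteq> -1" using m1 by auto
      ultimately have "E (Complex u v) = \<psi> x" using \<zeta>0 by (simp add: E_def cayley_inv_cayley m_def)
      then have "F (Complex u v) = x" using \<psi>[OF xG] by (simp add: F_def)
      then have "x \<in> \<gamma>" using v by (force simp: \<gamma>_def)
      then show False using C x closure_subset[of \<gamma>] by (auto simp: B_def)
    qed
    then show ?thesis by blast
  qed
  show ?thesis
  proof (rule that[OF \<open>0 < d\<close>])
    fix \<zeta> z z' assume "cmod \<zeta> = 1" and z: "z \<in> ball 0 1 \<inter> ball \<zeta> d" "z' \<in> ball 0 1 \<inter> ball \<zeta> d"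
    then obtain a where "cmod (\<phi> z - a) \<le> \<epsilon>'" "cmod (\<phi> z' - a) \<le> \<epsilon>'" using near by blast
    then show "cmod (\<phi> z - \<phi> z') \<le> \<epsilon>"
      using norm_triangle_ineq4[of "\<phi> z - a" "\<phi> z' - a"] \<epsilon>'(2) by simp
  qed
qed

section \<open>Arcs in the image of a half strip\<close>

text \<open>
  As \<open>K\<close> need not be convex, the mean value estimate only applies to points that are closer than
  the distance \<open>e\<close> from \<open>K\<close> to the complement of \<open>U\<close>; for other points the boundedness of \<open>g\<close> suffices.
\<close>

lemma holomorphic_lipschitz_on_compact:
  fixes g :: "complex \<Rightarrow> complex"
  assumes "open U" and hol: "g holomorphic_on U" and "compact K" "K \<subseteq> U"
  obtains L where "0 \<le> L" "\<And>x y. x \<in> K \<Longrightarrow> y \<in> K \<Longrightarrow> cmod (g x - g y) \<le> L * cmod (x - y)"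
proof (cases "K = {}")
  case True then show ?thesis using that[of 0] by simp
next
  case False
  obtain e where e: "0 < e" "(\<Union>x\<in>K. cball x e) \<subseteq> U"
    using compact_subset_open_imp_cball_epsilon_subset[OF \<open>compact K\<close> \<open>open U\<close> \<open>K \<subseteq> U\<close>] by blast
  define K' where "K' = (\<Union>x\<in>K. cball x e)"
  have "compact K'" unfolding K'_def by (rule compact_minkowski_sum_cball[OF \<open>compact K\<close>])
  have "continuous_on K' (\<lambda>z. cmod (deriv g z))"
    using holomorphic_on_imp_continuous_on[OF holomorphic_deriv[OF hol \<open>open U\<close>]] e
    by (intro continuous_on_norm) (auto simp: K'_def intro: continuous_on_subset)
  then have "bounded ((\<lambda>z. cmod (deriv g z)) ` K')"
    by (intro compact_imp_bounded compact_continuous_image \<open>compact K'\<close>)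
  then obtain B where B: "\<And>z. z \<in> K' \<Longrightarrow> cmod (deriv g z) \<le> B" by (force simp: bounded_iff)
  have "bounded (g ` K)"
    using holomorphic_on_imp_continuous_on[OF hol] \<open>K \<subseteq> U\<close>
    by (intro compact_imp_bounded compact_continuous_image \<open>compact K\<close>) (auto intro: continuous_on_subset)
  then obtain C where C: "\<And>z. z \<in> K \<Longrightarrow> cmod (g z) \<le> C" by (force simp: bounded_iff)
  obtain x0 where "x0 \<in> K" using False by blast
  then have "x0 \<in> K'" using e by (auto simp: K'_def intro!: bexI[of _ x0])
  then have "0 \<le> C" "0 \<le> B"
    using order_trans[OF norm_ge_zero C[of x0]] order_trans[OF norm_ge_zero B[of x0]] \<open>x0 \<in> K\<close> by auto
  show ?thesis
  proof (rule that[of "max B (2 * C / e)"])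
    show "0 \<le> max B (2 * C / e)" using \<open>0 \<le> B\<close> by simp
    fix x y assume xy: "x \<in> K" "y \<in> K"
    show "cmod (g x - g y) \<le> max B (2 * C / e) * cmod (x - y)"
    proof (cases "cmod (x - y) \<le> e")
      case True
      have sub: "cball y e \<subseteq> K'" using xy by (auto simp: K'_def)
      have "cmod (g x - g y) \<le> B * cmod (x - y)"
      proof (rule field_differentiable_bound[where S = "cball y e" and f' = "deriv g"])
        show "(g has_field_derivative deriv g z) (at z within cball y e)" if "z \<in> cball y e" for z
          by (rule holomorphic_derivI[OF hol \<open>open U\<close>]) (use sub that e in \<open>unfold K'_def, blast\<close>)
        show "cmod (deriv g z) \<le> B" if "z \<in> cball y e" for z using B sub that by blast
      qed (use True e in \<open>auto simp: dist_norm norm_minus_commute\<close>)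
      also have "\<dots> \<le> max B (2 * C / e) * cmod (x - y)" by (intro mult_right_mono) auto
      finally show ?thesis .
    next
      case False
      have "cmod (g x - g y) \<le> 2 * C" using C[OF xy(1)] C[OF xy(2)] norm_triangle_ineq4[of "g x" "g y"] by linarith
      also have "\<dots> = 2 * C / e * e" using e by simp
      also have "\<dots> \<le> max B (2 * C / e) * cmod (x - y)"
        using False e \<open>0 \<le> C\<close> by (intro mult_mono) (auto simp: le_max_iff_disj)
      finally show ?thesis .
    qed
  qed
qed

lemma injective_holomorphic_lower_bound:
  fixes g :: "complex \<Rightarrow> complex"
  assumes "open U" and hol: "g holomorphic_on U" and inj: "inj_on g U" and "compact K" "K \<subseteq> U"
  obtains m where "0 < m" "\<And>x y. x \<in> K \<Longrightarrow> y \<in> K \<Longrightarrow> m * cmod (x - y) \<le> cmod (g x - g y)"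
proof -
  obtain h where h: "h holomorphic_on (g ` U)" "\<And>z. z \<in> U \<Longrightarrow> h (g z) = z"
    using holomorphic_has_inverse[OF hol \<open>open U\<close> inj] by metis
  have "open (g ` U)" by (rule open_mapping_thm3[OF hol \<open>open U\<close> inj])
  moreover have "compact (g ` K)"
    using holomorphic_on_imp_continuous_on[OF hol] \<open>K \<subseteq> U\<close>
    by (intro compact_continuous_image \<open>compact K\<close>) (auto intro: continuous_on_subset)
  ultimately obtain L where L: "0 \<le> L"
      "\<And>x y. x \<in> g ` K \<Longrightarrow> y \<in> g ` K \<Longrightarrow> cmod (h x - h y) \<le> L * cmod (x - y)"
    using holomorphic_lipschitz_on_compact[OF _ h(1), of "g ` K"] \<open>K \<subseteq> U\<close> by (metis image_mono)
  show ?thesis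
  proof (rule that[of "1 / (L + 1)"])
    show "0 < 1 / (L + 1)" using L(1) by simp
    fix x y assume xy: "x \<in> K" "y \<in> K"
    then have "cmod (x - y) \<le> L * cmod (g x - g y)"
      using L(2)[of "g x" "g y"] h(2) \<open>K \<subseteq> U\<close> by (simp add: subset_iff)
    also have "\<dots> \<le> (L + 1) * cmod (g x - g y)" by (intro mult_right_mono) auto
    finally show "1 / (L + 1) * cmod (x - y) \<le> cmod (g x - g y)"
      using L(1) by (simp add: divide_le_eq mult.commute)
  qed
qed

definition half_strip :: "complex set" where
  "half_strip = {w. Re w < 0 \<and> \<bar>Im w\<bar> < pi}"

text \<open>
  The exponential maps the half strip onto the unit disc without the segment from \<open>-1\<close> to 0. Under it,
  the points \<open>strip_point r c\<close> with \<open>r\<close> fixed become the circular arc of radius \<open>exp (r - 1)\<close> and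
  angles from \<open>-pi * r\<close> to \<open>pi * r\<close>, which closes up to the whole unit circle as \<open>r\<close> tends to 1.
\<close>

definition strip_point :: "real \<Rightarrow> real \<Rightarrow> complex" where
  "strip_point r c = Complex (r - 1) (pi * r * (2 * c - 1))"

lemma open_half_strip: "open half_strip"
  unfolding half_strip_def by (intro open_Collect_conj open_Collect_less continuous_intros)

lemma abs_2c_minus_1: "c \<in> {0..1} \<Longrightarrow> \<bar>2 * c - 1\<bar> \<le> (1::real)"
  by (auto simp: abs_le_iff)

definition strip_box :: "real \<Rightarrow> complex set" where
  "strip_box R = cbox (Complex (-1) (- pi * R)) (Complex (R - 1) (pi * R))"

lemma strip_box: "compact (strip_box R)" "R < 1 \<Longrightarrow> strip_box R \<subseteq> half_strip"
  "\<lbrakk>0 \<le> r; r \<le> R; c \<in> {0..1}\<rbrakk> \<Longrightarrow> strip_point r c \<in> strip_box R"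
proof -
  show "compact (strip_box R)" by (simp add: strip_box_def)
  show "strip_box R \<subseteq> half_strip" if "R < 1"
  proof
    fix w assume "w \<in> strip_box R"
    then have "Re w \<le> R - 1" "\<bar>Im w\<bar> \<le> pi * R" by (auto simp: strip_box_def in_cbox_complex_iff)
    moreover have "pi * R < pi" using that by simp
    ultimately have "Re w < 0" "\<bar>Im w\<bar> < pi" using that by linarith+
    then show "w \<in> half_strip" by (simp add: half_strip_def)
  qed
  show "strip_point r c \<in> strip_box R" if "0 \<le> r" "r \<le> R" "c \<in> {0..1}"
  proof -
    have "\<bar>pi * r * (2 * c - 1)\<bar> \<le> pi * R * 1"
      unfolding abs_mult using that abs_2c_minus_1[OF that(3)] by (intro mult_mono) auto
    then show ?thesis using that by (auto simp: strip_box_def strip_point_def in_cbox_complex_iff abs_le_iff)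
  qed
qed

lemma strip_point_bounds:
  assumes p: "0 < r0" "r0 \<le> p" "p \<le> 1" "0 \<le> q" "q \<le> 1" and c: "c \<in> {0..1}" "d \<in> {0..1}"
  shows "cmod (strip_point p c - strip_point q d) \<le> 5 * \<bar>p - q\<bar> + 8 * \<bar>c - d\<bar>"
    and "r0 * \<bar>c - d\<bar> \<le> cmod (strip_point p c - strip_point q d)"
proof -
  define X where "X = p * (2 * c - 1) - q * (2 * d - 1)"
  have X: "X = 2 * (p * (c - d)) + (p - q) * (2 * d - 1)" by (simp add: X_def algebra_simps)
  have w: "strip_point p c - strip_point q d = Complex (p - q) (pi * X)"
    by (simp add: strip_point_def complex_eq_iff X_def algebra_simps)
  have 1: "\<bar>p * (c - d)\<bar> \<le> 1 * \<bar>c - d\<bar>" unfolding abs_mult using p by (intro mult_right_mono) auto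
  have 2: "\<bar>(p - q) * (2 * d - 1)\<bar> \<le> \<bar>p - q\<bar> * 1"
    unfolding abs_mult using abs_2c_minus_1[OF c(2)] by (intro mult_left_mono) auto
  have "cmod (strip_point p c - strip_point q d) \<le> \<bar>p - q\<bar> + \<bar>pi * X\<bar>"
    unfolding w using cmod_le[of "Complex (p - q) (pi * X)"] by simp
  also have "\<bar>pi * X\<bar> \<le> 4 * (2 * \<bar>c - d\<bar> + \<bar>p - q\<bar>)"
  proof -
    have "\<bar>2 * a + b\<bar> \<le> 2 * \<bar>a\<bar> + \<bar>b\<bar>" for a b :: real by linarith
    from this[of "p * (c - d)" "(p - q) * (2 * d - 1)"]
    have "\<bar>X\<bar> \<le> 2 * \<bar>c - d\<bar> + \<bar>p - q\<bar>" unfolding X using 1 2 by simp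
    then show ?thesis unfolding abs_mult using pi_less_4 by (intro mult_mono) auto
  qed
  finally show "cmod (strip_point p c - strip_point q d) \<le> 5 * \<bar>p - q\<bar> + 8 * \<bar>c - d\<bar>" by simp
  have "\<bar>X\<bar> \<le> pi * \<bar>X\<bar>" using pi_gt3 mult_right_mono[of 1 pi "\<bar>X\<bar>"] by simp
  also have "\<dots> \<le> cmod (strip_point p c - strip_point q d)"
    using abs_Im_le_cmod[of "Complex (p - q) (pi * X)"] unfolding w by (simp add: abs_mult)
  finally have 3: "\<bar>X\<bar> \<le> cmod (strip_point p c - strip_point q d)" .
  have 4: "\<bar>p - q\<bar> \<le> cmod (strip_point p c - strip_point q d)"
    using abs_Re_le_cmod[of "Complex (p - q) (pi * X)"] unfolding w by simp
  have "r0 * \<bar>c - d\<bar> \<le> \<bar>p * (c - d)\<bar>" unfolding abs_mult using p by (intro mult_right_mono) auto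
  moreover have "2 * \<bar>a\<bar> \<le> \<bar>2 * a + b\<bar> + \<bar>b\<bar>" for a b :: real by linarith
  from this[of "p * (c - d)" "(p - q) * (2 * d - 1)"]
  have "2 * \<bar>p * (c - d)\<bar> \<le> \<bar>X\<bar> + \<bar>p - q\<bar>" unfolding X using 2 by simp
  ultimately show "r0 * \<bar>c - d\<bar> \<le> cmod (strip_point p c - strip_point q d)"
    using 3 4 by linarith
qed

definition strip_arc :: "(complex \<Rightarrow> complex) \<Rightarrow> (real \<Rightarrow> real) \<Rightarrow> real \<Rightarrow> complex" where
  "strip_arc \<Theta> u c = \<Theta> (strip_point (u c) c)"

text \<open>
  Moving each point in the direction of the coordinate \<open>r\<close> is an isotopy with all the properties of
  \<open>arc_move_isotopy\<close>: velocities are Lipschitz in the parameter \<open>c\<close>, and positions are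
  bi-Lipschitz in it, because \<open>\<Theta>\<close> is injective and holomorphic and \<open>r\<close> stays away from 0 and 1.
\<close>

lemma strip_isotopy:
  fixes \<Theta> :: "complex \<Rightarrow> complex" and u u' :: "real \<Rightarrow> real"
  assumes hol: "\<Theta> holomorphic_on half_strip" and inj: "inj_on \<Theta> half_strip"
    and "0 < r0" "R < 1"
    and u: "k-lipschitz_on {0..1} u" "\<And>c. c \<in> {0..1} \<Longrightarrow> u c \<in> {r0..R}"
    and u': "k-lipschitz_on {0..1} u'" "\<And>c. c \<in> {0..1} \<Longrightarrow> u' c \<in> {r0..R}"
  defines "Z \<equiv> \<lambda>s. strip_arc \<Theta> (\<lambda>c. u c + s * (u' c - u c))"
  shows "\<exists>V B L.
    (\<forall>s\<in>{0..1}. \<forall>c\<in>{0..1}. ((\<lambda>s. Z s c) has_vector_derivative V s c) (at s)) \<and>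
    continuous_on ({0..1} \<times> {0..1}) (\<lambda>(s,c). Z s c) \<and>
    continuous_on ({0..1} \<times> {0..1}) (\<lambda>(s,c). V s c) \<and>
    (\<forall>s\<in>{0..1}. \<forall>c\<in>{0..1}. cmod (V s c) \<le> B) \<and>
    (\<forall>s\<in>{0..1}. \<forall>c\<in>{0..1}. \<forall>d\<in>{0..1}. cmod (V s c - V s d) \<le> L * cmod (Z s c - Z s d))"
proof -
  let ?I = "{0..1::real}" and ?K = "strip_box R"
  define p where "p = (\<lambda>s c. u c + s * (u' c - u c))"
  define ell where "ell = (\<lambda>s c. strip_point (p s c) c)"
  define Q where "Q = (\<lambda>c. complex_of_real (u' c - u c) * Complex 1 (pi * (2 * c - 1)))"
  define V where "V = (\<lambda>s c. Q c * deriv \<Theta> (ell s c))"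
  have Z: "Z s c = \<Theta> (ell s c)" for s c by (simp add: Z_def strip_arc_def ell_def p_def)
  have k0: "0 \<le> k" using u(1) by (rule lipschitz_on_nonneg)
  have pr: "r0 \<le> p s c \<and> p s c \<le> R" if "s \<in> ?I" "c \<in> ?I" for s c
  proof -
    have "p s c = (1 - s) * u c + s * u' c" by (simp add: p_def algebra_simps)
    moreover have "(1 - s) * r0 + s * r0 \<le> (1 - s) * u c + s * u' c"
      using that u(2)[OF that(2)] u'(2)[OF that(2)] by (intro add_mono mult_left_mono) auto
    moreover have "(1 - s) * u c + s * u' c \<le> (1 - s) * R + s * R"
      using that u(2)[OF that(2)] u'(2)[OF that(2)] by (intro add_mono mult_left_mono) auto
    ultimately show ?thesis by (simp add: algebra_simps)
  qed
  have pk: "\<bar>p s c - p s d\<bar> \<le> k * \<bar>c - d\<bar>" if "s \<in> ?I" "c \<in> ?I" "d \<in> ?I" for s c d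
  proof -
    have "p s c - p s d = (1 - s) * (u c - u d) + s * (u' c - u' d)" by (simp add: p_def algebra_simps)
    also have "\<bar>\<dots>\<bar> \<le> (1 - s) * \<bar>u c - u d\<bar> + s * \<bar>u' c - u' d\<bar>"
      using that abs_triangle_ineq[of "(1 - s) * (u c - u d)" "s * (u' c - u' d)"] by (simp add: abs_mult)
    also have "\<dots> \<le> (1 - s) * (k * \<bar>c - d\<bar>) + s * (k * \<bar>c - d\<bar>)"
      using that lipschitz_onD[OF u(1) that(2,3)] lipschitz_onD[OF u'(1) that(2,3)]
      by (intro add_mono mult_left_mono) (auto simp: dist_real_def)
    finally show ?thesis by (simp add: algebra_simps)
  qed
  have ell_box: "ell s c \<in> ?K" if "s \<in> ?I" "c \<in> ?I" for s c
    unfolding ell_def using pr[OF that] \<open>0 < r0\<close> that by (intro strip_box(3)) auto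
  have KD: "?K \<subseteq> half_strip" by (rule strip_box(2)[OF \<open>R < 1\<close>])
  have hol': "deriv \<Theta> holomorphic_on half_strip" by (rule holomorphic_deriv[OF hol open_half_strip])
  obtain m where m: "0 < m" "\<And>x y. x \<in> ?K \<Longrightarrow> y \<in> ?K \<Longrightarrow> m * cmod (x - y) \<le> cmod (\<Theta> x - \<Theta> y)"
    using injective_holomorphic_lower_bound[OF open_half_strip hol inj strip_box(1) KD] by blast
  obtain A where A: "0 \<le> A" "\<And>x y. x \<in> ?K \<Longrightarrow> y \<in> ?K \<Longrightarrow> cmod (deriv \<Theta> x - deriv \<Theta> y) \<le> A * cmod (x - y)"
    using holomorphic_lipschitz_on_compact[OF open_half_strip hol' strip_box(1) KD] by blast
  have c\<Theta>': "continuous_on ?K (deriv \<Theta>)" and c\<Theta>: "continuous_on ?K \<Theta>"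
    using holomorphic_on_imp_continuous_on[OF hol'] holomorphic_on_imp_continuous_on[OF hol] KD
    by (auto intro: continuous_on_subset)
  have "bounded (deriv \<Theta> ` ?K)"
    by (intro compact_imp_bounded compact_continuous_image c\<Theta>' strip_box(1))
  then obtain B where B: "\<And>x. x \<in> ?K \<Longrightarrow> cmod (deriv \<Theta> x) \<le> B" by (force simp: bounded_iff)
  have B0: "0 \<le> B" using order_trans[OF norm_ge_zero B[OF ell_box[of 0 0]]] by simp
  have cu: "continuous_on ?I u" "continuous_on ?I u'" using u(1) u'(1) lipschitz_on_continuous_on by blast+
  have cu2: "continuous_on (?I \<times> ?I) (\<lambda>q. u (snd q))" "continuous_on (?I \<times> ?I) (\<lambda>q. u' (snd q))"
    by (rule continuous_on_compose2[OF cu(1)] continuous_on_compose2[OF cu(2)],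
        auto intro: continuous_on_snd continuous_on_id)+
  have cell: "continuous_on (?I \<times> ?I) (\<lambda>q. ell (fst q) (snd q))"
    unfolding ell_def strip_point_def p_def by (intro continuous_intros cu2)
  have ellimg: "(\<lambda>q. ell (fst q) (snd q)) ` (?I \<times> ?I) \<subseteq> ?K" using ell_box by auto
  have Q5: "cmod (Complex 1 (pi * (2 * c - 1))) \<le> 5" if "c \<in> ?I" for c
  proof -
    have "\<bar>pi * (2 * c - 1)\<bar> \<le> 4 * 1"
      unfolding abs_mult using pi_less_4 abs_2c_minus_1[OF that] by (intro mult_mono) auto
    then show ?thesis using cmod_le[of "Complex 1 (pi * (2 * c - 1))"] by simp
  qed
  have du: "\<bar>u' c - u c\<bar> \<le> 1" if "c \<in> ?I" for c
    using u(2)[OF that] u'(2)[OF that] \<open>0 < r0\<close> \<open>R < 1\<close> by auto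
  have QB: "cmod (Q c) \<le> 1 * 5" if "c \<in> ?I" for c
    unfolding Q_def norm_mult norm_of_real using Q5[OF that] du[OF that] by (intro mult_mono) auto
  have QL: "cmod (Q c - Q d) \<le> (10 * k + 8) * \<bar>c - d\<bar>" if "c \<in> ?I" "d \<in> ?I" for c d
  proof -
    have "Q c - Q d = complex_of_real ((u' c - u' d) - (u c - u d)) * Complex 1 (pi * (2 * c - 1))
        + complex_of_real (u' d - u d) * Complex 0 (2 * pi * (c - d))"
      by (simp add: Q_def complex_eq_iff algebra_simps)
    also have "cmod \<dots> \<le> \<bar>(u' c - u' d) - (u c - u d)\<bar> * 5 + 1 * (8 * \<bar>c - d\<bar>)"
    proof (rule norm_triangle_mono)
      show "cmod (complex_of_real ((u' c - u' d) - (u c - u d)) * Complex 1 (pi * (2 * c - 1)))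
         \<le> \<bar>(u' c - u' d) - (u c - u d)\<bar> * 5"
        unfolding norm_mult norm_of_real using Q5[OF that(1)] by (intro mult_left_mono) auto
      have "cmod (Complex 0 (2 * pi * (c - d))) = 2 * pi * \<bar>c - d\<bar>"
        by (simp add: complex_norm abs_mult)
      also have "\<dots> \<le> 8 * \<bar>c - d\<bar>" using pi_less_4 by (intro mult_right_mono) auto
      finally show "cmod (complex_of_real (u' d - u d) * Complex 0 (2 * pi * (c - d))) \<le> 1 * (8 * \<bar>c - d\<bar>)"
        unfolding norm_mult norm_of_real using du[OF that(2)] by (intro mult_mono) auto
    qed
    also have "\<bar>(u' c - u' d) - (u c - u d)\<bar> \<le> 2 * (k * \<bar>c - d\<bar>)"
      using lipschitz_onD[OF u(1) that] lipschitz_onD[OF u'(1) that] by (auto simp: dist_real_def)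
    finally show ?thesis by (simp add: algebra_simps)
  qed
  have ellL: "cmod (ell s c - ell s d) \<le> (5 * k + 8) * \<bar>c - d\<bar>" "r0 * \<bar>c - d\<bar> \<le> cmod (ell s c - ell s d)"
    if "s \<in> ?I" "c \<in> ?I" "d \<in> ?I" for s c d
    using strip_point_bounds[of r0 "p s c" "p s d" c d] pr[OF that(1,2)] pr[OF that(1,3)] pk[OF that]
      that \<open>0 < r0\<close> \<open>R < 1\<close> by (simp_all add: ell_def algebra_simps)
  define W where "W = (10 * k + 8) * B + 5 * (A * (5 * k + 8))"
  have W0: "0 \<le> W" using k0 B0 A(1) by (simp add: W_def)
  show ?thesis
  proof (rule exI[of _ V], rule exI[of _ "5 * B"], rule exI[of _ "W / (r0 * m)"], intro conjI ballI)
    show "continuous_on (?I \<times> ?I) (\<lambda>(s,c). Z s c)"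
      using continuous_on_compose2[OF c\<Theta> cell ellimg] by (simp add: Z split_def)
    have "continuous_on (?I \<times> ?I) (\<lambda>q. deriv \<Theta> (ell (fst q) (snd q)))"
      by (rule continuous_on_compose2[OF c\<Theta>' cell ellimg])
    then show "continuous_on (?I \<times> ?I) (\<lambda>(s,c). V s c)"
      unfolding V_def Q_def split_def by (intro continuous_intros cu2)
    fix s c :: real assume s: "s \<in> ?I" and c: "c \<in> ?I"
    have "((\<lambda>s. strip_point (u c + s * (u' c - u c)) c) has_vector_derivative Q c) (at s)"
    proof -
      have "(\<lambda>s. strip_point (u c + s * (u' c - u c)) c)
          = (\<lambda>s. strip_point (u c) c + s *\<^sub>R Q c)"
        by (auto simp: strip_point_def Q_def complex_eq_iff algebra_simps)
      then show ?thesis by (auto intro!: derivative_eq_intros)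
    qed
    moreover have "(\<Theta> has_field_derivative deriv \<Theta> (ell s c)) (at (ell s c))"
      using holomorphic_derivI[OF hol open_half_strip] ell_box[OF s c] KD by blast
    ultimately show "((\<lambda>s. Z s c) has_vector_derivative V s c) (at s)"
      using field_vector_diff_chain_at[of "\<lambda>s. strip_point (u c + s * (u' c - u c)) c" "Q c" s \<Theta>]
      by (simp add: V_def Z ell_def p_def o_def)
    show "cmod (V s c) \<le> 5 * B"
      unfolding V_def norm_mult using QB[OF c] B[OF ell_box[OF s c]] by (intro mult_mono) auto
    fix d assume d: "d \<in> ?I"
    have "V s c - V s d = (Q c - Q d) * deriv \<Theta> (ell s c) + Q d * (deriv \<Theta> (ell s c) - deriv \<Theta> (ell s d))"
      by (simp add: V_def algebra_simps)
    also have "cmod \<dots> \<le> ((10 * k + 8) * \<bar>c - d\<bar>) * B + 5 * (A * ((5 * k + 8) * \<bar>c - d\<bar>))"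
    proof (rule norm_triangle_mono)
      show "cmod ((Q c - Q d) * deriv \<Theta> (ell s c)) \<le> ((10 * k + 8) * \<bar>c - d\<bar>) * B"
        unfolding norm_mult using k0 by (intro mult_mono QL c d B ell_box s) auto
      have "cmod (deriv \<Theta> (ell s c) - deriv \<Theta> (ell s d)) \<le> A * ((5 * k + 8) * \<bar>c - d\<bar>)"
        by (rule order_trans[OF A(2)[OF ell_box[OF s c] ell_box[OF s d]] mult_left_mono[OF ellL(1)[OF s c d] A(1)]])
      then show "cmod (Q d * (deriv \<Theta> (ell s c) - deriv \<Theta> (ell s d))) \<le> 5 * (A * ((5 * k + 8) * \<bar>c - d\<bar>))"
        unfolding norm_mult using QB[OF d] by (intro mult_mono) auto
    qed
    also have "\<dots> = W / r0 * (r0 * \<bar>c - d\<bar>)" using \<open>0 < r0\<close> by (simp add: W_def field_simps)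
    also have "\<dots> \<le> W / r0 * cmod (ell s c - ell s d)"
      using W0 \<open>0 < r0\<close> by (intro mult_left_mono ellL(2)[OF s c d]) auto
    also have "\<dots> = W / (r0 * m) * (m * cmod (ell s c - ell s d))" using m(1) by simp
    also have "\<dots> \<le> W / (r0 * m) * cmod (Z s c - Z s d)"
      unfolding Z using W0 \<open>0 < r0\<close> m(1) by (intro mult_left_mono m(2) ell_box s c d) auto
    finally show "cmod (V s c - V s d) \<le> W / (r0 * m) * cmod (Z s c - Z s d)" .
  qed
qed

section \<open>Cheap moves between arcs with small tracks\<close>

definition lip :: "(real \<Rightarrow> real) \<Rightarrow> bool" where
  "lip f \<longleftrightarrow> (\<exists>k. \<forall>c\<in>{0..1}. \<forall>d\<in>{0..1}. \<bar>f c - f d\<bar> \<le> k * \<bar>c - d\<bar>)"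

lemma lipE:
  assumes "lip f" obtains k where "0 \<le> k" "\<And>c d. c \<in> {0..1} \<Longrightarrow> d \<in> {0..1} \<Longrightarrow> \<bar>f c - f d\<bar> \<le> k * \<bar>c - d\<bar>"
proof -
  obtain k where k: "\<And>c d. c \<in> {0..1} \<Longrightarrow> d \<in> {0..1} \<Longrightarrow> \<bar>f c - f d\<bar> \<le> k * \<bar>c - d\<bar>"
    using assms unfolding lip_def by blast
  show ?thesis
  proof (rule that[of "\<bar>k\<bar>"])
    fix c d :: real assume "c \<in> {0..1}" "d \<in> {0..1}"
    from k[OF this] show "\<bar>f c - f d\<bar> \<le> \<bar>k\<bar> * \<bar>c - d\<bar>"
      by (rule order_trans) (intro mult_right_mono, auto)
  qed simp
qed

lemma lipI: "(\<And>c d. c \<in> {0..1} \<Longrightarrow> d \<in> {0..1} \<Longrightarrow> \<bar>f c - f d\<bar> \<le> k * \<bar>c - d\<bar>) \<Longrightarrow> lip f"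
  unfolding lip_def by blast

lemma lip_imp_lipschitz_on:
  assumes "lip f" "lip g"
  obtains k where "k-lipschitz_on {0..1} f" "k-lipschitz_on {0..1} g"
proof -
  obtain k where k: "0 \<le> k" "\<And>c d. c \<in> {0..1} \<Longrightarrow> d \<in> {0..1} \<Longrightarrow> \<bar>f c - f d\<bar> \<le> k * \<bar>c - d\<bar>"
    by (rule lipE[OF assms(1)], erule that, blast)
  obtain l where l: "0 \<le> l" "\<And>c d. c \<in> {0..1} \<Longrightarrow> d \<in> {0..1} \<Longrightarrow> \<bar>g c - g d\<bar> \<le> l * \<bar>c - d\<bar>"
    by (rule lipE[OF assms(2)], erule that, blast)
  have f: "k-lipschitz_on {0..1} f" and g: "l-lipschitz_on {0..1} g"
    using k l by (auto intro!: lipschitz_onI simp: dist_real_def)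
  show ?thesis
    by (rule that[OF lipschitz_on_le[OF f, of "max k l"] lipschitz_on_le[OF g, of "max k l"]]) simp_all
qed

lemma lip_const: "lip (\<lambda>_. a)" by (rule lipI[of _ 0]) simp

lemma lip_add:
  assumes "lip f" "lip g" shows "lip (\<lambda>c. f c + g c)"
proof -
  obtain k where k0: "0 \<le> k" and k: "\<And>c d. c \<in> {0..1} \<Longrightarrow> d \<in> {0..1} \<Longrightarrow> \<bar>f c - f d\<bar> \<le> k * \<bar>c - d\<bar>"
    by (rule lipE[OF assms(1)], erule that, blast)
  obtain l where l0: "0 \<le> l" and l: "\<And>c d. c \<in> {0..1} \<Longrightarrow> d \<in> {0..1} \<Longrightarrow> \<bar>g c - g d\<bar> \<le> l * \<bar>c - d\<bar>"
    by (rule lipE[OF assms(2)], erule that, blast)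
  show ?thesis
  proof (rule lipI[of _ "k + l"])
    fix c d :: real assume cd: "c \<in> {0..1}" "d \<in> {0..1}"
    have "\<bar>f c + g c - (f d + g d)\<bar> \<le> \<bar>f c - f d\<bar> + \<bar>g c - g d\<bar>" by linarith
    also have "\<dots> \<le> k * \<bar>c - d\<bar> + l * \<bar>c - d\<bar>" by (intro add_mono k l cd)
    finally show "\<bar>f c + g c - (f d + g d)\<bar> \<le> (k + l) * \<bar>c - d\<bar>" by (simp add: distrib_right)
  qed
qed

lemma lip_mult:
  assumes "lip f" "lip g" shows "lip (\<lambda>c. f c * g c)"
proof -
  obtain k where k: "0 \<le> k" "\<And>c d. c \<in> {0..1} \<Longrightarrow> d \<in> {0..1} \<Longrightarrow> \<bar>f c - f d\<bar> \<le> k * \<bar>c - d\<bar>"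
    by (rule lipE[OF assms(1)], erule that, blast)
  obtain l where l: "0 \<le> l" "\<And>c d. c \<in> {0..1} \<Longrightarrow> d \<in> {0..1} \<Longrightarrow> \<bar>g c - g d\<bar> \<le> l * \<bar>c - d\<bar>"
    by (rule lipE[OF assms(2)], erule that, blast)
  have fb: "\<bar>f c\<bar> \<le> \<bar>f 0\<bar> + k" if "c \<in> {0..1}" for c
  proof -
    have "k * \<bar>c - 0\<bar> \<le> k * 1" using that k(1) by (intro mult_left_mono) auto
    then show ?thesis using k(2)[OF that, of 0] by simp
  qed
  have gb: "\<bar>g c\<bar> \<le> \<bar>g 0\<bar> + l" if "c \<in> {0..1}" for c
  proof -
    have "l * \<bar>c - 0\<bar> \<le> l * 1" using that l(1) by (intro mult_left_mono) auto
    then show ?thesis using l(2)[OF that, of 0] by simp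
  qed
  show ?thesis
  proof (rule lipI[of _ "(\<bar>f 0\<bar> + k) * l + (\<bar>g 0\<bar> + l) * k"])
    fix c d :: real assume cd: "c \<in> {0..1}" "d \<in> {0..1}"
    have "f c * g c - f d * g d = f c * (g c - g d) + g d * (f c - f d)" by (simp add: algebra_simps)
    also have "\<bar>\<dots>\<bar> \<le> \<bar>f c * (g c - g d)\<bar> + \<bar>g d * (f c - f d)\<bar>" by (rule abs_triangle_ineq)
    also have "\<dots> \<le> (\<bar>f 0\<bar> + k) * (l * \<bar>c - d\<bar>) + (\<bar>g 0\<bar> + l) * (k * \<bar>c - d\<bar>)"
      unfolding abs_mult using k(1) l(1) by (intro add_mono mult_mono fb gb k(2) l(2) cd) auto
    finally show "\<bar>f c * g c - f d * g d\<bar> \<le> ((\<bar>f 0\<bar> + k) * l + (\<bar>g 0\<bar> + l) * k) * \<bar>c - d\<bar>"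
      by (simp add: distrib_right mult.assoc)
  qed
qed

text \<open>
  Positive only near the integers and less than 1 only away from them, so \<open>lattice_weight\<close> and
  \<open>1 - lattice_weight\<close> form a partition of unity for the cores of the integer lattice and of its translate by
  1/2. The radius 7/24 leaves a margin of 1/24 inside the radius 1/3 of the cores.
\<close>

definition lattice_weight :: "real \<Rightarrow> real" where
  "lattice_weight t = max 0 (min 1 (12 * (7/24 - infdist t \<int>)))"

lemma lattice_weight_range: "0 \<le> lattice_weight t" "lattice_weight t \<le> 1"
  by (simp_all add: lattice_weight_def)

lemma lattice_weight_lipschitz: "\<bar>lattice_weight s - lattice_weight t\<bar> \<le> 12 * \<bar>s - t\<bar>"
proof -
  have near: "\<bar>infdist t \<int> - infdist s \<int>\<bar> \<le> \<bar>s - t\<bar>"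
    using infdist_triangle_abs[of t \<int> s] by (simp add: dist_real_def abs_minus_commute)
  have "\<bar>max 0 (min 1 a) - max 0 (min 1 b)\<bar> \<le> \<bar>a - b\<bar>" for a b :: real
    by (auto simp: max_def min_def)
  from this[of "12 * (7/24 - infdist s \<int>)" "12 * (7/24 - infdist t \<int>)"]
  have "\<bar>lattice_weight s - lattice_weight t\<bar> \<le> \<bar>12 * (7/24 - infdist s \<int>) - 12 * (7/24 - infdist t \<int>)\<bar>"
    unfolding lattice_weight_def .
  also have "12 * (7/24 - infdist s \<int>) - 12 * (7/24 - infdist t \<int>) = 12 * (infdist t \<int> - infdist s \<int>)"
    by simp
  also have "\<bar>12 * (infdist t \<int> - infdist s \<int>)\<bar> = 12 * \<bar>infdist t \<int> - infdist s \<int>\<bar>"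
    by (simp only: abs_mult abs_numeral)
  also have "\<dots> \<le> 12 * \<bar>s - t\<bar>" using near by (intro mult_left_mono) auto
  finally show ?thesis .
qed

lemma lattice_weight_pos:
  assumes "0 < lattice_weight t" obtains k :: int where "\<bar>t - of_int k\<bar> < 7/24"
proof -
  have "infdist t \<int> < 7/24" using assms by (simp add: lattice_weight_def)
  moreover obtain a :: real where "a \<in> \<int>" "infdist t \<int> = dist t a"
    by (rule infdist_attains_inf[of "\<int> :: real set" t]) (use Ints_0 in \<open>auto simp: closed_Ints\<close>)
  ultimately show ?thesis using that by (auto simp: Ints_def dist_real_def)
qed

lemma lattice_weight_less_1:
  assumes "lattice_weight t < 1" obtains k :: int where "\<bar>t - (of_int k + 1/2)\<bar> < 7/24"
proof -
  have far: "5/24 < infdist t \<int>" using assms by (simp add: lattice_weight_def)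
  have "infdist t \<int> \<le> dist t (of_int \<lfloor>t\<rfloor>)" "infdist t \<int> \<le> dist t (of_int (\<lfloor>t\<rfloor> + 1))"
    by (intro infdist_le Ints_of_int)+
  then have "\<bar>t - (of_int \<lfloor>t\<rfloor> + 1/2)\<bar> < 7/24"
    using far floor_correct[of t] by (simp add: dist_real_def abs_if split: if_splits)
  then show ?thesis by (rule that)
qed

lemma in_core:
  fixes \<delta> \<sigma> x y :: real
  assumes "0 < \<delta>" "\<bar>x / \<delta> - (of_int k + \<sigma>)\<bar> < 7/24" "\<bar>y - x\<bar> < \<delta> / 24"
  shows "\<bar>y - \<delta> * (of_int k + \<sigma>)\<bar> < \<delta> / 3"
proof -
  have "\<delta> * (x / \<delta>) = x" using assms(1) by simp
  then have "x - \<delta> * (of_int k + \<sigma>) = \<delta> * (x / \<delta> - (of_int k + \<sigma>))"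
    by (simp only: right_diff_distrib)
  then have "\<bar>x - \<delta> * (of_int k + \<sigma>)\<bar> = \<delta> * \<bar>x / \<delta> - (of_int k + \<sigma>)\<bar>"
    using assms(1) by (simp add: abs_mult)
  also have "\<dots> < \<delta> * (7/24)" using assms by (intro mult_strict_left_mono) auto
  finally show ?thesis using assms(3) by linarith
qed

lemma strip_arc_moves:
  assumes hol: "\<Theta> holomorphic_on half_strip" and inj: "inj_on \<Theta> half_strip"
    and "0 < r0" "R < 1"
    and u: "lip u" "\<And>c. c \<in> {0..1} \<Longrightarrow> u c \<in> {r0..R}"
    and u': "lip u'" "\<And>c. c \<in> {0..1} \<Longrightarrow> u' c \<in> {r0..R}"
  shows "\<exists>M. arc_move M (strip_arc \<Theta> u) (strip_arc \<Theta> u')"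
    and "\<And>\<delta> \<sigma> \<tau>. 0 < \<delta> \<Longrightarrow>
      (\<And>c. c \<in> {0..1} \<Longrightarrow> u c \<noteq> u' c \<Longrightarrow>
        \<exists>k l. \<forall>r\<in>{r0..R}. \<bar>Re (\<Theta> (strip_point r c)) - \<delta> * (of_int k + \<sigma>)\<bar> < \<delta> / 3 \<and>
                          \<bar>Im (\<Theta> (strip_point r c)) - \<delta> * (of_int l + \<tau>)\<bar> < \<delta> / 3) \<Longrightarrow>
      arc_move (16 * \<delta>) (strip_arc \<Theta> u) (strip_arc \<Theta> u')"
proof -
  define Z where "Z = (\<lambda>s. strip_arc \<Theta> (\<lambda>c. u c + s * (u' c - u c)))"
  obtain k where k: "k-lipschitz_on {0..1} u" "k-lipschitz_on {0..1} u'"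
    using lip_imp_lipschitz_on[OF u(1) u'(1)] by blast
  obtain V B L where iso:
    "\<forall>s\<in>{0..1}. \<forall>c\<in>{0..1}. ((\<lambda>s. Z s c) has_vector_derivative V s c) (at s)"
    "continuous_on ({0..1} \<times> {0..1}) (\<lambda>(s,c). Z s c)"
    "continuous_on ({0..1} \<times> {0..1}) (\<lambda>(s,c). V s c)"
    "\<forall>s\<in>{0..1}. \<forall>c\<in>{0..1}. cmod (V s c) \<le> B"
    "\<forall>s\<in>{0..1}. \<forall>c\<in>{0..1}. \<forall>d\<in>{0..1}. cmod (V s c - V s d) \<le> L * cmod (Z s c - Z s d)"
    using strip_isotopy[OF hol inj \<open>0 < r0\<close> \<open>R < 1\<close> k(1) u(2) k(2) u'(2)] unfolding Z_def by auto
  note Z = iso(1)[rule_format] iso(2,3) iso(4,5)[rule_format]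
  have Z01: "Z 0 = strip_arc \<Theta> u" "Z 1 = strip_arc \<Theta> u'" by (simp_all add: Z_def strip_arc_def fun_eq_iff)
  show "\<exists>M. arc_move M (strip_arc \<Theta> u) (strip_arc \<Theta> u')"
    using arc_move_isotopy[OF Z] unfolding Z01 by blast
  fix \<delta> \<sigma> \<tau> :: real
  assume "0 < \<delta>" and core: "\<And>c. c \<in> {0..1} \<Longrightarrow> u c \<noteq> u' c \<Longrightarrow>
        \<exists>k l. \<forall>r\<in>{r0..R}. \<bar>Re (\<Theta> (strip_point r c)) - \<delta> * (of_int k + \<sigma>)\<bar> < \<delta> / 3 \<and>
                          \<bar>Im (\<Theta> (strip_point r c)) - \<delta> * (of_int l + \<tau>)\<bar> < \<delta> / 3"
  have "arc_move (16 * \<delta>) (Z 0) (Z 1)"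
  proof (rule arc_move_in_cores[OF \<open>0 < \<delta>\<close> Z])
    fix c :: real assume c: "c \<in> {0..1}"
    show "(\<forall>s. Z s c = Z 0 c) \<or>
        (\<exists>k l. \<forall>s\<in>{0..1}. \<bar>Re (Z s c) - \<delta> * (of_int k + \<sigma>)\<bar> < \<delta> / 3 \<and>
                          \<bar>Im (Z s c) - \<delta> * (of_int l + \<tau>)\<bar> < \<delta> / 3)"
    proof (cases "u c = u' c")
      case True
      then show ?thesis by (simp add: Z_def strip_arc_def)
    next
      case False
      obtain k l where kl: "\<And>r. r \<in> {r0..R} \<Longrightarrow> \<bar>Re (\<Theta> (strip_point r c)) - \<delta> * (of_int k + \<sigma>)\<bar> < \<delta> / 3 \<and>
                          \<bar>Im (\<Theta> (strip_point r c)) - \<delta> * (of_int l + \<tau>)\<bar> < \<delta> / 3"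
        using core[OF c False] by blast
      have "u c + s * (u' c - u c) \<in> {r0..R}" if "s \<in> {0..1}" for s
      proof -
        have "u c + s * (u' c - u c) = (1 - s) * u c + s * u' c" by (simp add: algebra_simps)
        moreover have "(1 - s) * r0 + s * r0 \<le> (1 - s) * u c + s * u' c"
          using that u(2)[OF c] u'(2)[OF c] by (intro add_mono mult_left_mono) auto
        moreover have "(1 - s) * u c + s * u' c \<le> (1 - s) * R + s * R"
          using that u(2)[OF c] u'(2)[OF c] by (intro add_mono mult_left_mono) auto
        ultimately show ?thesis by (simp add: algebra_simps)
      qed
      then show ?thesis using kl by (intro disjI2, rule_tac exI[of _ k], rule_tac exI[of _ l]) (simp add: Z_def strip_arc_def)
    qed
  qed
  then show "arc_move (16 * \<delta>) (strip_arc \<Theta> u) (strip_arc \<Theta> u')" unfolding Z01 .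
qed

text \<open>
  Each point of the arc moves from \<open>r\<close> to \<open>r'\<close> in four rounds, the share of each round being one of the four
  products of \<open>\<alpha>\<close> or \<open>1 - \<alpha>\<close> with \<open>\<beta>\<close> or \<open>1 - \<beta>\<close>. In a given round only those points move
  that lie deep in a core of the corresponding translate of the lattice. By the hypothesis on the
  oscillation they do not leave this core, so \<open>arc_move_in_cores\<close> applies.
\<close>

theorem arc_move_small_tracks:
  assumes hol: "\<Theta> holomorphic_on half_strip" and inj: "inj_on \<Theta> half_strip"
    and "0 < \<rho>" "0 < \<delta>"
    and osc: "\<And>r r' c. r \<in> {\<rho>..<1} \<Longrightarrow> r' \<in> {\<rho>..<1} \<Longrightarrow> c \<in> {0..1} \<Longrightarrow>
       cmod (\<Theta> (strip_point r c) - \<Theta> (strip_point r' c)) < \<delta> / 24"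
    and r: "r \<in> {\<rho>..<1}" "r' \<in> {\<rho>..<1}"
  shows "arc_move (64 * \<delta>) (strip_arc \<Theta> (\<lambda>_. r)) (strip_arc \<Theta> (\<lambda>_. r'))"
proof -
  let ?I = "{0..1::real}"
  define R where "R = max r r'"
  have R: "R < 1" "\<rho> \<le> R" using r by (auto simp: R_def)
  define P where "P = (\<lambda>c. \<Theta> (strip_point \<rho> c))"
  define \<alpha> where "\<alpha> = (\<lambda>c. lattice_weight (Re (P c) / \<delta>))"
  define \<beta> where "\<beta> = (\<lambda>c. lattice_weight (Im (P c) / \<delta>))"
  have ab: "0 \<le> \<alpha> c" "\<alpha> c \<le> 1" "0 \<le> \<beta> c" "\<beta> c \<le> 1" for c
    by (simp_all add: \<alpha>_def \<beta>_def lattice_weight_range)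
  obtain A where A: "0 \<le> A" "\<And>x y. x \<in> strip_box R \<Longrightarrow> y \<in> strip_box R \<Longrightarrow> cmod (\<Theta> x - \<Theta> y) \<le> A * cmod (x - y)"
    using holomorphic_lipschitz_on_compact[OF open_half_strip hol strip_box(1) strip_box(2)[OF R(1)]] by blast
  have PL: "cmod (P c - P d) \<le> A * (8 * \<bar>c - d\<bar>)" if "c \<in> ?I" "d \<in> ?I" for c d
  proof -
    have "cmod (P c - P d) \<le> A * cmod (strip_point \<rho> c - strip_point \<rho> d)"
      unfolding P_def using \<open>0 < \<rho>\<close> R that by (intro A(2) strip_box(3)) auto
    also have "\<dots> \<le> A * (8 * \<bar>c - d\<bar>)"
      using strip_point_bounds(1)[of \<rho> \<rho> \<rho> c d] \<open>0 < \<rho>\<close> R that A(1) by (intro mult_left_mono) auto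
    finally show ?thesis .
  qed
  have wl: "lip (\<lambda>c. lattice_weight (f (P c) / \<delta>))"
    if f: "\<And>z w. \<bar>f z - f w\<bar> \<le> cmod (z - w)" for f
  proof (rule lipI[of _ "12 * (A * 8 / \<delta>)"])
    fix c d :: real assume cd: "c \<in> ?I" "d \<in> ?I"
    have "\<bar>lattice_weight (f (P c) / \<delta>) - lattice_weight (f (P d) / \<delta>)\<bar> \<le> 12 * \<bar>f (P c) / \<delta> - f (P d) / \<delta>\<bar>"
      by (rule lattice_weight_lipschitz)
    also have "\<bar>f (P c) / \<delta> - f (P d) / \<delta>\<bar> = \<bar>f (P c) - f (P d)\<bar> / \<delta>"
      using \<open>0 < \<delta>\<close> by (simp add: diff_divide_distrib[symmetric])
    also have "\<dots> \<le> A * (8 * \<bar>c - d\<bar>) / \<delta>"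
      using \<open>0 < \<delta>\<close> order_trans[OF f PL[OF cd]] by (intro divide_right_mono) auto
    finally show "\<bar>lattice_weight (f (P c) / \<delta>) - lattice_weight (f (P d) / \<delta>)\<bar> \<le> 12 * (A * 8 / \<delta>) * \<bar>c - d\<bar>"
      by simp
  qed
  have l\<alpha>: "lip \<alpha>" unfolding \<alpha>_def by (rule wl) (use abs_Re_le_cmod in \<open>metis minus_complex.sel(1)\<close>)
  have l\<beta>: "lip \<beta>" unfolding \<beta>_def by (rule wl) (use abs_Im_le_cmod in \<open>metis minus_complex.sel(2)\<close>)
  define U :: "(real \<Rightarrow> real) \<Rightarrow> real \<Rightarrow> real" where "U = (\<lambda>w c. r + (r' - r) * w c :: real)"
  have lU: "lip (U w)" if "lip w" for w unfolding U_def by (intro lip_add lip_mult lip_const that)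
  have UR: "U w c \<in> {\<rho>..R}" if "0 \<le> w c" "w c \<le> 1" for w c
  proof -
    have "U w c = (1 - w c) * r + w c * r'" by (simp add: U_def algebra_simps)
    moreover have "(1 - w c) * \<rho> + w c * \<rho> \<le> (1 - w c) * r + w c * r'"
      using that r by (intro add_mono mult_left_mono) auto
    moreover have "(1 - w c) * r + w c * r' \<le> (1 - w c) * R + w c * R"
      using that r by (intro add_mono mult_left_mono) (auto simp: R_def)
    ultimately show ?thesis by (simp add: algebra_simps)
  qed
  have \<alpha>pos: "\<exists>k. \<bar>Re (P c) / \<delta> - (of_int k + 0)\<bar> < 7/24" if "0 < \<alpha> c" for c
    using lattice_weight_pos[of "Re (P c) / \<delta>"] that by (auto simp: \<alpha>_def)
  have \<alpha>less: "\<exists>k. \<bar>Re (P c) / \<delta> - (of_int k + 1/2)\<bar> < 7/24" if "\<alpha> c < 1" for c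
    using lattice_weight_less_1[of "Re (P c) / \<delta>"] that by (auto simp: \<alpha>_def)
  have \<beta>pos: "\<exists>k. \<bar>Im (P c) / \<delta> - (of_int k + 0)\<bar> < 7/24" if "0 < \<beta> c" for c
    using lattice_weight_pos[of "Im (P c) / \<delta>"] that by (auto simp: \<beta>_def)
  have \<beta>less: "\<exists>k. \<bar>Im (P c) / \<delta> - (of_int k + 1/2)\<bar> < 7/24" if "\<beta> c < 1" for c
    using lattice_weight_less_1[of "Im (P c) / \<delta>"] that by (auto simp: \<beta>_def)
  have round: "arc_move (16 * \<delta>) (strip_arc \<Theta> (U w)) (strip_arc \<Theta> (U w'))"
    if "lip w" "lip w'" "\<And>c. 0 \<le> w c \<and> w c \<le> 1" "\<And>c. 0 \<le> w' c \<and> w' c \<le> 1"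
      and core: "\<And>c. w c \<noteq> w' c \<Longrightarrow> (\<exists>k. \<bar>Re (P c) / \<delta> - (of_int k + \<sigma>)\<bar> < 7/24) \<and>
         (\<exists>k. \<bar>Im (P c) / \<delta> - (of_int k + \<tau>)\<bar> < 7/24)" for w w' \<sigma> \<tau>
  proof (rule strip_arc_moves(2)[OF hol inj \<open>0 < \<rho>\<close> R(1) lU[OF that(1)] _ lU[OF that(2)] _ \<open>0 < \<delta>\<close>])
    show "U w c \<in> {\<rho>..R}" "U w' c \<in> {\<rho>..R}" for c using that(3,4) UR by blast+
    fix c :: real assume c: "c \<in> ?I" and "U w c \<noteq> U w' c"
    then have "w c \<noteq> w' c" by (auto simp: U_def)
    then obtain k l where kl: "\<bar>Re (P c) / \<delta> - (of_int k + \<sigma>)\<bar> < 7/24" "\<bar>Im (P c) / \<delta> - (of_int l + \<tau>)\<bar> < 7/24"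
      using core by blast
    have near: "cmod (\<Theta> (strip_point s c) - P c) < \<delta> / 24" if "s \<in> {\<rho>..R}" for s
      unfolding P_def using osc[of s \<rho> c] that c R by auto
    show "\<exists>k l. \<forall>s\<in>{\<rho>..R}. \<bar>Re (\<Theta> (strip_point s c)) - \<delta> * (of_int k + \<sigma>)\<bar> < \<delta> / 3 \<and>
                          \<bar>Im (\<Theta> (strip_point s c)) - \<delta> * (of_int l + \<tau>)\<bar> < \<delta> / 3"
    proof (rule exI[of _ k], rule exI[of _ l], intro ballI conjI)
      fix s assume s: "s \<in> {\<rho>..R}"
      show "\<bar>Re (\<Theta> (strip_point s c)) - \<delta> * (of_int k + \<sigma>)\<bar> < \<delta> / 3"
        using near[OF s] abs_Re_le_cmod[of "\<Theta> (strip_point s c) - P c"]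
        by (intro in_core[OF \<open>0 < \<delta>\<close> kl(1)]) simp
      show "\<bar>Im (\<Theta> (strip_point s c)) - \<delta> * (of_int l + \<tau>)\<bar> < \<delta> / 3"
        using near[OF s] abs_Im_le_cmod[of "\<Theta> (strip_point s c) - P c"]
        by (intro in_core[OF \<open>0 < \<delta>\<close> kl(2)]) simp
    qed
  qed
  \<comment> \<open>The partial sums of the four shares are 0, \<open>w1\<close>, \<open>\<alpha>\<close>, \<open>w3\<close> and 1.\<close>
  define w1 where "w1 = (\<lambda>c. \<alpha> c * \<beta> c)"
  define w3 where "w3 = (\<lambda>c. \<alpha> c + (1 + (-1) * \<alpha> c) * \<beta> c)"
  have l1: "lip w1" "lip w3" unfolding w1_def w3_def by (intro lip_add lip_mult lip_const l\<alpha> l\<beta>)+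
  have r1: "0 \<le> w1 c \<and> w1 c \<le> 1" for c
    using ab[of c] mult_mono[of "\<alpha> c" 1 "\<beta> c" 1] by (simp add: w1_def)
  have r3: "0 \<le> w3 c \<and> w3 c \<le> 1" for c
  proof -
    have "(1 - \<alpha> c) * \<beta> c \<le> (1 - \<alpha> c) * 1" using ab[of c] by (intro mult_left_mono) auto
    then show ?thesis using ab[of c] by (simp add: w3_def)
  qed
  have "arc_move (16 * \<delta>) (strip_arc \<Theta> (U (\<lambda>_. 0))) (strip_arc \<Theta> (U w1))"
  proof (rule round[where \<sigma> = 0 and \<tau> = 0])
    fix c assume "0 \<noteq> w1 c"
    then have "0 < \<alpha> c" "0 < \<beta> c" using ab[of c] by (auto simp: w1_def less_le)
    then show "(\<exists>k. \<bar>Re (P c) / \<delta> - (of_int k + 0)\<bar> < 7/24) \<and> (\<exists>k. \<bar>Im (P c) / \<delta> - (of_int k + 0)\<bar> < 7/24)"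
      using \<alpha>pos \<beta>pos by blast
  qed (use l1 r1 lip_const in auto)
  moreover have "arc_move (16 * \<delta>) (strip_arc \<Theta> (U w1)) (strip_arc \<Theta> (U \<alpha>))"
  proof (rule round[where \<sigma> = 0 and \<tau> = "1/2"])
    fix c assume "w1 c \<noteq> \<alpha> c"
    then have "0 < \<alpha> c" "\<beta> c < 1" using ab[of c] by (auto simp: w1_def less_le)
    then show "(\<exists>k. \<bar>Re (P c) / \<delta> - (of_int k + 0)\<bar> < 7/24) \<and> (\<exists>k. \<bar>Im (P c) / \<delta> - (of_int k + 1/2)\<bar> < 7/24)"
      using \<alpha>pos \<beta>less by blast
  qed (use l1 r1 l\<alpha> ab in auto)
  ultimately have 1: "arc_move (2 * (16 * \<delta>)) (strip_arc \<Theta> (U (\<lambda>_. 0))) (strip_arc \<Theta> (U \<alpha>))"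
    by (rule arc_move_trans)
  have "arc_move (16 * \<delta>) (strip_arc \<Theta> (U \<alpha>)) (strip_arc \<Theta> (U w3))"
  proof (rule round[where \<sigma> = "1/2" and \<tau> = 0])
    fix c assume "\<alpha> c \<noteq> w3 c"
    then have "\<alpha> c < 1" "0 < \<beta> c" using ab[of c] by (auto simp: w3_def less_le)
    then show "(\<exists>k. \<bar>Re (P c) / \<delta> - (of_int k + 1/2)\<bar> < 7/24) \<and> (\<exists>k. \<bar>Im (P c) / \<delta> - (of_int k + 0)\<bar> < 7/24)"
      using \<alpha>less \<beta>pos by blast
  qed (use l1 r3 l\<alpha> ab in auto)
  moreover have "arc_move (16 * \<delta>) (strip_arc \<Theta> (U w3)) (strip_arc \<Theta> (U (\<lambda>_. 1)))"
  proof (rule round[where \<sigma> = "1/2" and \<tau> = "1/2"])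
    fix c assume "w3 c \<noteq> 1"
    then have "\<alpha> c < 1" "\<beta> c < 1" using ab[of c] by (auto simp: w3_def less_le)
    then show "(\<exists>k. \<bar>Re (P c) / \<delta> - (of_int k + 1/2)\<bar> < 7/24) \<and> (\<exists>k. \<bar>Im (P c) / \<delta> - (of_int k + 1/2)\<bar> < 7/24)"
      using \<alpha>less \<beta>less by blast
  qed (use l1 r3 lip_const in auto)
  ultimately have 2: "arc_move (2 * (16 * \<delta>)) (strip_arc \<Theta> (U \<alpha>)) (strip_arc \<Theta> (U (\<lambda>_. 1)))"
    by (rule arc_move_trans)
  have "arc_move (2 * (2 * (16 * \<delta>))) (strip_arc \<Theta> (U (\<lambda>_. 0))) (strip_arc \<Theta> (U (\<lambda>_. 1)))"
    by (rule arc_move_trans[OF 1 2])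
  moreover have "U (\<lambda>_. 0) = (\<lambda>_. r)" "U (\<lambda>_. 1) = (\<lambda>_. r')" by (auto simp: U_def)
  ultimately show ?thesis by simp
qed

text \<open>
  For small \<open>r\<close> the arc lies close to \<open>\<Theta> (-1)\<close>, where \<open>\<Theta>\<close> is nearly affine, so up to translation it is
  close to a segment even in the sense of Lipschitz constants. Linear interpolation between the
  two is then an isotopy.
\<close>

lemma arc_move_from_segment:
  assumes hol: "\<Theta> holomorphic_on half_strip" and inj: "inj_on \<Theta> half_strip"
  obtains r M B where "r \<in> {0<..<1}" "B \<noteq> 0"
    "arc_move M (\<lambda>c. (2 * c - 1) *\<^sub>R B) (strip_arc \<Theta> (\<lambda>_. r))"
proof -
  let ?I = "{0..1::real}"
  define P where "P = deriv \<Theta> (-1)"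
  have m1: "-1 \<in> half_strip" by (simp add: half_strip_def)
  have P: "P \<noteq> 0" unfolding P_def by (rule holomorphic_injective_imp_regular[OF hol open_half_strip inj m1])
  have "continuous_on half_strip (deriv \<Theta>)"
    by (rule holomorphic_on_imp_continuous_on[OF holomorphic_deriv[OF hol open_half_strip]])
  then have "isCont (deriv \<Theta>) (-1)" using m1 open_half_strip by (simp add: continuous_on_eq_continuous_at)
  then obtain e where e: "0 < e" "\<And>w. dist w (-1) < e \<Longrightarrow> dist (deriv \<Theta> w) P < cmod P / 2"
    using P unfolding continuous_at_eps_delta P_def by (metis half_gt_zero zero_less_norm_iff)
  obtain e' where e': "0 < e'" "ball (-1) e' \<subseteq> half_strip" using open_half_strip m1 by (meson openE)
  define \<eta> where "\<eta> = min 1 (min e e')"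
  have \<eta>: "0 < \<eta>" "\<eta> \<le> 1" using e e' by (auto simp: \<eta>_def)
  define r where "r = \<eta> / 6"
  have r: "0 < r" "r < 1" using \<eta> by (auto simp: r_def)
  define B where "B = \<i> * complex_of_real (pi * r) * P"
  have B: "B \<noteq> 0" using P r by (simp add: B_def)
  have close: "strip_point r c \<in> ball (-1) \<eta>" if "c \<in> ?I" for c
  proof -
    have "strip_point r c - (-1) = Complex r (pi * r * (2 * c - 1))" by (simp add: strip_point_def complex_eq_iff)
    then have "cmod (strip_point r c - (-1)) \<le> \<bar>r\<bar> + \<bar>pi * r * (2 * c - 1)\<bar>"
      using cmod_le[of "Complex r (pi * r * (2 * c - 1))"] by simp
    also have "\<dots> \<le> r + 4 * r * 1"
      unfolding abs_mult using r pi_less_4 abs_2c_minus_1[OF that] by (intro add_mono mult_mono) auto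
    also have "\<dots> < \<eta>" using \<eta> by (simp add: r_def)
    finally show ?thesis by (simp only: mem_ball dist_norm norm_minus_commute[of "-1"])
  qed
  define a where "a = (\<lambda>c. (2 * c - 1) *\<^sub>R B)"
  define b where "b = strip_arc \<Theta> (\<lambda>_. r)"
  have lin: "cmod ((b c - a c) - (b d - a d)) \<le> cmod B * \<bar>c - d\<bar>" if "c \<in> ?I" "d \<in> ?I" for c d
  proof -
    let ?x = "strip_point r c" and ?y = "strip_point r d"
    have xy: "?x - ?y = \<i> * complex_of_real (2 * pi * r * (c - d))"
      by (simp add: strip_point_def complex_eq_iff algebra_simps)
    have "(b c - a c) - (b d - a d) = (\<Theta> ?x - P * ?x) - (\<Theta> ?y - P * ?y)"
    proof -
      have "a c - a d = P * (?x - ?y)"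
        unfolding xy a_def B_def by (simp add: scaleR_conv_of_real algebra_simps)
      then show ?thesis by (simp add: b_def strip_arc_def algebra_simps)
    qed
    also have "cmod \<dots> \<le> cmod P / 2 * cmod (?x - ?y)"
    proof (rule field_differentiable_bound[where S = "ball (-1) \<eta>" and f = "\<lambda>z. \<Theta> z - P * z" and f' = "\<lambda>z. deriv \<Theta> z - P"])
      fix z :: complex assume z: "z \<in> ball (-1) \<eta>"
      then have "z \<in> half_strip" using e' by (auto simp: \<eta>_def)
      then show "((\<lambda>z. \<Theta> z - P * z) has_field_derivative deriv \<Theta> z - P) (at z within ball (-1) \<eta>)"
        by (auto intro!: derivative_eq_intros holomorphic_derivI[OF hol open_half_strip])
      have "dist z (-1) < e" using z by (simp add: \<eta>_def dist_commute)
      from e(2)[OF this] show "cmod (deriv \<Theta> z - P) \<le> cmod P / 2" by (simp add: dist_norm)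
    qed (use close that in auto)
    also have "cmod (?x - ?y) = 2 * pi * r * \<bar>c - d\<bar>"
      unfolding xy norm_mult norm_of_real using r by (simp add: abs_mult)
    also have "cmod P / 2 * (2 * pi * r * \<bar>c - d\<bar>) = cmod B * \<bar>c - d\<bar>"
      unfolding B_def norm_mult norm_of_real using r by simp
    finally show ?thesis .
  qed
  have ca: "continuous_on ?I a" unfolding a_def by (intro continuous_intros)
  have cd: "continuous_on ?I (\<lambda>c. b c - a c)"
    by (rule lipschitz_on_continuous_on[of "cmod B"])
       (auto intro!: lipschitz_onI lin simp: dist_norm)
  then have "continuous_on ?I (\<lambda>c. (b c - a c) + a c)" using ca by (rule continuous_on_add)
  then have cb: "continuous_on ?I b" by simp
  have "bounded ((\<lambda>c. b c - a c) ` ?I)" by (intro compact_imp_bounded compact_continuous_image cd) simp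
  then obtain M where M: "\<And>c. c \<in> ?I \<Longrightarrow> cmod (b c - a c) \<le> M" by (force simp: bounded_iff)
  have "arc_move (2 * M) a b"
  proof (rule arc_move_linear[OF ca cb M, where L = 1])
    fix s c d :: real assume s: "s \<in> ?I" and cd: "c \<in> ?I" "d \<in> ?I"
    have "a c - a d = (2 * (c - d)) *\<^sub>R B" by (simp add: a_def scaleR_diff_left[symmetric])
    then have 1: "cmod (a c - a d) = 2 * (cmod B * \<bar>c - d\<bar>)"
      by (simp only: norm_scaleR abs_mult abs_numeral mult_ac)
    have "s * cmod ((b c - a c) - (b d - a d)) \<le> 1 * (cmod B * \<bar>c - d\<bar>)"
      using s by (intro mult_mono lin cd) auto
    then have 2: "cmod (s *\<^sub>R ((b c - a c) - (b d - a d))) \<le> cmod B * \<bar>c - d\<bar>" using s by simp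
    have "(a c + s *\<^sub>R (b c - a c)) - (a d + s *\<^sub>R (b d - a d)) = (a c - a d) + s *\<^sub>R ((b c - a c) - (b d - a d))"
      by (simp add: scaleR_diff_right)
    then have "cmod (a c - a d) - cmod (s *\<^sub>R ((b c - a c) - (b d - a d)))
       \<le> cmod ((a c + s *\<^sub>R (b c - a c)) - (a d + s *\<^sub>R (b d - a d)))"
      using norm_diff_ineq by metis
    then show "cmod ((b c - a c) - (b d - a d)) \<le> 1 * cmod ((a c + s *\<^sub>R (b c - a c)) - (a d + s *\<^sub>R (b d - a d)))"
      using 1 2 lin[OF cd] by linarith
  qed
  then show ?thesis using that[of r B "2 * M"] r B by (simp add: a_def b_def)
qed

section \<open>Jordan curves as limits of arcs\<close>

lemma norm_exp_strip_point_diff: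
  assumes "0 \<le> r" "r \<le> 1" "c \<in> {0..1}"
  shows "cmod (exp (strip_point r c) - exp (strip_point 1 c)) \<le> 5 * (1 - r)"
proof -
  have "cmod (exp (strip_point r c) - exp (strip_point 1 c)) \<le> 1 * cmod (strip_point r c - strip_point 1 c)"
  proof (rule field_differentiable_bound[where S = "{z. Re z \<le> 0}" and f' = exp])
    show "convex {z. Re z \<le> 0}" by (rule convex_halfspace_Re_le)
  qed (use assms in \<open>auto intro!: derivative_eq_intros simp: strip_point_def\<close>)
  also have "\<dots> \<le> 5 * (1 - r)"
  proof -
    have w: "strip_point r c - strip_point 1 c = Complex (r - 1) (pi * (r - 1) * (2 * c - 1))"
      by (simp add: strip_point_def complex_eq_iff algebra_simps)
    have "\<bar>pi * (r - 1) * (2 * c - 1)\<bar> \<le> 4 * (1 - r) * 1"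
      unfolding abs_mult using assms pi_less_4 abs_2c_minus_1[OF assms(3)] by (intro mult_mono) auto
    then show ?thesis unfolding w using cmod_le[of "Complex (r - 1) (pi * (r - 1) * (2 * c - 1))"] assms by simp
  qed
  finally show ?thesis .
qed

text \<open>
  The arcs belong to parameters \<open>r n\<close> that are so close to 1 that later tracks oscillate little enough for
  \<open>arc_move_small_tracks\<close> to give the speed \<open>1 / 4 ^ n\<close>. The boundary estimate for the conformal map
  makes the arcs converge. Limits lie in the frontier because the preimages leave every compact
  subset of the disc, and every frontier point is a limit because it is approached by images of
  points of the disc that accumulate on the circle.
\<close>

theorem frontier_limit_of_arc_moves:
  fixes G :: "complex set"
  assumes "open G" "bounded G" "G \<noteq> {}" "simply_connected G" and lc: "locally connected (frontier G)"
  shows "\<exists>a b B C. B \<noteq> 0 \<and> (\<forall>c\<in>{0..1}. a 0 c = (2 * c - 1) *\<^sub>R B) \<and>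
    (\<forall>n. arc_move (C / 4 ^ n) (a n) (a (Suc n))) \<and>
    (\<forall>c\<in>{0..1}. (\<lambda>n. a n c) \<longlonglongrightarrow> b c) \<and> b ` {0..1} = frontier G"
proof -
  let ?I = "{0..1::real}"
  have "G \<noteq> UNIV" using \<open>bounded G\<close> not_bounded_UNIV by blast
  then obtain \<psi> \<phi> where hol\<psi>: "\<psi> holomorphic_on G" and hol\<phi>: "\<phi> holomorphic_on ball 0 1"
    and \<psi>: "\<And>w. w \<in> G \<Longrightarrow> \<psi> w \<in> ball 0 1 \<and> \<phi> (\<psi> w) = w"
    and \<phi>: "\<And>z. z \<in> ball 0 1 \<Longrightarrow> \<phi> z \<in> G \<and> \<psi> (\<phi> z) = z"
    using Riemann_mapping_theorem[of G] assms(1,3,4) by metis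
  have c\<psi>: "continuous_on G \<psi>" by (rule holomorphic_on_imp_continuous_on[OF hol\<psi>])
  have GJ: "G \<inter> frontier G = {}" using frontier_disjoint_eq[of G] \<open>open G\<close> by (simp add: Int_commute)
  define \<Theta> where "\<Theta> = (\<lambda>w. \<phi> (exp w))"
  have expD: "exp ` half_strip \<subseteq> ball 0 1" by (auto simp: half_strip_def norm_exp_eq_Re)
  have hol: "\<Theta> holomorphic_on half_strip"
    using holomorphic_on_compose_gen[OF _ hol\<phi> expD] by (simp add: \<Theta>_def o_def holomorphic_intros)
  have inj: "inj_on \<Theta> half_strip"
  proof (rule inj_on_inverseI[where g = "\<lambda>x. Ln (\<psi> x)"])
    fix w assume w: "w \<in> half_strip"
    then have "\<psi> (\<Theta> w) = exp w" using \<phi>[of "exp w"] expD by (auto simp: \<Theta>_def)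
    then show "Ln (\<psi> (\<Theta> w)) = w" using w by (simp add: half_strip_def abs_less_iff)
  qed
  have sp: "strip_point r c \<in> half_strip" if "r \<in> {0<..<1}" "c \<in> ?I" for r c
    using strip_box(2)[of r] strip_box(3)[of r r c] that by auto
  have exp1: "exp (strip_point r c) \<in> ball 0 1" if "r \<in> {0<..<1}" "c \<in> ?I" for r c
    using sp[OF that] expD by blast
  have \<Theta>\<psi>: "\<Theta> (strip_point r c) \<in> G \<and> \<psi> (\<Theta> (strip_point r c)) = exp (strip_point r c)"
    if "r \<in> {0<..<1}" "c \<in> ?I" for r c
    using \<phi>[OF exp1[OF that]] by (simp add: \<Theta>_def)
  define \<zeta> where "\<zeta> = (\<lambda>c. exp (strip_point 1 c))"
  have \<zeta>1: "cmod (\<zeta> c) = 1" for c by (simp add: \<zeta>_def strip_point_def norm_exp_eq_Re)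
  have near: "\<exists>\<rho>\<in>{0<..<1}. \<forall>r\<in>{\<rho>..<1}. \<forall>c\<in>?I. exp (strip_point r c) \<in> ball 0 1 \<inter> ball (\<zeta> c) d" if "0 < d" for d
  proof (rule bexI[of _ "max (1/2) (1 - d/10)"])
    show "\<forall>r\<in>{max (1/2) (1 - d/10)..<1}. \<forall>c\<in>?I. exp (strip_point r c) \<in> ball 0 1 \<inter> ball (\<zeta> c) d"
    proof (intro ballI IntI)
      fix r c assume r: "r \<in> {max (1/2) (1 - d/10)..<1}" and c: "c \<in> ?I"
      show "exp (strip_point r c) \<in> ball 0 1" using r c by (intro exp1) auto
      have "cmod (exp (strip_point r c) - \<zeta> c) \<le> 5 * (1 - r)"
        unfolding \<zeta>_def using r c by (intro norm_exp_strip_point_diff) auto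
      also have "\<dots> < d" using r that by auto
      finally show "exp (strip_point r c) \<in> ball (\<zeta> c) d" by (simp add: dist_norm norm_minus_commute)
    qed
  qed (use that in auto)
  have osc: "\<exists>\<rho>\<in>{0<..<1}. \<forall>r\<in>{\<rho>..<1}. \<forall>r'\<in>{\<rho>..<1}. \<forall>c\<in>?I. cmod (\<Theta> (strip_point r c) - \<Theta> (strip_point r' c)) < e"
    if "0 < e" for e
  proof -
    have "0 < e/2" using that by simp
    from conformal_map_uniformly_close_near_boundary[OF assms(1,2) lc hol\<phi> \<phi> c\<psi> \<psi> this]
    obtain d where "0 < d" and d: "\<And>\<zeta> z z'. cmod \<zeta> = 1 \<Longrightarrow> z \<in> ball 0 1 \<inter> ball \<zeta> d \<Longrightarrow> z' \<in> ball 0 1 \<inter> ball \<zeta> d \<Longrightarrow>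
       cmod (\<phi> z - \<phi> z') \<le> e/2" by blast
    obtain \<rho> where \<rho>: "\<rho> \<in> {0<..<1}" "\<forall>r\<in>{\<rho>..<1}. \<forall>c\<in>?I. exp (strip_point r c) \<in> ball 0 1 \<inter> ball (\<zeta> c) d"
      using near[OF \<open>0 < d\<close>] by blast
    show ?thesis
    proof (rule bexI[OF _ \<rho>(1)], intro ballI)
      fix r r' c assume "r \<in> {\<rho>..<1}" "r' \<in> {\<rho>..<1}" "c \<in> ?I"
      then have "cmod (\<Theta> (strip_point r c) - \<Theta> (strip_point r' c)) \<le> e/2"
        unfolding \<Theta>_def using \<rho>(2) by (intro d[OF \<zeta>1[of c]]) auto
      then show "cmod (\<Theta> (strip_point r c) - \<Theta> (strip_point r' c)) < e" using that by linarith
    qed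
  qed
  define \<delta> where "\<delta> = (\<lambda>n::nat. 1 / (64 * 4 ^ n :: real))"
  have \<delta>: "0 < \<delta> n" "0 < \<delta> n / 24" "64 * \<delta> n = 1 / 4 ^ n" for n by (simp_all add: \<delta>_def)
  obtain \<rho> where \<rho>: "\<And>n. \<rho> n \<in> {0<..<1}"
    "\<And>n r r' c. r \<in> {\<rho> n..<1} \<Longrightarrow> r' \<in> {\<rho> n..<1} \<Longrightarrow> c \<in> ?I \<Longrightarrow>
       cmod (\<Theta> (strip_point r c) - \<Theta> (strip_point r' c)) < \<delta> n / 24"
    using osc[OF \<delta>(2)] by metis
  define r where "r = (\<lambda>n. Max (insert (1 - 1 / (real n + 2)) (\<rho> ` {..n})))"
  have r_lt: "r n < 1" for n using \<rho>(1) by (auto simp: r_def)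
  have r_ge: "\<rho> m \<le> r n" if "m \<le> n" for m n unfolding r_def by (rule Max_ge) (use that in auto)
  have r_ge': "1 - 1 / (real n + 2) \<le> r n" for n unfolding r_def by (rule Max_ge) auto
  have r01: "r n \<in> {0<..<1}" for n using r_lt[of n] r_ge[of n n] \<rho>(1)[of n] by auto
  have rlim: "r \<longlonglongrightarrow> 1"
  proof (rule tendsto_sandwich[of "\<lambda>n. 1 - 1 / (real n + 2)" r _ "\<lambda>_. 1"])
    have "(\<lambda>n. 1 / (real n + 2)) \<longlonglongrightarrow> 0"
      using LIMSEQ_ignore_initial_segment[OF LIMSEQ_inverse_real_of_nat, of 1]
      by (simp add: inverse_eq_divide add.commute)
    then show "(\<lambda>n. 1 - 1 / (real n + 2)) \<longlonglongrightarrow> 1" using tendsto_diff[OF tendsto_const, of _ 0] by fastforce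
  qed (simp_all add: r_ge' r_lt less_imp_le)
  obtain s M B where s: "s \<in> {0<..<1}" and B: "B \<noteq> 0"
    and first: "arc_move M (\<lambda>c. (2 * c - 1) *\<^sub>R B) (strip_arc \<Theta> (\<lambda>_. s))"
    using arc_move_from_segment[OF hol inj] by blast
  obtain M' where second: "arc_move M' (strip_arc \<Theta> (\<lambda>_. s)) (strip_arc \<Theta> (\<lambda>_. r 0))"
  proof -
    have "\<exists>M. arc_move M (strip_arc \<Theta> (\<lambda>_. s)) (strip_arc \<Theta> (\<lambda>_. r 0))"
      by (rule strip_arc_moves(1)[OF hol inj, of "min s (r 0)" "max s (r 0)"])
         (use s r01[of 0] in \<open>auto simp: lip_const\<close>)
    then show ?thesis using that by blast
  qed
  define a where "a = (\<lambda>n. case n of 0 \<Rightarrow> (\<lambda>c. (2 * c - 1) *\<^sub>R B) | Suc n \<Rightarrow> strip_arc \<Theta> (\<lambda>_. r n))"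
  have a0: "a 0 = (\<lambda>c. (2 * c - 1) *\<^sub>R B)" and aS: "a (Suc n) = strip_arc \<Theta> (\<lambda>_. r n)" for n
    by (simp_all add: a_def)
  have aS': "a (Suc n) c = \<Theta> (strip_point (r n) c)" for n c by (simp add: aS strip_arc_def)
  define C where "C = max 4 (2 * max M M')"
  have moves: "arc_move (C / 4 ^ n) (a n) (a (Suc n))" for n
  proof (cases n)
    case 0
    have "arc_move (2 * max M M') (a 0) (a (Suc 0))"
      unfolding a0 aS by (rule arc_move_trans[OF arc_move_mono[OF first] arc_move_mono[OF second]]) auto
    then have "arc_move C (a 0) (a (Suc 0))" by (rule arc_move_mono) (simp add: C_def)
    then show ?thesis by (simp add: 0)
  next
    case (Suc m)
    have "arc_move (64 * \<delta> m) (a (Suc m)) (a (Suc (Suc m)))"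
      unfolding aS using r_lt r_ge[of m m] r_ge[of m "Suc m"] \<rho>(1)[of m]
      by (intro arc_move_small_tracks[OF hol inj _ \<delta>(1) \<rho>(2)]) auto
    moreover have "64 * \<delta> m \<le> C / 4 ^ n" unfolding \<delta>(3) Suc by (simp add: C_def field_simps)
    ultimately show ?thesis unfolding Suc by (rule arc_move_mono)
  qed
  have "Cauchy (\<lambda>n. \<Theta> (strip_point (r n) c))" if c: "c \<in> ?I" for c
  proof (rule CauchyI)
    fix e :: real assume "0 < e"
    then obtain p where p: "p \<in> {0<..<1}" "\<forall>r\<in>{p..<1}. \<forall>r'\<in>{p..<1}. \<forall>c\<in>?I. cmod (\<Theta> (strip_point r c) - \<Theta> (strip_point r' c)) < e"
      using osc by blast
    have "\<forall>\<^sub>F n in sequentially. p < r n" using order_tendstoD(1)[OF rlim] p by simp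
    then obtain N where "\<And>n. N \<le> n \<Longrightarrow> p < r n" unfolding eventually_sequentially by blast
    then have "\<And>n. N \<le> n \<Longrightarrow> r n \<in> {p..<1}" using r_lt by (simp add: less_imp_le)
    then show "\<exists>N. \<forall>m\<ge>N. \<forall>n\<ge>N. cmod (\<Theta> (strip_point (r m) c) - \<Theta> (strip_point (r n) c)) < e"
      using p(2) c by blast
  qed
  then have "\<forall>c\<in>?I. \<exists>l. (\<lambda>n. \<Theta> (strip_point (r n) c)) \<longlonglongrightarrow> l"
    using Cauchy_convergent_iff convergent_def by blast
  then obtain b where blim: "\<And>c. c \<in> ?I \<Longrightarrow> (\<lambda>n. \<Theta> (strip_point (r n) c)) \<longlonglongrightarrow> b c" by metis
  have explim: "(\<lambda>n. exp (strip_point (r n) c)) \<longlonglongrightarrow> \<zeta> c" for c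
    unfolding \<zeta>_def strip_point_def by (intro tendsto_intros tendsto_Complex rlim)
  have "b ` ?I = frontier G"
  proof (intro equalityI subsetI)
    fix q assume "q \<in> b ` ?I"
    then obtain c where c: "c \<in> ?I" and q: "q = b c" by blast
    have "b c \<in> closure G"
      unfolding closure_sequential using blim[OF c] \<Theta>\<psi>[OF r01 c]
      by (intro exI[of _ "\<lambda>n. \<Theta> (strip_point (r n) c)"]) simp
    moreover have "b c \<notin> G"
    proof
      assume bG: "b c \<in> G"
      then have "isCont \<psi> (b c)" using c\<psi> \<open>open G\<close> by (simp add: continuous_on_eq_continuous_at)
      then have "(\<lambda>n. \<psi> (\<Theta> (strip_point (r n) c))) \<longlonglongrightarrow> \<psi> (b c)" by (rule isCont_tendsto_compose[OF _ blim[OF c]])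
      then have "(\<lambda>n. exp (strip_point (r n) c)) \<longlonglongrightarrow> \<psi> (b c)" using \<Theta>\<psi>[OF r01 c] by simp
      then have "\<psi> (b c) = \<zeta> c" using explim LIMSEQ_unique by blast
      then show False using \<psi>[OF bG] \<zeta>1[of c] by simp
    qed
    ultimately show "q \<in> frontier G" using \<open>open G\<close> by (simp add: q frontier_def interior_open)
  next
    fix q assume q: "q \<in> frontier G"
    then have "q \<in> closure G" by (simp add: frontier_def)
    then obtain w where w: "\<And>n. w n \<in> G" "w \<longlonglongrightarrow> q" unfolding closure_sequential by blast
    have mem: "\<psi> (w n) \<in> cball 0 1" for n using \<psi>[OF w(1)[of n]] by simp
    obtain z k where z: "z \<in> cball 0 1" and k: "strict_mono (k :: nat \<Rightarrow> nat)" and zlim: "((\<lambda>n. \<psi> (w n)) \<circ> k) \<longlonglongrightarrow> z"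
      using compact_cball[of "0::complex" 1, unfolded compact_def, rule_format, of "\<lambda>n. \<psi> (w n)", OF mem]
      by blast
    have wk: "(\<lambda>n. w (k n)) \<longlonglongrightarrow> q" using LIMSEQ_subseq_LIMSEQ[OF w(2) k] by (simp add: o_def)
    have z1: "cmod z = 1"
    proof (rule ccontr)
      assume "cmod z \<noteq> 1"
      then have zD: "z \<in> ball 0 1" using z by simp
      then have "isCont \<phi> z"
        using holomorphic_on_imp_continuous_on[OF hol\<phi>] by (simp add: continuous_on_eq_continuous_at)
      then have "(\<lambda>n. \<phi> (\<psi> (w (k n)))) \<longlonglongrightarrow> \<phi> z"
        using zlim by (intro isCont_tendsto_compose[of z \<phi>]) (simp_all add: o_def)
      then have "(\<lambda>n. w (k n)) \<longlonglongrightarrow> \<phi> z" using \<psi>[OF w(1)] by simp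
      then have "q = \<phi> z" using wk LIMSEQ_unique by blast
      then show False using \<phi>[OF zD] q GJ by blast
    qed
    define c where "c = (Arg z / pi + 1) / 2"
    have z0: "z \<noteq> 0" using z1 by auto
    have "- 1 < Arg z / pi" "Arg z / pi \<le> 1"
      using Arg_bounded[of z] by (simp_all add: pos_less_divide_eq pos_divide_le_eq)
    then have c: "c \<in> ?I" by (auto simp: c_def)
    have "2 * c - 1 = Arg z / pi" by (simp add: c_def field_simps)
    then have "strip_point 1 c = \<i> * complex_of_real (Arg z)" by (simp add: strip_point_def complex_eq_iff)
    then have \<zeta>z: "\<zeta> c = z" using Arg_eq[OF z0] z1 by (simp add: \<zeta>_def)
    have "cmod (q - b c) \<le> e" if "0 < e" for e
    proof -
      from conformal_map_uniformly_close_near_boundary[OF assms(1,2) lc hol\<phi> \<phi> c\<psi> \<psi> that]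
      obtain d where "0 < d" and d: "\<And>\<zeta> z z'. cmod \<zeta> = 1 \<Longrightarrow> z \<in> ball 0 1 \<inter> ball \<zeta> d \<Longrightarrow> z' \<in> ball 0 1 \<inter> ball \<zeta> d \<Longrightarrow>
         cmod (\<phi> z - \<phi> z') \<le> e" by blast
      have "\<forall>\<^sub>F n in sequentially. \<psi> (w (k n)) \<in> ball z d"
        using topological_tendstoD[OF zlim, of "ball z d"] \<open>0 < d\<close> by (simp add: o_def)
      moreover have "\<forall>\<^sub>F n in sequentially. exp (strip_point (r n) c) \<in> ball z d"
        using topological_tendstoD[OF explim, of "ball z d" c] \<open>0 < d\<close> by (simp add: \<zeta>z)
      ultimately have ev: "\<forall>\<^sub>F n in sequentially. cmod (w (k n) - \<Theta> (strip_point (r n) c)) \<le> e"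
      proof eventually_elim
        case (elim n)
        have "cmod (\<phi> (\<psi> (w (k n))) - \<phi> (exp (strip_point (r n) c))) \<le> e"
          using elim \<psi>[OF w(1)] exp1[OF r01 c] by (intro d[OF z1]) auto
        then show ?case using \<psi>[OF w(1)] by (simp add: \<Theta>_def)
      qed
      have "(\<lambda>n. w (k n) - \<Theta> (strip_point (r n) c)) \<longlonglongrightarrow> q - b c"
        by (intro tendsto_diff wk blim c)
      then show ?thesis by (rule Lim_norm_ubound[OF _ _ ev, rotated]) simp
    qed
    then have "cmod (q - b c) \<le> 0" by (rule field_le_epsilon) simp
    then have "q = b c" by simp
    then show "q \<in> b ` ?I" using c by blast
  qed
  moreover have "(\<lambda>n. a n c) \<longlonglongrightarrow> b c" if "c \<in> ?I" for c
    by (rule LIMSEQ_imp_Suc) (simp add: aS' blim[OF that])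
  ultimately show ?thesis
    using B a0 moves by (intro exI[of _ a] exI[of _ b] exI[of _ B] exI[of _ C]) simp
qed

lemma arc_move_isometry:
  assumes "bounded_linear \<iota>" and iso: "\<And>x. norm (\<iota> x) = norm x" and mv: "arc_move M a b"
  shows "arc_move M (\<lambda>c. \<iota> (a c)) (\<lambda>c. \<iota> (b c))"
proof -
  interpret bounded_linear \<iota> by fact
  obtain L y v where m: "moving_arc M L y v" and ab: "\<forall>c\<in>{0..1}. y 0 c = a c \<and> y 1 c = b c"
    using mv unfolding arc_move_def by blast
  note m' = m[unfolded moving_arc_def]
  have "moving_arc M L (\<lambda>t c. \<iota> (y t c)) (\<lambda>t c. \<iota> (v t c))"
    unfolding moving_arc_def
  proof (intro conjI allI ballI impI)
    have "continuous_on (UNIV \<times> {0..1}) (\<lambda>p. \<iota> (case p of (t,c) \<Rightarrow> y t c))"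
      by (rule continuous_on) (use m' in blast)
    then show "continuous_on (UNIV \<times> {0..1}) (\<lambda>(t,c). \<iota> (y t c))" by (simp add: split_def)
    have "continuous_on (UNIV \<times> {0..1}) (\<lambda>p. \<iota> (case p of (t,c) \<Rightarrow> v t c))"
      by (rule continuous_on) (use m' in blast)
    then show "continuous_on (UNIV \<times> {0..1}) (\<lambda>(t,c). \<iota> (v t c))" by (simp add: split_def)
    fix t c d :: real assume c: "c \<in> {0..1}"
    have "((\<lambda>t. y t c) has_vector_derivative v t c) (at t)" using m' c by blast
    then show "((\<lambda>t. \<iota> (y t c)) has_vector_derivative \<iota> (v t c)) (at t)" by (rule has_vector_derivative)
    show "norm (\<iota> (v t c)) \<le> M" using m' c by (simp add: iso)
    show "\<iota> (v t c) = 0" if "t \<le> 0 \<or> 1 \<le> t" using m' c that by (auto simp: zero)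
    assume "d \<in> {0..1}"
    then have "norm (v t c - v t d) \<le> L * norm (y t c - y t d)" using m' c by blast
    then show "norm (\<iota> (v t c) - \<iota> (v t d)) \<le> L * norm (\<iota> (y t c) - \<iota> (y t d))"
      by (simp add: diff[symmetric] iso)
  qed
  then show ?thesis unfolding arc_move_def using ab by (intro exI conjI) auto
qed

definition plane_of_complex :: "complex \<Rightarrow> real ^ 2" where
  "plane_of_complex z = vector [Re z, Im z]"

lemma plane_of_complex:
  "bounded_linear plane_of_complex" "norm (plane_of_complex z) = norm z" "surj plane_of_complex"
proof -
  show n: "norm (plane_of_complex z) = norm z" for z
    by (simp add: plane_of_complex_def norm_vec_def L2_set_def sum_2 norm_complex_def)
  show "bounded_linear plane_of_complex"
  proof (rule bounded_linear_intro[where K = 1])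
    show "norm (plane_of_complex z) \<le> norm z * 1" for z by (simp add: n)
  qed (simp_all add: plane_of_complex_def vec_eq_iff forall_2)
  show "surj plane_of_complex"
    by (rule surjI[of _ "\<lambda>x. Complex (vec_nth x 1) (vec_nth x 2)"]) (simp add: plane_of_complex_def vec_eq_iff forall_2)
qed

text \<open>
  The inside of a Jordan curve is simply connected and has the curve as its frontier, which is
  locally connected as a homeomorphic image of a circle. The plane of complex numbers is identified with
  \<open>real ^ 2\<close> by a linear isometry, which carries moves of arcs to moves of arcs.
\<close>

theorem theorem1:
  fixes J :: "(real ^ 2) set"
  assumes "Jordan_curve J"
    and "\<exists>p\<in>J. smoothly_pierceable_at J p"
  shows "funnel_section J"
proof -
  let ?\<iota> = plane_of_complex
  interpret \<iota>: bounded_linear ?\<iota> by (rule plane_of_complex(1))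
  have inj: "inj ?\<iota>"
    unfolding linear_injective_0[OF \<iota>.linear_axioms] by (metis norm_eq_zero plane_of_complex(2))
  define J' where "J' = ?\<iota> -` J"
  have JJ': "?\<iota> ` J' = J" unfolding J'_def by (rule surj_image_vimage_eq[OF plane_of_complex(3)])
  have "J' homeomorphic J" using linear_homeomorphic_image[OF \<iota>.linear_axioms inj, of J'] JJ' by simp
  also have "J homeomorphic sphere (0 :: real ^ 2) 1" using assms(1) by (simp add: Jordan_curve_def)
  also have "sphere (0 :: real ^ 2) 1 = ?\<iota> ` sphere 0 1"
  proof (intro equalityI subsetI)
    fix x :: "real ^ 2" assume x: "x \<in> sphere 0 1"
    obtain z where "x = ?\<iota> z" using plane_of_complex(3) by (rule surjE)
    then show "x \<in> ?\<iota> ` sphere 0 1" using x by (auto simp: plane_of_complex(2))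
  qed (auto simp: plane_of_complex(2))
  also have "\<dots> homeomorphic sphere (0::complex) 1"
    using linear_homeomorphic_image[OF \<iota>.linear_axioms inj] homeomorphic_sym by blast
  finally have hom: "J' homeomorphic sphere (0::complex) 1" .
  then obtain h where h: "continuous_on (sphere (0::complex) 1) h" "inj_on h (sphere 0 1)" "h ` sphere 0 1 = J'"
    using homeomorphic_sym unfolding homeomorphic_def homeomorphism_def by (metis inj_on_inverseI)
  define \<gamma> where "\<gamma> = h \<circ> circlepath 0 1"
  have "simple_path \<gamma>" "path_image \<gamma> = J'" "pathfinish \<gamma> = pathstart \<gamma>"
  proof -
    have "simple_path (circlepath 0 1)" by (simp add: simple_path_circlepath)
    moreover have img: "path_image (circlepath 0 1) = sphere (0::complex) 1" by (simp add: path_image_circlepath)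
    ultimately show "simple_path \<gamma>"
      unfolding \<gamma>_def using h by (intro simple_path_continuous_image) (simp_all only: img)
    show "path_image \<gamma> = J'" unfolding \<gamma>_def path_image_compose img by (rule h(3))
    show "pathfinish \<gamma> = pathstart \<gamma>" by (simp add: \<gamma>_def pathfinish_compose pathstart_compose)
  qed
  note \<gamma> = this
  have jordan: "inside J' \<noteq> {}" "open (inside J')" "bounded (inside J')" "frontier (inside J') = J'"
    using Jordan_inside_outside[OF \<gamma>(1,3)] unfolding \<gamma>(2) by auto
  have sc: "simply_connected (inside J')" using simply_connected_inside_simple_path[OF \<gamma>(1)] by (simp add: \<gamma>(2))
  have "locally connected (sphere (0::complex) 1)" by (rule locally_connected_sphere)
  then have lc: "locally connected (frontier (inside J'))"
    unfolding jordan(4) using homeomorphic_locally[OF hom] homeomorphic_connectedness by blast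
  obtain a b B C where ab: "B \<noteq> 0" "\<forall>c\<in>{0..1}. a 0 c = (2 * c - 1) *\<^sub>R B"
    "\<forall>n. arc_move (C / 4 ^ n) (a n) (a (Suc n))"
    "\<forall>c\<in>{0..1}. (\<lambda>n. a n c) \<longlonglongrightarrow> b c" "b ` {0..1} = J'"
    using frontier_limit_of_arc_moves[OF jordan(2,3,1) sc lc] unfolding jordan(4) by blast
  have "funnel_section ((\<lambda>c. ?\<iota> (b c)) ` {0..1})"
  proof (rule funnel_section_limit_of_moves)
    show "?\<iota> B \<noteq> 0" using ab(1) plane_of_complex(2) by (metis norm_eq_zero)
    show "?\<iota> (a 0 c) = 0 + (2 * c - 1) *\<^sub>R ?\<iota> B" if "c \<in> {0..1}" for c by (simp add: ab(2)[rule_format, OF that] \<iota>.scaleR)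
    show "arc_move (C / 4 ^ n) (\<lambda>c. ?\<iota> (a n c)) (\<lambda>c. ?\<iota> (a (Suc n) c))" for n
      by (rule arc_move_isometry[OF plane_of_complex(1,2) ab(3)[rule_format]])
    show "(\<lambda>n. ?\<iota> (a n c)) \<longlonglongrightarrow> ?\<iota> (b c)" if "c \<in> {0..1}" for c
      by (rule \<iota>.tendsto[OF ab(4)[rule_format, OF that]])
  qed
  moreover have "(\<lambda>c. ?\<iota> (b c)) ` {0..1} = J" using ab(5) JJ' by (metis image_image)
  ultimately show ?thesis by simp
qed

end
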